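(* Let $\mathcal VM$ be a relative tractor bundle on a parabolic geometry of type $(G,Q)$ and let $\nabla^{\rho,\mathcal V}$ be the associated relative tractor connection. Then for $\varphi\in\Omega^k_\rho(M,\mathcal VM)$ the relative twisted exterior derivative satisfies $$d^{\mathcal V}\varphi(\xi_0,\dots,\xi_k)=\sum_{i=0}^k(-1)^i\nabla^{\rho,\mathcal V}_{\xi_i}\bigl(\varphi(\xi_0,\dots,\widehat{\xi_i},\dots,\xi_k)\bigr)+\sum_{i<j}(-1)^{i+j}\varphi([\![\xi_i,\xi_j]\!],\xi_0,\dots,\widehat{\xi_i},\dots,\widehat{\xi_j},\dots,\xi_k)$$ for all $\xi_0,\dots,\xi_k\in\Gamma(T_\rho M)$.
   Context: $G$ is a real or complex semisimple Lie group with Lie algebra $\mathfrak g$; $\mathfrak q\subset\mathfrak p\subset\mathfrak g$ are nested parabolic subalgebras ($\mathfrak p=\mathfrak g$ allowed); $P\subset G$ is a parabolic subgroup with Lie algebra $\mathfrak p$, $Q\subset P$ the normalizer of $\mathfrak q$ in $P$. Nilradicals: $\mathfrak p_+\subset\mathfrak q_+\subset\mathfrak q\subset\mathfrak p$; $P_+=\exp(\mathfrak p_+)$. A parabolic geometry of type $(G,Q)$ is a principal $Q$-bundle $\mathcal G\to M$ with a Cartan connection $\omega\in\Omega^1(\mathcal G,\mathfrak g)$. A relative natural bundle is $\mathcal G\times_Q\mathbb W$ with $\mathbb W$ a $Q$-representation on which $P_+$ acts trivially; a relative tractor bundle is $\mathcal VM=\mathcal G\times_Q\mathbb V$ for a finite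 dimensional representation $\mathbb V$ of $P$ on which $P_+$ acts trivially. $T_\rho M=\mathcal G\times_Q(\mathfrak p/\mathfrak q)\subset TM$; $\Omega^k_\rho(M,\mathcal VM)=\Gamma(\Lambda^kT^*_\rho M\otimes\mathcal VM)$. $\mathcal AM=\mathcal G\times_Q\mathfrak g$, $\mathcal A_\rho M=\mathcal G\times_Q(\mathfrak p/\mathfrak p_+)$, $\mathcal A^0_\rho M=\mathcal G\times_Q(\mathfrak q/\mathfrak p_+)$, $\Pi_\rho:\mathcal A_\rho M\to\mathcal A_\rho M/\mathcal A^0_\rho M=T_\rho M$ the projection. Via $\Pi_\rho$, $\Omega^k_\rho(M,\mathcal VM)$ is the subspace of $\Gamma(\Lambda^k\mathcal A^*_\rho M\otimes\mathcal VM)$ of elements vanishing upon insertion of one section of $\mathcal A^0_\rho M$. The bracket of $\mathfrak p/\mathfrak p_+$ and its action on $\mathbb V$ induce $\{\ ,\ \}$ on $\mathcal A_\rho M$ and $\bullet:\mathcal A_\rho M\times\mathcal VM\to\mathcal VM$. Relative fundamental derivative: for a relative natural bundle $E$, $s\in\Gamma(\mathcal A_\rho M)$, $\sigma\in\Gamma(E)$, $D^\rho_s\sigma$ is obtained by choosing $\tilde s\in\Gamma(\mathcal G\times_Q\mathfrak p)\subset\Gamma(\mathcal AM)$ projecting to $s$, viewing $\tilde s$ via $\omega$ as a $Q$-invariant vector field on $\mathcal G$, and differentiating along it the $Q$-equivariant function corresponding to $\sigma$ (independent of the choice). The relative twisted exterior derivative $d^{\mathcal V}$ is the restriction to relative forms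 of $$\tilde d^{\mathcal V}\varphi(s_0,\dots,s_k)=\sum_{i}(-1)^i(D^\rho_{s_i}\varphi)(s_0,\dots,\widehat{s_i},\dots,s_k)+\sum_i(-1)^is_i\bullet\varphi(s_0,\dots,\widehat{s_i},\dots,s_k)+\sum_{i<j}(-1)^{i+j}\varphi(\{s_i,s_j\},s_0,\dots,\widehat{s_i},\dots,\widehat{s_j},\dots,s_k).$$ The relative tractor connection is the partial connection $\nabla^{\rho,\mathcal V}:\Gamma(T_\rho M)\times\Gamma(\mathcal VM)\to\Gamma(\mathcal VM)$ with $\nabla^{\rho,\mathcal V}_{\Pi_\rho(s)}\sigma=D^\rho_s\sigma+s\bullet\sigma$. The operation $[\![\ ,\ ]\!]:\Gamma(T_\rho M)\times\Gamma(T_\rho M)\to\Gamma(T_\rho M)$ is the (well defined) skew symmetric bilinear operator with $[\![\Pi_\rho(s_1),\Pi_\rho(s_2)]\!]=\Pi_\rho(D^\rho_{s_1}s_2-D^\rho_{s_2}s_1+\{s_1,s_2\})$. *)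

theory Defs
  imports "HOL-Analysis.Analysis" "HOL-Algebra.Group"
begin

section \<open>Finite-dimensional vector spaces and smooth functions between them\<close>

text \<open>Finite dimension is a class that, unlike \<open>euclidean_space\<close>, admits the zero space; quotients
  such as \<open>\<pp>/\<qq>\<close> may be zero.\<close>

class fin_dim_vector = real_vector +
  assumes finite_spanning_set: "\<exists>B. finite B \<and> (\<forall>x. \<exists>c. x = (\<Sum>b\<in>B. scaleR (c b) b))"

instance euclidean_space \<subseteq> fin_dim_vector
  by standard (metis finite_Basis euclidean_representation)

fun Ck_on :: "nat \<Rightarrow> ('a::real_normed_vector \<Rightarrow> 'b::real_normed_vector) \<Rightarrow> 'a set \<Rightarrow> bool" where
  "Ck_on 0 f S \<longleftrightarrow> continuous_on S f"
| "Ck_on (Suc k) f S \<longleftrightarrow>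
     (\<forall>x\<in>S. f differentiable (at x)) \<and> (\<forall>v. Ck_on k (\<lambda>x. frechet_derivative f (at x) v) S)"

text \<open>Only used on open subsets of finite-dimensional spaces.\<close>

definition smooth_on :: "'a::real_normed_vector set \<Rightarrow> ('a \<Rightarrow> 'b::real_normed_vector) \<Rightarrow> bool" where
  "smooth_on S f \<longleftrightarrow> (\<forall>k. Ck_on k f S)"


section \<open>Smooth manifolds\<close>

type_synonym ('a, 'e) atlas = "('a set \<times> ('a \<Rightarrow> 'e)) set"

definition smooth_manifold ::
  "('a::{t2_space,second_countable_topology}, 'e::{real_normed_vector,fin_dim_vector}) atlas \<Rightarrow> bool" where
  "smooth_manifold A \<longleftrightarrow>
     (\<Union>(U, \<phi>)\<in>A. U) = UNIV \<and>
     (\<forall>(U, \<phi>)\<in>A. open U \<and> open (\<phi> ` U) \<and> (\<exists>\<psi>. homeomorphism U (\<phi> ` U) \<phi> \<psi>)) \<and>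
     (\<forall>(U, \<phi>)\<in>A. \<forall>(V, \<psi>)\<in>A. smooth_on (\<phi> ` (U \<inter> V)) (\<psi> \<circ> inv_into U \<phi>))"

definition prod_atlas :: "('a, 'e) atlas \<Rightarrow> ('b, 'f) atlas \<Rightarrow> ('a \<times> 'b, 'e \<times> 'f) atlas" where
  "prod_atlas A B = {(U \<times> V, map_prod \<phi> \<psi>) | U \<phi> V \<psi>. (U, \<phi>) \<in> A \<and> (V, \<psi>) \<in> B}"

definition real_atlas :: "(real, real) atlas" where
  "real_atlas = {(UNIV, \<lambda>t. t)}"

definition smooth_map ::
  "('a::topological_space, 'e::real_normed_vector) atlas \<Rightarrow> ('b::topological_space, 'f::real_normed_vector) atlas
    \<Rightarrow> 'a set \<Rightarrow> ('a \<Rightarrow> 'b) \<Rightarrow> bool" where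
  "smooth_map A B W f \<longleftrightarrow> continuous_on W f \<and>
     (\<forall>(U, \<phi>)\<in>A. \<forall>(V, \<psi>)\<in>B. smooth_on (\<phi> ` (U \<inter> W \<inter> f -` V)) (\<psi> \<circ> f \<circ> inv_into U \<phi>))"

text \<open>Smoothness of a function with values in a finite-dimensional vector space (which carries no
  norm here) is smoothness of all its components.\<close>

definition smooth_fun ::
  "('a::topological_space, 'e::real_normed_vector) atlas \<Rightarrow> 'a set \<Rightarrow> ('a \<Rightarrow> 'w::fin_dim_vector) \<Rightarrow> bool" where
  "smooth_fun A W f \<longleftrightarrow>
     (\<forall>l::'w \<Rightarrow> real. linear l \<longrightarrow> (\<forall>(U, \<phi>)\<in>A. smooth_on (\<phi> ` (U \<inter> W)) (l \<circ> f \<circ> inv_into U \<phi>)))"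

text \<open>Maps defined on an arbitrary subset are smooth if they extend smoothly near each of its
  points. For embedded submanifolds, in particular for closed subgroups of Lie groups, this is
  smoothness for the induced manifold structure.\<close>

definition smooth_map_on_subset ::
  "('a::topological_space, 'e::real_normed_vector) atlas \<Rightarrow> ('b::topological_space, 'f::real_normed_vector) atlas
    \<Rightarrow> 'a set \<Rightarrow> ('a \<Rightarrow> 'b) \<Rightarrow> bool" where
  "smooth_map_on_subset A B S f \<longleftrightarrow>
     (\<forall>x\<in>S. \<exists>U F. open U \<and> x \<in> U \<and> smooth_map A B U F \<and> (\<forall>y\<in>U \<inter> S. F y = f y))"

definition smooth_fun_on_subset ::
  "('a::topological_space, 'e::real_normed_vector) atlas \<Rightarrow> 'a set \<Rightarrow> ('a \<Rightarrow> 'w::fin_dim_vector) \<Rightarrow> bool" where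
  "smooth_fun_on_subset A S f \<longleftrightarrow>
     (\<forall>x\<in>S. \<exists>U F. open U \<and> x \<in> U \<and> smooth_fun A U F \<and> (\<forall>y\<in>U \<inter> S. F y = f y))"

text \<open>Tangent vectors at \<open>x\<close> are the derivations of the algebra of germs at \<open>x\<close> of smooth
  real functions. As total functions, they are set to 0 on functions that are not smooth near
  \<open>x\<close>.\<close>

definition smooth_at :: "('a::topological_space, 'e::real_normed_vector) atlas \<Rightarrow> 'a \<Rightarrow> ('a \<Rightarrow> real) \<Rightarrow> bool" where
  "smooth_at A x f \<longleftrightarrow> (\<exists>U. open U \<and> x \<in> U \<and> smooth_fun A U f)"

definition tangent_space ::
  "('a::topological_space, 'e::real_normed_vector) atlas \<Rightarrow> 'a \<Rightarrow> (('a \<Rightarrow> real) \<Rightarrow> real) set" where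
  "tangent_space A x = {v.
     (\<forall>f. \<not> smooth_at A x f \<longrightarrow> v f = 0) \<and>
     (\<forall>f g. smooth_at A x f \<and> smooth_at A x g \<longrightarrow>
        v (\<lambda>y. f y + g y) = v f + v g \<and>
        v (\<lambda>y. f y * g y) = f x * v g + g x * v f \<and>
        (eventually (\<lambda>y. f y = g y) (nhds x) \<longrightarrow> v f = v g)) \<and>
     (\<forall>f c. smooth_at A x f \<longrightarrow> v (\<lambda>y. c * f y) = c * v f)}"

definition pushforward ::
  "('b::topological_space, 'f::real_normed_vector) atlas \<Rightarrow> ('a \<Rightarrow> 'b) \<Rightarrow> 'a
    \<Rightarrow> (('a \<Rightarrow> real) \<Rightarrow> real) \<Rightarrow> (('b \<Rightarrow> real) \<Rightarrow> real)" where
  "pushforward B F x v = (\<lambda>f. if smooth_at B (F x) f then v (f \<circ> F) else 0)"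

definition velocity ::
  "('a::topological_space, 'e::real_normed_vector) atlas \<Rightarrow> (real \<Rightarrow> 'a) \<Rightarrow> (('a \<Rightarrow> real) \<Rightarrow> real)" where
  "velocity A c = (\<lambda>f. if smooth_at A (c 0) f then deriv (f \<circ> c) 0 else 0)"

definition dir_deriv :: "(('a \<Rightarrow> real) \<Rightarrow> real) \<Rightarrow> ('a \<Rightarrow> 'w::fin_dim_vector) \<Rightarrow> 'w" where
  "dir_deriv v f = (THE w. \<forall>l::'w \<Rightarrow> real. linear l \<longrightarrow> l w = v (l \<circ> f))"

definition smooth_vector_field ::
  "('a::topological_space, 'e::real_normed_vector) atlas \<Rightarrow> 'a set \<Rightarrow> ('a \<Rightarrow> ('a \<Rightarrow> real) \<Rightarrow> real) \<Rightarrow> bool" where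
  "smooth_vector_field A U X \<longleftrightarrow> (\<forall>x\<in>U. X x \<in> tangent_space A x) \<and>
     (\<forall>V f. open V \<and> V \<subseteq> U \<and> smooth_fun A V f \<longrightarrow> smooth_fun A V (\<lambda>x. X x f))"


section \<open>Lie algebras\<close>

definition lie_algebra :: "('g::real_vector \<Rightarrow> 'g \<Rightarrow> 'g) \<Rightarrow> bool" where
  "lie_algebra lb \<longleftrightarrow> (\<forall>X. linear (lb X)) \<and> (\<forall>Y. linear (\<lambda>X. lb X Y)) \<and> (\<forall>X. lb X X = 0) \<and>
     (\<forall>X Y Z. lb X (lb Y Z) + lb Y (lb Z X) + lb Z (lb X Y) = 0)"

definition lie_subalgebra :: "('g::real_vector \<Rightarrow> 'g \<Rightarrow> 'g) \<Rightarrow> 'g set \<Rightarrow> bool" where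
  "lie_subalgebra lb S \<longleftrightarrow> subspace S \<and> (\<forall>X\<in>S. \<forall>Y\<in>S. lb X Y \<in> S)"

definition lie_ideal :: "('g::real_vector \<Rightarrow> 'g \<Rightarrow> 'g) \<Rightarrow> 'g set \<Rightarrow> 'g set \<Rightarrow> bool" where
  "lie_ideal lb S I \<longleftrightarrow> subspace I \<and> I \<subseteq> S \<and> (\<forall>X\<in>S. \<forall>Y\<in>I. lb X Y \<in> I)"

definition bracket_span :: "('g::real_vector \<Rightarrow> 'g \<Rightarrow> 'g) \<Rightarrow> 'g set \<Rightarrow> 'g set \<Rightarrow> 'g set" where
  "bracket_span lb A B = span {lb X Y | X Y. X \<in> A \<and> Y \<in> B}"

definition lie_solvable :: "('g::real_vector \<Rightarrow> 'g \<Rightarrow> 'g) \<Rightarrow> 'g set \<Rightarrow> bool" where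
  "lie_solvable lb S \<longleftrightarrow> (\<exists>n. ((\<lambda>D. bracket_span lb D D) ^^ n) S = {0})"

definition lie_nilpotent :: "('g::real_vector \<Rightarrow> 'g \<Rightarrow> 'g) \<Rightarrow> 'g set \<Rightarrow> bool" where
  "lie_nilpotent lb S \<longleftrightarrow> (\<exists>n. ((\<lambda>C. bracket_span lb S C) ^^ n) S = {0})"

definition is_nilradical :: "('g::real_vector \<Rightarrow> 'g \<Rightarrow> 'g) \<Rightarrow> 'g set \<Rightarrow> 'g set \<Rightarrow> bool" where
  "is_nilradical lb S N \<longleftrightarrow> lie_ideal lb S N \<and> lie_nilpotent lb N \<and>
     (\<forall>I. lie_ideal lb S I \<and> lie_nilpotent lb I \<longrightarrow> I \<subseteq> N)"

definition semisimple :: "('g::real_vector \<Rightarrow> 'g \<Rightarrow> 'g) \<Rightarrow> bool" where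
  "semisimple lb \<longleftrightarrow> (\<forall>I. lie_ideal lb UNIV I \<and> lie_solvable lb I \<longrightarrow> I = {0})"

text \<open>A complex Lie algebra is a real one with a complex structure \<open>J\<close> (multiplication by the
  imaginary unit) for which the bracket is complex bilinear.\<close>

definition complex_structure :: "('g::real_vector \<Rightarrow> 'g \<Rightarrow> 'g) \<Rightarrow> ('g \<Rightarrow> 'g) \<Rightarrow> bool" where
  "complex_structure lb J \<longleftrightarrow> linear J \<and> (\<forall>X. J (J X) = - X) \<and> (\<forall>X Y. lb (J X) Y = J (lb X Y))"

definition complex_semisimple :: "('g::real_vector \<Rightarrow> 'g \<Rightarrow> 'g) \<Rightarrow> ('g \<Rightarrow> 'g) \<Rightarrow> bool" where
  "complex_semisimple lb J \<longleftrightarrow>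
     (\<forall>I. lie_ideal lb UNIV I \<and> J ` I \<subseteq> I \<and> lie_solvable lb I \<longrightarrow> I = {0})"

definition borel_subalgebra :: "('g::real_vector \<Rightarrow> 'g \<Rightarrow> 'g) \<Rightarrow> ('g \<Rightarrow> 'g) \<Rightarrow> 'g set \<Rightarrow> bool" where
  "borel_subalgebra lb J b \<longleftrightarrow> lie_subalgebra lb b \<and> J ` b \<subseteq> b \<and> lie_solvable lb b \<and>
     (\<forall>b'. lie_subalgebra lb b' \<and> J ` b' \<subseteq> b' \<and> lie_solvable lb b' \<and> b \<subseteq> b' \<longrightarrow> b' = b)"

definition complex_parabolic :: "('g::real_vector \<Rightarrow> 'g \<Rightarrow> 'g) \<Rightarrow> ('g \<Rightarrow> 'g) \<Rightarrow> 'g set \<Rightarrow> bool" where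
  "complex_parabolic lb J p \<longleftrightarrow> lie_subalgebra lb p \<and> J ` p \<subseteq> p \<and> (\<exists>b\<subseteq>p. borel_subalgebra lb J b)"

text \<open>The complexification, with \<open>(X, Y)\<close> standing for \<open>X + i Y\<close>.\<close>

definition complexified_bracket ::
  "('g::real_vector \<Rightarrow> 'g \<Rightarrow> 'g) \<Rightarrow> 'g \<times> 'g \<Rightarrow> 'g \<times> 'g \<Rightarrow> 'g \<times> 'g" where
  "complexified_bracket lb = (\<lambda>(X, Y) (X', Y'). (lb X X' - lb Y Y', lb X Y' + lb Y X'))"

definition real_parabolic :: "('g::real_vector \<Rightarrow> 'g \<Rightarrow> 'g) \<Rightarrow> 'g set \<Rightarrow> bool" where
  "real_parabolic lb p \<longleftrightarrow> lie_subalgebra lb p \<and>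
     complex_parabolic (complexified_bracket lb) (\<lambda>(X, Y). (- Y, X)) (p \<times> p)"


section \<open>Lie groups\<close>

definition lie_group ::
  "'x::{t2_space,second_countable_topology} monoid \<Rightarrow> ('x, 'e::{real_normed_vector,fin_dim_vector}) atlas \<Rightarrow> bool" where
  "lie_group G A \<longleftrightarrow> smooth_manifold A \<and> group G \<and> carrier G = UNIV \<and>
     smooth_map (prod_atlas A A) A UNIV (\<lambda>(x, y). x \<otimes>\<^bsub>G\<^esub> y) \<and> smooth_map A A UNIV (\<lambda>x. inv\<^bsub>G\<^esub> x)"

text \<open>\<open>\<iota>\<close> identifies the Lie algebra \<open>('g, lb)\<close> with the tangent space at the identity. The vector
  field \<open>h \<mapsto> (f \<mapsto> \<iota> Y (\<lambda>h'. f (h h')))\<close> is the left invariant field generated by \<open>Y\<close>,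
  and the bracket is the commutator of left invariant fields.\<close>

definition lie_algebra_of_group ::
  "'x::topological_space monoid \<Rightarrow> ('x, 'e::real_normed_vector) atlas
    \<Rightarrow> ('g::fin_dim_vector \<Rightarrow> ('x \<Rightarrow> real) \<Rightarrow> real) \<Rightarrow> ('g \<Rightarrow> 'g \<Rightarrow> 'g) \<Rightarrow> bool" where
  "lie_algebra_of_group G A \<iota> lb \<longleftrightarrow> lie_algebra lb \<and>
     bij_betw \<iota> UNIV (tangent_space A \<one>\<^bsub>G\<^esub>) \<and>
     (\<forall>X Y f. \<iota> (X + Y) f = \<iota> X f + \<iota> Y f) \<and> (\<forall>c X f. \<iota> (c *\<^sub>R X) f = c * \<iota> X f) \<and>
     (\<forall>X Y f. smooth_at A \<one>\<^bsub>G\<^esub> f \<longrightarrow>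
        \<iota> (lb X Y) f = \<iota> X (\<lambda>h. \<iota> Y (\<lambda>h'. f (h \<otimes>\<^bsub>G\<^esub> h'))) - \<iota> Y (\<lambda>h. \<iota> X (\<lambda>h'. f (h \<otimes>\<^bsub>G\<^esub> h'))))"

definition Ad ::
  "'x::topological_space monoid \<Rightarrow> ('x, 'e::real_normed_vector) atlas
    \<Rightarrow> ('g \<Rightarrow> ('x \<Rightarrow> real) \<Rightarrow> real) \<Rightarrow> 'x \<Rightarrow> 'g \<Rightarrow> 'g" where
  "Ad G A \<iota> x X =
     inv_into UNIV \<iota> (pushforward A (\<lambda>h. x \<otimes>\<^bsub>G\<^esub> h \<otimes>\<^bsub>G\<^esub> inv\<^bsub>G\<^esub> x) \<one>\<^bsub>G\<^esub> (\<iota> X))"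

text \<open>\<open>generates G A \<iota> X c\<close> says that \<open>c\<close> is the one-parameter subgroup \<open>t \<mapsto> exp (t X)\<close>; in
  particular \<open>exp X = c 1\<close>.\<close>

definition generates ::
  "'x::topological_space monoid \<Rightarrow> ('x, 'e::real_normed_vector) atlas
    \<Rightarrow> ('g \<Rightarrow> ('x \<Rightarrow> real) \<Rightarrow> real) \<Rightarrow> 'g \<Rightarrow> (real \<Rightarrow> 'x) \<Rightarrow> bool" where
  "generates G A \<iota> X c \<longleftrightarrow> smooth_map real_atlas A UNIV c \<and>
     (\<forall>s t. c (s + t) = c s \<otimes>\<^bsub>G\<^esub> c t) \<and> velocity A c = \<iota> X"

definition exp_image ::
  "'x::topological_space monoid \<Rightarrow> ('x, 'e::real_normed_vector) atlas
    \<Rightarrow> ('g \<Rightarrow> ('x \<Rightarrow> real) \<Rightarrow> real) \<Rightarrow> 'g set \<Rightarrow> 'x set" where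
  "exp_image G A \<iota> S = {c 1 | c X. X \<in> S \<and> generates G A \<iota> X c}"

text \<open>The Lie algebra of a closed subgroup \<open>H\<close>.\<close>

definition lie_subgroup_algebra ::
  "'x::topological_space monoid \<Rightarrow> ('x, 'e::real_normed_vector) atlas
    \<Rightarrow> ('g \<Rightarrow> ('x \<Rightarrow> real) \<Rightarrow> real) \<Rightarrow> 'x set \<Rightarrow> 'g set" where
  "lie_subgroup_algebra G A \<iota> H = {X. \<exists>c. generates G A \<iota> X c \<and> range c \<subseteq> H}"

text \<open>A complex Lie group is described by its underlying real Lie group and an \<open>Ad\<close>-invariant
  complex structure on the Lie algebra.\<close>

definition semisimple_with_parabolics ::
  "'x::topological_space monoid \<Rightarrow> ('x, 'e::real_normed_vector) atlas
    \<Rightarrow> ('g::real_vector \<Rightarrow> ('x \<Rightarrow> real) \<Rightarrow> real) \<Rightarrow> ('g \<Rightarrow> 'g \<Rightarrow> 'g) \<Rightarrow> 'g set \<Rightarrow> 'g set \<Rightarrow> bool" where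
  "semisimple_with_parabolics G A \<iota> lb q p \<longleftrightarrow> q \<subseteq> p \<and>
     ((semisimple lb \<and> real_parabolic lb q \<and> real_parabolic lb p) \<or>
      (\<exists>J. complex_structure lb J \<and> (\<forall>x X. Ad G A \<iota> x (J X) = J (Ad G A \<iota> x X)) \<and>
           complex_semisimple lb J \<and> complex_parabolic lb J q \<and> complex_parabolic lb J p))"

definition group_rep ::
  "'x::topological_space monoid \<Rightarrow> ('x, 'e::real_normed_vector) atlas \<Rightarrow> 'x set
    \<Rightarrow> ('x \<Rightarrow> 'v::fin_dim_vector \<Rightarrow> 'v) \<Rightarrow> bool" where
  "group_rep G A H \<rho> \<longleftrightarrow> (\<forall>x\<in>H. linear (\<rho> x)) \<and> (\<forall>v. \<rho> \<one>\<^bsub>G\<^esub> v = v) \<and>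
     (\<forall>x\<in>H. \<forall>y\<in>H. \<forall>v. \<rho> (x \<otimes>\<^bsub>G\<^esub> y) v = \<rho> x (\<rho> y v)) \<and>
     (\<forall>v. smooth_fun_on_subset A H (\<lambda>x. \<rho> x v))"

text \<open>The infinitesimal action on \<open>v\<close> of \<open>X\<close> in the Lie algebra of \<open>H\<close>.\<close>

definition infinitesimal_action ::
  "'x::topological_space monoid \<Rightarrow> ('x, 'e::real_normed_vector) atlas
    \<Rightarrow> ('g \<Rightarrow> ('x \<Rightarrow> real) \<Rightarrow> real) \<Rightarrow> 'x set \<Rightarrow> ('x \<Rightarrow> 'v::fin_dim_vector \<Rightarrow> 'v) \<Rightarrow> 'g \<Rightarrow> 'v \<Rightarrow> 'v" where
  "infinitesimal_action G A \<iota> H \<rho> X v =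
     (THE w. \<forall>c. generates G A \<iota> X c \<and> range c \<subseteq> H \<longrightarrow>
        (\<forall>l::'v \<Rightarrow> real. linear l \<longrightarrow> ((\<lambda>t. l (\<rho> (c t) v)) has_real_derivative l w) (at 0)))"


section \<open>Principal bundles and Cartan connections\<close>

text \<open>\<open>Q\<close> is a closed subgroup of the Lie group \<open>(G, AG)\<close>; \<open>act u g\<close> is the right action of
  \<open>g \<in> Q\<close> on the total space \<open>(\<P>, AB)\<close> over the base \<open>(M, AM)\<close>; \<open>\<theta>\<close> and \<open>\<psi>\<close> are a local
  trivialization and its inverse.\<close>

definition principal_bundle ::
  "'x::{t2_space,second_countable_topology} monoid \<Rightarrow> ('x, 'e::real_normed_vector) atlas \<Rightarrow> 'x set
    \<Rightarrow> ('u::{t2_space,second_countable_topology}, 'f::{real_normed_vector,fin_dim_vector}) atlas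
    \<Rightarrow> ('b::{t2_space,second_countable_topology}, 'm::{real_normed_vector,fin_dim_vector}) atlas
    \<Rightarrow> ('u \<Rightarrow> 'b) \<Rightarrow> ('u \<Rightarrow> 'x \<Rightarrow> 'u) \<Rightarrow> bool" where
  "principal_bundle G AG Q AB AM \<pi> act \<longleftrightarrow>
     smooth_manifold AB \<and> smooth_manifold AM \<and> smooth_map AB AM UNIV \<pi> \<and>
     (\<forall>u. act u \<one>\<^bsub>G\<^esub> = u) \<and>
     (\<forall>u. \<forall>g\<in>Q. \<forall>h\<in>Q. act u (g \<otimes>\<^bsub>G\<^esub> h) = act (act u g) h) \<and>
     smooth_map_on_subset (prod_atlas AB AG) AB (UNIV \<times> Q) (\<lambda>(u, g). act u g) \<and>
     (\<forall>x. \<exists>U \<theta> \<psi>. open U \<and> x \<in> U \<and>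
        smooth_map AB (prod_atlas AM AG) (\<pi> -` U) \<theta> \<and>
        smooth_map_on_subset (prod_atlas AM AG) AB (U \<times> Q) \<psi> \<and>
        (\<forall>u\<in>\<pi> -` U. \<theta> u \<in> U \<times> Q \<and> \<psi> (\<theta> u) = u \<and> fst (\<theta> u) = \<pi> u) \<and>
        (\<forall>z\<in>U \<times> Q. \<psi> z \<in> \<pi> -` U \<and> \<theta> (\<psi> z) = z) \<and>
        (\<forall>u\<in>\<pi> -` U. \<forall>g\<in>Q. \<theta> (act u g) = (\<pi> u, snd (\<theta> u) \<otimes>\<^bsub>G\<^esub> g)))"

definition cartan_connection ::
  "'x::topological_space monoid \<Rightarrow> ('x, 'e::real_normed_vector) atlas
    \<Rightarrow> ('g::fin_dim_vector \<Rightarrow> ('x \<Rightarrow> real) \<Rightarrow> real) \<Rightarrow> 'x set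
    \<Rightarrow> ('u::topological_space, 'f::real_normed_vector) atlas \<Rightarrow> ('u \<Rightarrow> 'x \<Rightarrow> 'u)
    \<Rightarrow> ('u \<Rightarrow> (('u \<Rightarrow> real) \<Rightarrow> real) \<Rightarrow> 'g) \<Rightarrow> bool" where
  "cartan_connection G AG \<iota> Q AB act \<omega> \<longleftrightarrow>
     (\<forall>u. bij_betw (\<omega> u) (tangent_space AB u) UNIV \<and>
        (\<forall>v\<in>tangent_space AB u. \<forall>w\<in>tangent_space AB u. \<omega> u (\<lambda>f. v f + w f) = \<omega> u v + \<omega> u w) \<and>
        (\<forall>v\<in>tangent_space AB u. \<forall>c. \<omega> u (\<lambda>f. c * v f) = c *\<^sub>R \<omega> u v)) \<and>
     (\<forall>U X. open U \<and> smooth_vector_field AB U X \<longrightarrow> smooth_fun AB U (\<lambda>u. \<omega> u (X u))) \<and>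
     (\<forall>u. \<forall>g\<in>Q. \<forall>v\<in>tangent_space AB u.
        \<omega> (act u g) (pushforward AB (\<lambda>u'. act u' g) u v) = Ad G AG \<iota> (inv\<^bsub>G\<^esub> g) (\<omega> u v)) \<and>
     (\<forall>X c. generates G AG \<iota> X c \<and> range c \<subseteq> Q \<longrightarrow>
        (\<forall>u. \<omega> u (velocity AB (\<lambda>t. act u (c t))) = X))"


section \<open>Parabolic geometries of type \<open>(G, Q)\<close> relative to \<open>P\<close>\<close>

text \<open>\<open>qmap S \<pi> N\<close>: the restriction of \<open>\<pi>\<close> to \<open>S\<close> is the projection onto (a realization of)
  the quotient space \<open>S/N\<close>. \<open>descend S \<pi> F y\<close> is the value at \<open>y\<close> of the map that \<open>F\<close> induces on
  the quotient; using it presupposes that \<open>F\<close> is constant on the fibres of \<open>\<pi>\<close>.\<close>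

definition qmap :: "'a::real_vector set \<Rightarrow> ('a \<Rightarrow> 'b::real_vector) \<Rightarrow> 'a set \<Rightarrow> bool" where
  "qmap S \<pi> N \<longleftrightarrow> linear \<pi> \<and> \<pi> ` S = UNIV \<and> {X \<in> S. \<pi> X = 0} = N"

definition descend :: "'a set \<Rightarrow> ('a \<Rightarrow> 'b) \<Rightarrow> ('a \<Rightarrow> 'c) \<Rightarrow> 'b \<Rightarrow> 'c" where
  "descend S \<pi> F y = (THE z. \<forall>X\<in>S. \<pi> X = y \<longrightarrow> z = F X)"

text \<open>\<open>quotA\<close> projects \<open>\<pp>\<close> onto \<open>\<pp>/\<pp>\<^sub>+\<close> (type \<open>'r\<close>) and \<open>projT\<close> projects
  \<open>\<pp>/\<pp>\<^sub>+\<close> onto \<open>\<pp>/\<qq>\<close> (type \<open>'t\<close>); the latter induces \<open>\<Pi>\<^sub>\<rho>\<close>.\<close>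

record ('x, 'e, 'g, 'u, 'f, 'b, 'm, 'r, 't) par_geom =
  grp :: "'x monoid"
  grp_atlas :: "('x, 'e) atlas"
  alg_id :: "'g \<Rightarrow> ('x \<Rightarrow> real) \<Rightarrow> real"
  lbr :: "'g \<Rightarrow> 'g \<Rightarrow> 'g"
  alg_q :: "'g set"
  alg_p :: "'g set"
  nil_p :: "'g set"
  grp_P :: "'x set"
  tot_atlas :: "('u, 'f) atlas"
  base_atlas :: "('b, 'm) atlas"
  proj :: "'u \<Rightarrow> 'b"
  ract :: "'u \<Rightarrow> 'x \<Rightarrow> 'u"
  cartan :: "'u \<Rightarrow> (('u \<Rightarrow> real) \<Rightarrow> real) \<Rightarrow> 'g"
  quotA :: "'g \<Rightarrow> 'r"
  projT :: "'r \<Rightarrow> 't"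

abbreviation AdG ::
  "('x::topological_space, 'e::real_normed_vector, 'g, 'u, 'f, 'b, 'm, 'r, 't) par_geom \<Rightarrow> 'x \<Rightarrow> 'g \<Rightarrow> 'g" where
  "AdG \<G> \<equiv> Ad (grp \<G>) (grp_atlas \<G>) (alg_id \<G>)"

definition grp_Q ::
  "('x::topological_space, 'e::real_normed_vector, 'g, 'u, 'f, 'b, 'm, 'r, 't) par_geom \<Rightarrow> 'x set" where
  "grp_Q \<G> = {x \<in> grp_P \<G>. AdG \<G> x ` alg_q \<G> = alg_q \<G>}"

definition grp_P_plus ::
  "('x::topological_space, 'e::real_normed_vector, 'g, 'u, 'f, 'b, 'm, 'r, 't) par_geom \<Rightarrow> 'x set" where
  "grp_P_plus \<G> = exp_image (grp \<G>) (grp_atlas \<G>) (alg_id \<G>) (nil_p \<G>)"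

definition parabolic_geometry ::
  "('x::{t2_space,second_countable_topology}, 'e::{real_normed_vector,fin_dim_vector}, 'g::fin_dim_vector,
    'u::{t2_space,second_countable_topology}, 'f::{real_normed_vector,fin_dim_vector},
    'b::{t2_space,second_countable_topology}, 'm::{real_normed_vector,fin_dim_vector},
    'r::fin_dim_vector, 't::fin_dim_vector) par_geom \<Rightarrow> bool" where
  "parabolic_geometry \<G> \<longleftrightarrow>
     lie_group (grp \<G>) (grp_atlas \<G>) \<and>
     lie_algebra_of_group (grp \<G>) (grp_atlas \<G>) (alg_id \<G>) (lbr \<G>) \<and>
     semisimple_with_parabolics (grp \<G>) (grp_atlas \<G>) (alg_id \<G>) (lbr \<G>) (alg_q \<G>) (alg_p \<G>) \<and>
     is_nilradical (lbr \<G>) (alg_p \<G>) (nil_p \<G>) \<and>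
     subgroup (grp_P \<G>) (grp \<G>) \<and> closed (grp_P \<G>) \<and>
     lie_subgroup_algebra (grp \<G>) (grp_atlas \<G>) (alg_id \<G>) (grp_P \<G>) = alg_p \<G> \<and>
     principal_bundle (grp \<G>) (grp_atlas \<G>) (grp_Q \<G>) (tot_atlas \<G>) (base_atlas \<G>) (proj \<G>) (ract \<G>) \<and>
     cartan_connection (grp \<G>) (grp_atlas \<G>) (alg_id \<G>) (grp_Q \<G>) (tot_atlas \<G>) (ract \<G>) (cartan \<G>) \<and>
     qmap (alg_p \<G>) (quotA \<G>) (nil_p \<G>) \<and>
     linear (projT \<G>) \<and> qmap (alg_p \<G>) (projT \<G> \<circ> quotA \<G>) (alg_q \<G>)"

definition actA ::
  "('x::topological_space, 'e::real_normed_vector, 'g, 'u, 'f, 'b, 'm, 'r, 't) par_geom \<Rightarrow> 'x \<Rightarrow> 'r \<Rightarrow> 'r" where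
  "actA \<G> g = descend (alg_p \<G>) (quotA \<G>) (\<lambda>X. quotA \<G> (AdG \<G> g X))"

definition actT ::
  "('x::topological_space, 'e::real_normed_vector, 'g, 'u, 'f, 'b, 'm, 'r, 't) par_geom \<Rightarrow> 'x \<Rightarrow> 't \<Rightarrow> 't" where
  "actT \<G> g = descend (alg_p \<G>) (projT \<G> \<circ> quotA \<G>) (\<lambda>X. projT \<G> (quotA \<G> (AdG \<G> g X)))"

definition brA :: "('x, 'e, 'g, 'u, 'f, 'b, 'm, 'r, 't) par_geom \<Rightarrow> 'r \<Rightarrow> 'r \<Rightarrow> 'r" where
  "brA \<G> x y = descend (alg_p \<G>) (quotA \<G>)
     (\<lambda>X. descend (alg_p \<G>) (quotA \<G>) (\<lambda>Y. quotA \<G> (lbr \<G> X Y)) y) x"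

text \<open>Sections over the open set \<open>U\<close> of the bundle associated to the action \<open>\<tau>\<close> of \<open>Q\<close>, as
  equivariant smooth functions on the part of the total space lying over \<open>U\<close>.\<close>

definition sections ::
  "('x::topological_space, 'e::real_normed_vector, 'g, 'u::topological_space, 'f::real_normed_vector,
    'b, 'm, 'r, 't) par_geom \<Rightarrow> ('x \<Rightarrow> 'w::fin_dim_vector \<Rightarrow> 'w) \<Rightarrow> 'b set \<Rightarrow> ('u \<Rightarrow> 'w) set" where
  "sections \<G> \<tau> U = {\<sigma>. smooth_fun (tot_atlas \<G>) (proj \<G> -` U) \<sigma> \<and>
     (\<forall>u\<in>proj \<G> -` U. \<forall>g\<in>grp_Q \<G>. \<sigma> (ract \<G> u g) = \<tau> (inv\<^bsub>grp \<G>\<^esub> g) (\<sigma> u))}"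

text \<open>The relative fundamental derivative at the point \<open>u\<close>. It is tensorial in its first argument:
  for a section \<open>s\<close>, the function \<open>D\<^sup>\<rho>\<^sub>s \<sigma>\<close> is \<open>\<lambda>u. rel_fund_deriv \<G> (s u) \<sigma> u\<close>. The lift of \<open>s\<close>
  enters only through its value \<open>X\<close> at \<open>u\<close>, and the corresponding vector field takes the value
  \<open>\<omega>\<^sub>u\<^sup>-\<^sup>1(X)\<close> there.\<close>

definition rel_fund_deriv ::
  "('x, 'e, 'g, 'u::topological_space, 'f::real_normed_vector, 'b, 'm, 'r, 't) par_geom
    \<Rightarrow> 'r \<Rightarrow> ('u \<Rightarrow> 'w::fin_dim_vector) \<Rightarrow> 'u \<Rightarrow> 'w" where
  "rel_fund_deriv \<G> x \<sigma> u = descend (alg_p \<G>) (quotA \<G>)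
     (\<lambda>X. dir_deriv (inv_into (tangent_space (tot_atlas \<G>) u) (cartan \<G> u) X) \<sigma>) x"


section \<open>Relative tractor bundles and their operators\<close>

definition tractor_rep ::
  "('x::topological_space, 'e::real_normed_vector, 'g, 'u, 'f, 'b, 'm, 'r, 't) par_geom
    \<Rightarrow> ('x \<Rightarrow> 'v::fin_dim_vector \<Rightarrow> 'v) \<Rightarrow> bool" where
  "tractor_rep \<G> \<rho> \<longleftrightarrow> group_rep (grp \<G>) (grp_atlas \<G>) (grp_P \<G>) \<rho> \<and>
     (\<forall>g\<in>grp_P_plus \<G>. \<forall>v. \<rho> g v = v)"

definition bullet ::
  "('x::topological_space, 'e::real_normed_vector, 'g, 'u, 'f, 'b, 'm, 'r, 't) par_geom
    \<Rightarrow> ('x \<Rightarrow> 'v::fin_dim_vector \<Rightarrow> 'v) \<Rightarrow> 'r \<Rightarrow> 'v \<Rightarrow> 'v" where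
  "bullet \<G> \<rho> x v = descend (alg_p \<G>) (quotA \<G>)
     (\<lambda>X. infinitesimal_action (grp \<G>) (grp_atlas \<G>) (alg_id \<G>) (grp_P \<G>) \<rho> X v) x"

text \<open>\<open>k\<close>-linear forms take a list of \<open>k\<close> arguments; their values on lists of other lengths are
  irrelevant.\<close>

definition alternating_form :: "nat \<Rightarrow> ('t::real_vector list \<Rightarrow> 'v::real_vector) \<Rightarrow> bool" where
  "alternating_form k \<alpha> \<longleftrightarrow>
     (\<forall>ys i. length ys = k \<and> i < k \<longrightarrow> linear (\<lambda>y. \<alpha> (ys[i := y]))) \<and>
     (\<forall>ys i j. length ys = k \<and> i < j \<and> j < k \<and> ys ! i = ys ! j \<longrightarrow> \<alpha> ys = 0)"

text \<open>\<open>\<Omega>\<^sup>k\<^sub>\<rho>(M, VM)\<close>, as equivariant smooth functions with values in the alternating forms on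
  \<open>\<pp>/\<qq>\<close>.\<close>

definition rel_forms ::
  "('x::topological_space, 'e::real_normed_vector, 'g, 'u::topological_space, 'f::real_normed_vector,
    'b, 'm, 'r, 't::real_vector) par_geom
    \<Rightarrow> ('x \<Rightarrow> 'v::fin_dim_vector \<Rightarrow> 'v) \<Rightarrow> nat \<Rightarrow> ('u \<Rightarrow> 't list \<Rightarrow> 'v) set" where
  "rel_forms \<G> \<rho> k = {\<phi>. (\<forall>u. alternating_form k (\<phi> u)) \<and>
     (\<forall>ys. length ys = k \<longrightarrow> smooth_fun (tot_atlas \<G>) UNIV (\<lambda>u. \<phi> u ys)) \<and>
     (\<forall>u. \<forall>g\<in>grp_Q \<G>. \<forall>ys. length ys = k \<longrightarrow>
        \<phi> (ract \<G> u g) ys = \<rho> (inv\<^bsub>grp \<G>\<^esub> g) (\<phi> u (map (actT \<G> g) ys)))}"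

text \<open>The operator \<open>d~\<^sup>V\<close> on \<open>V\<close>-valued forms on \<open>A\<^sub>\<rho>M\<close>, evaluated at \<open>u\<close> on elements
  \<open>x\<^sub>0, \<dots>, x\<^sub>k\<close> of \<open>\<pp>/\<pp>\<^sub>+\<close>; the defining formula is tensorial in the sections \<open>s\<^sub>i\<close>. The
  derivative \<open>(D\<^sup>\<rho>\<^sub>s \<phi>)(\<dots>)\<close> of the form-valued function \<open>\<phi>\<close> is taken with constant arguments
  inserted.\<close>

definition twisted_d ::
  "('x::topological_space, 'e::real_normed_vector, 'g, 'u::topological_space, 'f::real_normed_vector,
    'b, 'm, 'r, 't) par_geom
    \<Rightarrow> ('x \<Rightarrow> 'v::fin_dim_vector \<Rightarrow> 'v) \<Rightarrow> ('u \<Rightarrow> 'r list \<Rightarrow> 'v) \<Rightarrow> 'u \<Rightarrow> 'r list \<Rightarrow> 'v" where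
  "twisted_d \<G> \<rho> \<phi> u xs =
     (\<Sum>i<length xs. (- 1) ^ i *\<^sub>R rel_fund_deriv \<G> (xs ! i) (\<lambda>u'. \<phi> u' (nths xs (- {i}))) u) +
     (\<Sum>i<length xs. (- 1) ^ i *\<^sub>R bullet \<G> \<rho> (xs ! i) (\<phi> u (nths xs (- {i})))) +
     (\<Sum>j<length xs. \<Sum>i<j. (- 1) ^ (i + j) *\<^sub>R
        \<phi> u (brA \<G> (xs ! i) (xs ! j) # nths xs (- {i, j})))"

text \<open>The restriction of \<open>d~\<^sup>V\<close> to relative forms: \<open>\<phi>\<close> is viewed as the form
  \<open>\<phi> \<circ> map \<Pi>\<^sub>\<rho>\<close> on \<open>A\<^sub>\<rho>M\<close>, and the result is the form on \<open>T\<^sub>\<rho>M\<close> to which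
  \<open>d~\<^sup>V\<close> of it descends.\<close>

definition rel_twisted_d ::
  "('x::topological_space, 'e::real_normed_vector, 'g, 'u::topological_space, 'f::real_normed_vector,
    'b, 'm, 'r, 't) par_geom
    \<Rightarrow> ('x \<Rightarrow> 'v::fin_dim_vector \<Rightarrow> 'v) \<Rightarrow> ('u \<Rightarrow> 't list \<Rightarrow> 'v) \<Rightarrow> 'u \<Rightarrow> 't list \<Rightarrow> 'v" where
  "rel_twisted_d \<G> \<rho> \<phi> u =
     descend UNIV (map (projT \<G>)) (twisted_d \<G> \<rho> (\<lambda>u' xs. \<phi> u' (map (projT \<G>) xs)) u)"

definition rel_tractor_connection ::
  "('x::topological_space, 'e::real_normed_vector, 'g, 'u::topological_space, 'f::real_normed_vector,
    'b, 'm, 'r, 't) par_geom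
    \<Rightarrow> ('x \<Rightarrow> 'v::fin_dim_vector \<Rightarrow> 'v) \<Rightarrow> ('u \<Rightarrow> 't) \<Rightarrow> ('u \<Rightarrow> 'v) \<Rightarrow> 'u \<Rightarrow> 'v" where
  "rel_tractor_connection \<G> \<rho> \<xi> \<sigma> u =
     descend UNIV (projT \<G>) (\<lambda>x. rel_fund_deriv \<G> x \<sigma> u + bullet \<G> \<rho> x (\<sigma> u)) (\<xi> u)"

text \<open>The operator \<open>\<lbrakk>\<xi>, \<eta>\<rbrakk>\<close> at the point \<open>u\<close>. It is a local operator, and \<open>\<xi>\<close>, \<open>\<eta>\<close> are
  lifted to sections \<open>s1\<close>, \<open>s2\<close> of \<open>A\<^sub>\<rho>M\<close> on neighbourhoods of the base point of \<open>u\<close>; global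
  lifts are the case \<open>U = UNIV\<close>.\<close>

definition rel_bracket ::
  "('x::topological_space, 'e::real_normed_vector, 'g, 'u::topological_space, 'f::real_normed_vector,
    'b::topological_space, 'm, 'r::fin_dim_vector, 't) par_geom
    \<Rightarrow> ('u \<Rightarrow> 't) \<Rightarrow> ('u \<Rightarrow> 't) \<Rightarrow> 'u \<Rightarrow> 't" where
  "rel_bracket \<G> \<xi> \<eta> u =
     (THE y. \<forall>U s1 s2. open U \<and> proj \<G> u \<in> U \<and>
        s1 \<in> sections \<G> (actA \<G>) U \<and> s2 \<in> sections \<G> (actA \<G>) U \<and>
        (\<forall>u'\<in>proj \<G> -` U. projT \<G> (s1 u') = \<xi> u' \<and> projT \<G> (s2 u') = \<eta> u') \<longrightarrow>
        y = projT \<G> (rel_fund_deriv \<G> (s1 u) s2 u - rel_fund_deriv \<G> (s2 u) s1 u + brA \<G> (s1 u) (s2 u)))"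

end

theory Submission
  imports Defs
begin

text \<open>
  Each operator is given by a quotient construction, so the first task is to see that the
  constructions descend. For \<open>X\<close> in \<open>\<qq>\<close> the vector \<open>\<omega>\<^sub>u\<^sup>-\<^sup>1(X)\<close> is the velocity of
  \<open>t \<mapsto> u \<cdot> exp (t X)\<close>, and differentiating equivariance along this curve gives
  \<open>D\<^sub>X \<sigma> = - X \<bullet> \<sigma>\<close> for sections \<open>\<sigma>\<close> of the tractor bundle and \<open>D\<^sub>X \<xi> = - [X, \<xi>]\<close> for
  sections \<open>\<xi>\<close> of \<open>T\<^sub>\<rho>M\<close>. That the curve stays in \<open>Q\<close> uses that \<open>Ad (exp (t X))\<close> solves a linear
  differential equation with coefficient \<open>ad X\<close>, and that the nilradical of \<open>\<pp>\<close> lies in every Borel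
  subalgebra of \<open>\<qq>\<close>.

  Given lifts \<open>X\<^sub>i\<close> of \<open>\<xi>\<^sub>i(u)\<close> to \<open>\<pp>\<close>, one then has
  \<open>\<lbrakk>\<xi>\<^sub>i, \<xi>\<^sub>j\<rbrakk> = D\<^sub>X\<^sub>i \<xi>\<^sub>j - D\<^sub>X\<^sub>j \<xi>\<^sub>i + [X\<^sub>i, X\<^sub>j]\<close> modulo \<open>\<qq>\<close>, and the Leibniz rule for
  \<open>D\<^sub>X\<^sub>i (\<phi> (\<xi>\<^sub>0, \<dots>, \<xi>\<^sub>k))\<close> produces terms \<open>\<phi> (\<dots>, D\<^sub>X\<^sub>i \<xi>\<^sub>j, \<dots>)\<close>. Moving the changed argument to
  the front, these cancel exactly the derivative terms of the brackets, for every choice of lifts.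
\<close>

section \<open>Finite-dimensional vector spaces\<close>

text \<open>One-parameter subgroups are available only for elements of \<open>\<pp>\<close>, through
  the hypothesis that \<open>\<pp>\<close> is the Lie algebra of \<open>P\<close>; no exponential
  map on the whole Lie algebra is constructed. Differential facts about \<open>Ad\<close> therefore
  take generating curves as hypotheses. Fibres carry no norm, so vector-valued derivatives are
  tested on linear functionals.

  The inclusion of the nilradical in \<open>\<qq>\<close> matters because the Cartan connection
  reproduces generators only along curves in \<open>Q\<close>: it makes derivatives in nilradical
  directions computable, and so lets \<open>rel_fund_deriv\<close> descend from
  \<open>\<pp>\<close>. A form with constant arguments inserted is in general not a section of the
  tractor bundle, so this descent rests on the weaker invariance \<open>horizontal_at\<close>. The
  bracket of sections is a definite description over local lifts; it has a value only once lifts are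
  shown to exist and to agree, and existence is obtained locally from a trivialization.\<close>

definition fbasis :: "'a::fin_dim_vector set" where
  "fbasis = (SOME B. finite B \<and> independent B \<and> span B = UNIV)"

definition fcoord :: "'a::fin_dim_vector \<Rightarrow> 'a \<Rightarrow> real" where
  "fcoord b x = representation fbasis x b"

lemma fbasis: "finite (fbasis :: 'a::fin_dim_vector set)" "independent (fbasis :: 'a set)"
  "span (fbasis :: 'a set) = UNIV"
proof -
  obtain B :: "'a set" where B: "finite B" "\<forall>x. \<exists>c. x = (\<Sum>b\<in>B. scaleR (c b) b)"
    using finite_spanning_set by auto
  have "span B = UNIV"
    unfolding span_finite[OF B(1)] using B(2) by auto
  obtain B' where B': "B' \<subseteq> B" "independent B'" "B \<subseteq> span B'"
    using maximal_independent_subset by metis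
  have "span B' = UNIV"
    using B'(3) \<open>span B = UNIV\<close> span_mono span_span by (metis top.extremum_uniqueI)
  then have "\<exists>B::'a set. finite B \<and> independent B \<and> span B = UNIV"
    using B' B(1) finite_subset by blast
  then have "finite (fbasis::'a set) \<and> independent (fbasis::'a set) \<and> span (fbasis::'a set) = UNIV"
    unfolding fbasis_def by (rule someI_ex)
  then show "finite (fbasis :: 'a set)" "independent (fbasis :: 'a set)" "span (fbasis :: 'a set) = UNIV"
    by auto
qed

lemma linear_fcoord: "linear (fcoord b)"
  unfolding fcoord_def
  by (rule linearI) (auto simp: fbasis real_vector.representation_add real_vector.representation_scale)

lemma fcoord_expansion: "x = (\<Sum>b\<in>fbasis. fcoord b x *\<^sub>R b)"
  unfolding fcoord_def
  using real_vector.sum_representation_eq[OF fbasis(2) _ fbasis(1) order_refl] fbasis(3)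
  by (metis UNIV_I)

lemma linear_expansion: "linear l \<Longrightarrow> l x = (\<Sum>b\<in>fbasis. fcoord b x *\<^sub>R l b)"
  by (subst fcoord_expansion) (simp add: linear_sum linear_scale)

lemma linear_functional_expansion: "linear l \<Longrightarrow> l x = (\<Sum>b\<in>fbasis. fcoord b x * l b)"
  for l :: "_ \<Rightarrow> real"
  using linear_expansion[of l x] by simp

lemma functionals_separate:
  fixes x y :: "'a::fin_dim_vector"
  assumes "\<And>l::'a \<Rightarrow> real. linear l \<Longrightarrow> l x = l y"
  shows "x = y"
  using assms[OF linear_fcoord] fcoord_expansion[of x] fcoord_expansion[of y] by simp

text \<open>Reflexivity in finite dimension: the vector with coordinates \<open>T (fcoord b)\<close>
  represents \<open>T\<close>. It gives meaning to the definite description in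
  \<open>dir_deriv\<close>, where \<open>T\<close> sends a functional to the derivative of a
  component.\<close>

lemma fin_dim_reflexive:
  fixes T :: "('a::fin_dim_vector \<Rightarrow> real) \<Rightarrow> real"
  assumes add: "\<And>l m. linear l \<Longrightarrow> linear m \<Longrightarrow> T (\<lambda>x. l x + m x) = T l + T m"
    and scale: "\<And>l c. linear l \<Longrightarrow> T (\<lambda>x. c * l x) = c * T l"
  shows "\<exists>!w. \<forall>l. linear l \<longrightarrow> l w = T l"
proof (rule ex_ex1I)
  have T0: "T (\<lambda>x. 0) = 0"
    using scale[of "\<lambda>x. 0" 0] by (simp add: linear_zero)
  have sum: "T (\<lambda>x. \<Sum>b\<in>B. c b * fcoord b x) = (\<Sum>b\<in>B. c b * T (fcoord b))" if "finite B" for B c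
    using that
  proof (induction B rule: finite_induct)
    case empty then show ?case by (simp add: T0)
  next
    case (insert b B)
    have l1: "linear (\<lambda>x. c b * fcoord b x)"
      using linear_compose_scale_right[OF linear_fcoord] by auto
    have l2: "linear (\<lambda>x. \<Sum>b\<in>B. c b * fcoord b x)"
      by (rule linear_compose_sum) (use linear_compose_scale_right[OF linear_fcoord] in auto)
    show ?case
      using insert add[OF l1 l2] scale[OF linear_fcoord, of "c b" b] by simp
  qed
  have "l (\<Sum>b\<in>fbasis. T (fcoord b) *\<^sub>R b) = T l" if l: "linear l" for l
  proof -
    have "l = (\<lambda>x. \<Sum>b\<in>fbasis. l b * fcoord b x)"
      by (rule ext) (subst linear_functional_expansion[OF l], simp add: mult.commute)
    then have "T l = T (\<lambda>x. \<Sum>b\<in>fbasis. l b * fcoord b x)" by simp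
    also have "\<dots> = (\<Sum>b\<in>fbasis. l b * T (fcoord b))" using sum[OF fbasis(1)] .
    finally show ?thesis using l by (simp add: linear_sum linear_scale mult.commute)
  qed
  then show "\<exists>w. \<forall>l. linear l \<longrightarrow> l w = T l" by blast
next
  fix w w' assume "\<forall>l. linear l \<longrightarrow> l w = T l" "\<forall>l. linear l \<longrightarrow> l w' = T l"
  then show "w = w'" by (metis functionals_separate)
qed

text \<open>A basis of \<open>S\<close> stays independent after adjoining \<open>w\<close>, so
  values on the enlarged basis can be prescribed. This turns membership in a subspace into the
  vanishing of real functions, to which differential equations apply.\<close>

lemma subspace_separate:
  fixes S :: "'a::real_vector set"
  assumes S: "subspace S" and w: "w \<notin> S"
  obtains l :: "'a \<Rightarrow> real" where "linear l" "\<And>x. x \<in> S \<Longrightarrow> l x = 0" "l w = 1"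
proof -
  obtain B where B: "B \<subseteq> S" "independent B" "S \<subseteq> span B"
    using maximal_independent_subset by metis
  have SB: "span B = S" using B S by (metis span_subspace)
  then have "independent (insert w B)" using B w by (simp add: independent_insert)
  then obtain l :: "'a \<Rightarrow> real" where l: "linear l" "\<forall>x\<in>insert w B. l x = (if x = w then 1 else 0)"
    using linear_independent_extend[of "insert w B" "\<lambda>x. if x = w then 1 else 0"] by auto
  have "l x = 0" if "x \<in> S" for x
  proof -
    have "w \<notin> B" using B w by auto
    then have "\<And>b. b \<in> B \<Longrightarrow> l b = 0" using l(2) by auto
    then show ?thesis using linear_eq_0_on_span[OF l(1)] that SB by auto
  qed
  then show ?thesis using that l by auto
qed

text \<open>A subspace of the dual with trivial common kernel is the whole dual. Eliminating basis
  vectors one at a time produces functionals in \<open>R\<close> dual to \<open>fbasis\<close>, in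
  which any functional expands.\<close>

lemma separating_functionals_span:
  fixes R :: "('a::fin_dim_vector \<Rightarrow> real) set"
  assumes lin: "\<And>l. l \<in> R \<Longrightarrow> linear l"
    and zero: "(\<lambda>x. 0) \<in> R"
    and add: "\<And>l m. l \<in> R \<Longrightarrow> m \<in> R \<Longrightarrow> (\<lambda>x. l x + m x) \<in> R"
    and scale: "\<And>l c. l \<in> R \<Longrightarrow> (\<lambda>x. c * l x) \<in> R"
    and sep: "\<And>x. (\<And>l. l \<in> R \<Longrightarrow> l x = 0) \<Longrightarrow> x = 0"
    and l: "linear l"
  shows "l \<in> R"
proof -
  have ex: "\<exists>l\<in>R. (\<forall>b\<in>B. l b = 0) \<and> l z \<noteq> 0" if "finite B" "independent B" "z \<notin> span B" for B z
    using that
  proof (induction B arbitrary: z rule: finite_induct)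
    case empty
    then show ?case using sep[of z] by auto
  next
    case (insert b B)
    have ind: "independent B" "b \<notin> span B"
      using insert.prems(1) insert.hyps(2) by (auto simp: independent_insert)
    obtain l1 where l1: "l1 \<in> R" "\<forall>b\<in>B. l1 b = 0" "l1 b \<noteq> 0"
      using insert.IH[OF ind] by blast
    define a where "a = l1 z / l1 b"
    have "z - a *\<^sub>R b \<notin> span B"
      using insert.prems(2) by (auto simp: span_insert)
    then obtain m where m: "m \<in> R" "\<forall>b\<in>B. m b = 0" "m (z - a *\<^sub>R b) \<noteq> 0"
      using insert.IH[OF ind(1)] by blast
    \<comment> \<open>Subtracting this multiple of \<open>l1\<close> kills \<open>b\<close> and
      keeps the zeros on \<open>B\<close>; the value at \<open>z\<close> becomes that of
      \<open>m\<close> at \<open>z - a *\<^sub>R b\<close>, which is nonzero by the choice of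
      \<open>m\<close>.\<close>
    define l where "l = (\<lambda>x. m x + (- (m b / l1 b)) * l1 x)"
    have "l \<in> R" unfolding l_def by (intro add scale l1 m)
    moreover have "l x = 0" if "x \<in> insert b B" for x
      using that l1 m unfolding l_def by auto
    moreover have "l z = m (z - a *\<^sub>R b)"
      using lin[OF m(1)] by (simp add: l_def a_def linear_diff linear_scale)
    ultimately show ?case using m by metis
  qed
  have "\<exists>m\<in>R. \<forall>c\<in>fbasis. m c = (if c = b then 1 else 0)" if b: "b \<in> (fbasis::'a set)" for b
  proof -
    have "b \<notin> span (fbasis - {b})" using fbasis(2) b by (auto simp: dependent_def)
    moreover have "independent (fbasis - {b})" using fbasis(2) independent_mono by blast
    ultimately obtain m where m: "m \<in> R" "\<forall>c\<in>fbasis - {b}. m c = 0" "m b \<noteq> 0"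
      using ex[of "fbasis - {b}" b] fbasis(1) by auto
    have "(\<lambda>x. (1 / m b) * m x) \<in> R" using scale m by blast
    then show ?thesis using m by (intro bexI[of _ "\<lambda>x. (1 / m b) * m x"]) auto
  qed
  then obtain m where m: "\<And>b. b \<in> fbasis \<Longrightarrow> m b \<in> R"
    "\<And>b c. b \<in> fbasis \<Longrightarrow> c \<in> fbasis \<Longrightarrow> m b c = (if c = b then 1 else 0)"
    by metis
  have sumR: "(\<lambda>x. \<Sum>b\<in>B. l b * m b x) \<in> R" if "finite B" "B \<subseteq> fbasis" for B
    using that
  proof (induction B rule: finite_induct)
    case empty then show ?case using zero by simp
  next
    case (insert b B) then show ?case using add[OF scale[OF m(1), of b "l b"]] by auto
  qed
  have "l = (\<lambda>x. \<Sum>b\<in>fbasis. l b * m b x)"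
  proof
    fix x
    have "m b x = fcoord b x" if "b \<in> fbasis" for b
      using linear_functional_expansion[OF lin[OF m(1)[OF that]], of x] m(2)[OF that] that
      by (simp add: if_distrib fbasis(1) sum.delta cong: if_cong)
    then show "l x = (\<Sum>b\<in>fbasis. l b * m b x)"
      by (subst linear_functional_expansion[OF l]) (simp add: mult.commute)
  qed
  then show ?thesis using sumR[OF fbasis(1) order_refl] by simp
qed

text \<open>Charts of a product manifold take values in the product of the model spaces, so the
  class of model spaces has to be closed under products.\<close>

instance prod :: (fin_dim_vector, fin_dim_vector) fin_dim_vector
proof
  define B :: "('a \<times> 'b) set" where "B = (\<lambda>a. (a, 0)) ` fbasis \<union> (\<lambda>b. (0, b)) ` fbasis"
  have fin: "finite B" unfolding B_def by (simp add: fbasis(1))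
  have "x \<in> span B" for x :: "'a \<times> 'b"
  proof -
    have "x = (\<Sum>a\<in>fbasis. fcoord a (fst x) *\<^sub>R (a, 0)) + (\<Sum>b\<in>fbasis. fcoord b (snd x) *\<^sub>R (0, b))"
      using fcoord_expansion[of "fst x"] fcoord_expansion[of "snd x"]
      by (intro prod_eqI) (simp_all add: fst_sum snd_sum)
    also have "\<dots> \<in> span B"
      by (intro span_add span_sum span_scale span_base) (auto simp: B_def)
    finally show ?thesis .
  qed
  then show "\<exists>B::('a \<times> 'b) set. finite B \<and> (\<forall>x. \<exists>c. x = (\<Sum>b\<in>B. c b *\<^sub>R b))"
    using fin unfolding span_finite[OF fin] by (intro exI[of _ B]) auto
qed

text \<open>Equivalence of norms in finite dimension, in the form of bounds on coordinates. The
  induction adds a vector at positive distance from the span of the others; that distance bounds its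
  coefficient, and the remaining ones follow from the bound for the smaller set.\<close>

lemma independent_coefficients_bounded:
  fixes B :: "'a::real_normed_vector set"
  assumes "finite B" "independent B"
  shows "\<exists>C>0. \<forall>c. \<forall>b\<in>B. \<bar>c b\<bar> \<le> C * norm (\<Sum>b\<in>B. c b *\<^sub>R b)"
  using assms
proof (induction B rule: finite_induct)
  case empty
  then show ?case by (auto intro: exI[of _ 1])
next
  case (insert b B)
  have ind: "independent B" "b \<notin> span B"
    using insert.prems(1) insert.hyps(2) by (auto simp: independent_insert)
  obtain C where C: "C > 0" "\<And>c b. b \<in> B \<Longrightarrow> \<bar>c b\<bar> \<le> C * norm (\<Sum>b\<in>B. c b *\<^sub>R b)"
    using insert.IH[OF ind(1)] by blast
  \<comment> \<open>Otherwise some sequence in \<open>span B\<close> converges to \<open>b\<close>.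
    The bound already known for \<open>B\<close> makes its coefficients Cauchy, and their limits
    express \<open>b\<close> as an element of \<open>span B\<close>, against independence.\<close>
  have "\<exists>d>0. \<forall>y\<in>span B. d \<le> norm (b - y)"
  proof (rule ccontr)
    assume "\<not> ?thesis"
    then have "\<exists>y\<in>span B. norm (b - y) < 1 / Suc n" for n :: nat
      by (metis not_less of_nat_0_less_iff zero_less_Suc zero_less_divide_1_iff)
    then obtain y where y: "\<And>n. y n \<in> span B" "\<And>n::nat. norm (b - y n) < 1 / Suc n" by metis
    have yb: "y \<longlonglongrightarrow> b"
    proof (rule Lim_transform_bound[where f = "\<lambda>n. y n - b" and g = "\<lambda>n. 1 / real (Suc n)", THEN Lim_null[THEN iffD2]])
      show "\<forall>\<^sub>F n in sequentially. norm (y n - b) \<le> norm (1 / real (Suc n))"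
        using y(2) by (intro always_eventually allI) (simp add: norm_minus_commute less_imp_le)
      show "(\<lambda>n. 1 / real (Suc n)) \<longlonglongrightarrow> 0" by (rule LIMSEQ_Suc[OF lim_1_over_n])
    qed
    have "\<forall>n. \<exists>c. y n = (\<Sum>b\<in>B. c b *\<^sub>R b)"
      using y(1) unfolding span_finite[OF insert.hyps(1)] by auto
    then obtain c where c: "\<And>n. y n = (\<Sum>b\<in>B. c n b *\<^sub>R b)" by metis
    have cauchy: "Cauchy y" using yb by (simp add: LIMSEQ_imp_Cauchy)
    have "\<exists>l. (\<lambda>n. c n b') \<longlonglongrightarrow> l" if b': "b' \<in> B" for b'
    proof -
      have "Cauchy (\<lambda>n. c n b')"
      proof (rule metric_CauchyI)
        fix e :: real assume "e > 0"
        then have "e / C > 0" using C by simp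
        then obtain M where M: "\<And>m n. m \<ge> M \<Longrightarrow> n \<ge> M \<Longrightarrow> dist (y m) (y n) < e / C"
          using cauchy metric_CauchyD by blast
        have "dist (c m b') (c n b') < e" if "m \<ge> M" "n \<ge> M" for m n
        proof -
          have "\<bar>c m b' - c n b'\<bar> \<le> C * norm (\<Sum>b\<in>B. (c m b - c n b) *\<^sub>R b)"
            using C(2)[OF b', of "\<lambda>b. c m b - c n b"] .
          also have "(\<Sum>b\<in>B. (c m b - c n b) *\<^sub>R b) = y m - y n"
            by (simp add: c scaleR_diff_left sum_subtractf)
          also have "C * norm (y m - y n) < C * (e / C)"
            using M[OF that] C(1) by (intro mult_strict_left_mono) (auto simp: dist_norm)
          finally show ?thesis using C(1) by (simp add: dist_norm)
        qed
        then show "\<exists>M. \<forall>m\<ge>M. \<forall>n\<ge>M. dist (c m b') (c n b') < e" by blast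
      qed
      then show ?thesis using Cauchy_convergent convergent_def by blast
    qed
    then obtain l where l: "\<And>b'. b' \<in> B \<Longrightarrow> (\<lambda>n. c n b') \<longlonglongrightarrow> l b'" by metis
    have "y \<longlonglongrightarrow> (\<Sum>b\<in>B. l b *\<^sub>R b)"
      unfolding c[abs_def] by (intro tendsto_sum tendsto_scaleR l tendsto_const)
    then have "b = (\<Sum>b\<in>B. l b *\<^sub>R b)" using yb LIMSEQ_unique by blast
    also have "\<dots> \<in> span B" by (intro span_sum span_scale span_base)
    finally have "b \<in> span B" .
    then show False using ind by simp
  qed
  then obtain d where d: "d > 0" "\<And>y. y \<in> span B \<Longrightarrow> d \<le> norm (b - y)" by blast
  \<comment> \<open>\<open>1 / d\<close> controls the coefficient of \<open>b\<close>; the second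
    summand controls those over \<open>B\<close>, because the norm of the sum without
    \<open>b\<close> is at most \<open>(1 + norm b / d) * norm x\<close>.\<close>
  define K where "K = 1 / d + C * (1 + norm b / d)"
  have K: "K > 0" unfolding K_def using C d
    by (intro add_pos_nonneg) auto
  have "\<bar>c b'\<bar> \<le> K * norm (\<Sum>b\<in>insert b B. c b *\<^sub>R b)" if "b' \<in> insert b B" for c b'
  proof -
    define y where "y = (\<Sum>b\<in>B. c b *\<^sub>R b)"
    define x where "x = c b *\<^sub>R b + y"
    have x: "x = (\<Sum>b\<in>insert b B. c b *\<^sub>R b)"
      unfolding x_def y_def using insert.hyps by simp
    have y: "y \<in> span B" unfolding y_def by (intro span_sum span_scale span_base)
    have cb: "\<bar>c b\<bar> \<le> norm x / d"
    proof (cases "c b = 0")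
      case True then show ?thesis using d(1) by simp
    next
      case False
      have "- (inverse (c b) *\<^sub>R y) \<in> span B" using y by (simp add: span_neg span_scale)
      from d(2)[OF this] have "d \<le> norm (b + inverse (c b) *\<^sub>R y)" by simp
      then have "\<bar>c b\<bar> * d \<le> \<bar>c b\<bar> * norm (b + inverse (c b) *\<^sub>R y)" by (simp add: mult_left_mono)
      also have "\<dots> = norm (c b *\<^sub>R (b + inverse (c b) *\<^sub>R y))" by simp
      also have "c b *\<^sub>R (b + inverse (c b) *\<^sub>R y) = x"
        using False by (simp add: x_def scaleR_add_right)
      finally show ?thesis using d(1) by (simp add: field_simps)
    qed
    have K1: "1 / d \<le> K" "C * (1 + norm b / d) \<le> K" unfolding K_def using C d by auto
    show ?thesis
    proof (cases "b' = b")
      case True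
      have "\<bar>c b'\<bar> \<le> (1 / d) * norm x" using cb True by simp
      also have "\<dots> \<le> K * norm x" by (rule mult_right_mono[OF K1(1)]) simp
      finally show ?thesis using x by simp
    next
      case False
      then have "b' \<in> B" using that by simp
      then have "\<bar>c b'\<bar> \<le> C * norm y" unfolding y_def by (rule C(2))
      also have "norm y \<le> norm x + \<bar>c b\<bar> * norm b"
        unfolding x_def by (metis norm_scaleR norm_triangle_ineq4 add_diff_cancel_left')
      also have "\<dots> \<le> norm x + (norm x / d) * norm b" by (intro add_left_mono mult_right_mono cb) simp
      also have "C * (norm x + (norm x / d) * norm b) = C * (1 + norm b / d) * norm x"
        by (simp add: algebra_simps)
      also have "\<dots> \<le> K * norm x" by (rule mult_right_mono[OF K1(2)]) simp
      finally show ?thesis using x C(1) by (simp add: mult_left_mono)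
    qed
  qed
  then show ?case using K by blast
qed

lemma bounded_linear_fcoord:
  fixes b :: "'a::{real_normed_vector, fin_dim_vector}"
  assumes "b \<in> fbasis"
  shows "bounded_linear (fcoord b)"
proof -
  obtain C where C: "\<And>c b. b \<in> fbasis \<Longrightarrow> \<bar>c b\<bar> \<le> C * norm (\<Sum>b\<in>fbasis. c b *\<^sub>R (b::'a))"
    using independent_coefficients_bounded[OF fbasis(1,2)] by blast
  show ?thesis
  proof (rule bounded_linear_intro)
    show "norm (fcoord b x) \<le> norm x * C" for x
      using C[OF assms, of "\<lambda>b. fcoord b x"] fcoord_expansion[of x, symmetric] by (simp add: mult.commute)
  qed (simp_all add: linear_fcoord linear_add linear_scale)
qed

section \<open>Calculus of smooth functions\<close>

lemma Ck_on_cong: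
  assumes "open S" "\<And>x. x \<in> S \<Longrightarrow> f x = g x" "Ck_on k f S"
  shows "Ck_on k g S"
  using assms(2,3)
proof (induction k arbitrary: f g)
  case 0
  then show ?case by (simp cong: continuous_on_cong)
next
  case (Suc k)
  have D: "(g has_derivative frechet_derivative f (at x)) (at x)" if "x \<in> S" for x
  proof (rule has_derivative_transform_within_open[OF _ assms(1) that])
    show "(f has_derivative frechet_derivative f (at x)) (at x)"
      using Suc.prems that by (simp add: frechet_derivative_works[symmetric])
  qed (use Suc.prems in auto)
  then have "g differentiable (at x)" if "x \<in> S" for x
    using that by (auto simp: differentiable_def)
  moreover have "frechet_derivative g (at x) = frechet_derivative f (at x)" if "x \<in> S" for x
    using D[OF that] by (rule frechet_derivative_at[symmetric])
  ultimately show ?case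
    using Suc.IH Suc.prems by auto
qed

lemma Ck_on_subset: "Ck_on k f S \<Longrightarrow> T \<subseteq> S \<Longrightarrow> Ck_on k f T"
  by (induction k arbitrary: f) (auto intro: continuous_on_subset)

lemma Ck_on_local:
  assumes "\<And>x. x \<in> S \<Longrightarrow> \<exists>T. open T \<and> x \<in> T \<and> Ck_on k f T"
  shows "Ck_on k f S"
  using assms
proof (induction k arbitrary: f)
  case 0
  then show ?case
    by (fastforce intro: continuous_at_imp_continuous_on simp: continuous_on_eq_continuous_at)
next
  case (Suc k)
  have "Ck_on k (\<lambda>x. frechet_derivative f (at x) v) S" for v
    by (rule Suc.IH) (use Suc.prems in fastforce)
  then show ?case using Suc.prems by fastforce
qed

lemma Ck_on_SucD: "Ck_on (Suc k) f S \<Longrightarrow> Ck_on k f S"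
proof (induction k arbitrary: f)
  case 0
  then show ?case
    by (auto intro!: continuous_at_imp_continuous_on differentiable_imp_continuous_within)
next
  case (Suc k)
  then show ?case by (metis Ck_on.simps(2))
qed

lemma Ck_on_const: "Ck_on k (\<lambda>x. c) S"
  by (induction k arbitrary: c) auto

lemma Ck_on_add:
  assumes "open S" "Ck_on k f S" "Ck_on k g S"
  shows "Ck_on k (\<lambda>x. f x + g x) S"
  using assms(2,3)
proof (induction k arbitrary: f g)
  case 0
  then show ?case by (auto intro: continuous_intros)
next
  case (Suc k)
  have "((\<lambda>x. f x + g x) has_derivative (\<lambda>v. frechet_derivative f (at x) v + frechet_derivative g (at x) v)) (at x)"
    if "x \<in> S" for x
    using Suc.prems that by (intro has_derivative_add) (auto simp: frechet_derivative_works[symmetric])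
  then have D: "frechet_derivative (\<lambda>x. f x + g x) (at x) = (\<lambda>v. frechet_derivative f (at x) v + frechet_derivative g (at x) v)"
    "(\<lambda>x. f x + g x) differentiable (at x)"
    if "x \<in> S" for x
    using that by (auto intro: frechet_derivative_at[symmetric] simp: differentiable_def)
  have "Ck_on k (\<lambda>x. frechet_derivative (\<lambda>x. f x + g x) (at x) v) S" for v
    by (rule Ck_on_cong[OF assms(1) _ Suc.IH]) (use Suc.prems D(1) in auto)
  then show ?case using D(2) by simp
qed

lemma Ck_on_bounded_linear:
  assumes "open S" "bounded_linear l" "Ck_on k f S"
  shows "Ck_on k (\<lambda>x. l (f x)) S"
  using assms(3)
proof (induction k arbitrary: f)
  case 0
  then show ?case using assms(2)
    by (auto intro: bounded_linear.continuous_on)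
next
  case (Suc k)
  have "((\<lambda>x. l (f x)) has_derivative (\<lambda>v. l (frechet_derivative f (at x) v))) (at x)"
    if "x \<in> S" for x
    using Suc.prems that
    by (intro bounded_linear.has_derivative[OF assms(2)]) (auto simp: frechet_derivative_works[symmetric])
  then have D: "frechet_derivative (\<lambda>x. l (f x)) (at x) = (\<lambda>v. l (frechet_derivative f (at x) v))"
    "(\<lambda>x. l (f x)) differentiable (at x)"
    if "x \<in> S" for x
    using that by (auto intro: frechet_derivative_at[symmetric] simp: differentiable_def)
  have "Ck_on k (\<lambda>x. frechet_derivative (\<lambda>x. l (f x)) (at x) v) S" for v
    by (rule Ck_on_cong[OF assms(1) _ Suc.IH]) (use Suc.prems D(1) in auto)
  then show ?case using D(2) by simp
qed

lemma Ck_on_scaleR: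
  fixes f :: "'a::real_normed_vector \<Rightarrow> real"
  assumes "open S" "Ck_on k f S" "Ck_on k g S"
  shows "Ck_on k (\<lambda>x. f x *\<^sub>R g x) S"
  using assms(2,3)
proof (induction k arbitrary: f g)
  case 0
  then show ?case by (auto intro: continuous_intros)
next
  case (Suc k)
  have "((\<lambda>x. f x *\<^sub>R g x) has_derivative (\<lambda>v. f x *\<^sub>R frechet_derivative g (at x) v + frechet_derivative f (at x) v *\<^sub>R g x)) (at x)"
    if "x \<in> S" for x
    using Suc.prems that by (intro has_derivative_scaleR) (auto simp: frechet_derivative_works[symmetric])
  then have D: "frechet_derivative (\<lambda>x. f x *\<^sub>R g x) (at x) = (\<lambda>v. f x *\<^sub>R frechet_derivative g (at x) v + frechet_derivative f (at x) v *\<^sub>R g x)"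
    "(\<lambda>x. f x *\<^sub>R g x) differentiable (at x)"
    if "x \<in> S" for x
    using that by (auto intro: frechet_derivative_at[symmetric] simp: differentiable_def)
  have "Ck_on k (\<lambda>x. frechet_derivative (\<lambda>x. f x *\<^sub>R g x) (at x) v) S" for v
  proof (rule Ck_on_cong[OF assms(1) _ Ck_on_add[OF assms(1)]])
    show "Ck_on k (\<lambda>x. f x *\<^sub>R frechet_derivative g (at x) v) S"
      using Suc.prems Ck_on_SucD[OF Suc.prems(1)] by (intro Suc.IH) auto
    show "Ck_on k (\<lambda>x. frechet_derivative f (at x) v *\<^sub>R g x) S"
      using Suc.prems Ck_on_SucD[OF Suc.prems(2)] by (intro Suc.IH) auto
  qed (use D(1) in auto)
  then show ?case using D(2) by simp
qed

lemma Ck_on_sum: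
  assumes "open S" "\<And>i. i \<in> I \<Longrightarrow> Ck_on k (f i) S"
  shows "Ck_on k (\<lambda>x. \<Sum>i\<in>I. f i x) S"
  using assms(2)
  by (induction I rule: infinite_finite_induct) (auto simp: Ck_on_const intro!: Ck_on_add[OF assms(1)])

lemma Ck_on_bounded_linear_self: "open S \<Longrightarrow> bounded_linear l \<Longrightarrow> Ck_on k l S"
proof (cases k)
  case (Suc m)
  assume l: "bounded_linear l"
  then have "(l has_derivative l) (at x)" for x by (rule bounded_linear_imp_has_derivative)
  then have "frechet_derivative l (at x) = l" "l differentiable (at x)" for x
    by (auto intro: frechet_derivative_at[symmetric] simp: differentiable_def)
  then show ?thesis by (simp add: Suc Ck_on_const)
qed (simp add: linear_continuous_on)

text \<open>\<open>Ck_on\<close> speaks of derivatives at fixed vectors, whereas the chain rule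
  evaluates the derivative of \<open>g\<close> at a vector varying with \<open>x\<close>. Expanding
  that vector in a basis of the middle space leaves sums of products, to which the induction
  hypothesis applies.\<close>

lemma Ck_on_compose:
  fixes f :: "'a::real_normed_vector \<Rightarrow> 'b::{real_normed_vector,fin_dim_vector}"
    and g :: "'b \<Rightarrow> 'c::real_normed_vector"
  assumes "open S" "open T" "f ` S \<subseteq> T" "Ck_on k f S" "Ck_on k g T"
  shows "Ck_on k (g \<circ> f) S"
  using assms(4,5)
proof (induction k arbitrary: g)
  case 0
  then show ?case using assms(3) by (metis Ck_on.simps(1) continuous_on_compose continuous_on_subset)
next
  case (Suc k)
  let ?Df = "\<lambda>x. frechet_derivative f (at x)" and ?Dg = "\<lambda>y. frechet_derivative g (at y)"
  have D': "(g \<circ> f has_derivative ?Dg (f x) \<circ> ?Df x) (at x)" if "x \<in> S" for x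
    using Suc.prems that assms(3)
    by (intro diff_chain_at) (auto simp: frechet_derivative_works[symmetric])
  then have D: "frechet_derivative (g \<circ> f) (at x) = ?Dg (f x) \<circ> ?Df x"
    "(g \<circ> f) differentiable (at x)" if "x \<in> S" for x
    using that by (auto intro: frechet_derivative_at[symmetric] simp: differentiable_def)
  have "Ck_on k (\<lambda>x. frechet_derivative (g \<circ> f) (at x) v) S" for v
  proof (rule Ck_on_cong[OF assms(1)])
    show "Ck_on k (\<lambda>x. \<Sum>b\<in>fbasis. fcoord b (?Df x v) *\<^sub>R (?Dg (f x) b)) S"
    proof (rule Ck_on_sum[OF assms(1)], rule Ck_on_scaleR[OF assms(1)])
      fix b :: 'b assume b: "b \<in> fbasis"
      have "Ck_on k (\<lambda>x. ?Df x v) S" using Suc.prems by simp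
      from Ck_on_bounded_linear[OF assms(1) bounded_linear_fcoord[OF b] this]
      show "Ck_on k (\<lambda>x. fcoord b (?Df x v)) S" .
      show "Ck_on k (\<lambda>x. ?Dg (f x) b) S"
        using Suc.IH[of "\<lambda>y. ?Dg y b"] Suc.prems(2) Ck_on_SucD[OF Suc.prems(1)] by (simp add: o_def)
    qed
    show "(\<Sum>b\<in>fbasis. fcoord b (?Df x v) *\<^sub>R (?Dg (f x) b)) = frechet_derivative (g \<circ> f) (at x) v"
      if "x \<in> S" for x
    proof -
      have "linear (?Dg (f x))"
        using Suc.prems(2) that assms(3) by (intro linear_frechet_derivative) auto
      from linear_expansion[OF this, of "?Df x v"] show ?thesis using D(1)[OF that] by simp
    qed
  qed
  then show ?case using D(2) unfolding Ck_on.simps by blast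
qed

lemma Ck_on_Pair:
  assumes "open S" "Ck_on k f S" "Ck_on k g S"
  shows "Ck_on k (\<lambda>x. (f x, g x)) S"
proof -
  have "Ck_on k (\<lambda>x. (f x, 0) + (0, g x)) S"
    by (rule Ck_on_add[OF assms(1) Ck_on_bounded_linear[OF assms(1) _ assms(2)] Ck_on_bounded_linear[OF assms(1) _ assms(3)]])
       (intro bounded_linear_Pair bounded_linear_ident bounded_linear_zero)+
  then show ?thesis by simp
qed

lemma smooth_on_cong: "open S \<Longrightarrow> (\<And>x. x \<in> S \<Longrightarrow> f x = g x) \<Longrightarrow> smooth_on S f \<Longrightarrow> smooth_on S g"
  unfolding smooth_on_def using Ck_on_cong by blast

lemma smooth_on_subset: "smooth_on S f \<Longrightarrow> T \<subseteq> S \<Longrightarrow> smooth_on T f"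
  unfolding smooth_on_def using Ck_on_subset by blast

lemma smooth_on_local:
  "(\<And>x. x \<in> S \<Longrightarrow> \<exists>T. open T \<and> x \<in> T \<and> smooth_on T f) \<Longrightarrow> smooth_on S f"
  unfolding smooth_on_def by (metis Ck_on_local)

lemma smooth_on_compose:
  fixes f :: "'a::real_normed_vector \<Rightarrow> 'b::{real_normed_vector,fin_dim_vector}"
    and g :: "'b \<Rightarrow> 'c::real_normed_vector"
  shows "open S \<Longrightarrow> open T \<Longrightarrow> f ` S \<subseteq> T \<Longrightarrow> smooth_on S f \<Longrightarrow> smooth_on T g \<Longrightarrow> smooth_on S (g \<circ> f)"
  unfolding smooth_on_def using Ck_on_compose by blast

lemma smooth_on_imp_continuous_on: "smooth_on S f \<Longrightarrow> continuous_on S f"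
  unfolding smooth_on_def by (metis Ck_on.simps(1))

lemma smooth_on_imp_differentiable: "smooth_on S f \<Longrightarrow> x \<in> S \<Longrightarrow> f differentiable (at x)"
  unfolding smooth_on_def by (metis Ck_on.simps(2))

lemma smooth_on_frechet_derivative: "smooth_on S f \<Longrightarrow> smooth_on S (\<lambda>x. frechet_derivative f (at x) v)"
  unfolding smooth_on_def by (metis Ck_on.simps(2))

lemma smooth_on_has_derivative:
  "smooth_on S f \<Longrightarrow> x \<in> S \<Longrightarrow> (f has_derivative frechet_derivative f (at x)) (at x)"
  using smooth_on_imp_differentiable frechet_derivative_works by blast

section \<open>Derivatives along lines and symmetry of second derivatives\<close>

lemma smooth_on_along_line:
  fixes f :: "'a::real_normed_vector \<Rightarrow> real"
  assumes "smooth_on S f" "p + s *\<^sub>R v \<in> S"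
  shows "((\<lambda>s. f (p + s *\<^sub>R v)) has_real_derivative frechet_derivative f (at (p + s *\<^sub>R v)) v) (at s)"
proof -
  let ?D = "frechet_derivative f (at (p + s *\<^sub>R v))"
  have D: "(f has_derivative ?D) (at (p + s *\<^sub>R v))"
    using smooth_on_has_derivative assms by blast
  have "((\<lambda>s. f (p + s *\<^sub>R v)) has_derivative (\<lambda>h. ?D (h *\<^sub>R v))) (at s)"
    by (rule has_derivative_compose[where f = "\<lambda>s. p + s *\<^sub>R v" and f' = "\<lambda>h. h *\<^sub>R v", OF _ D])
       (auto intro!: derivative_eq_intros)
  moreover have "?D (h *\<^sub>R v) = ?D v * h" for h
    using has_derivative_linear[OF D] by (simp add: linear_scale)
  ultimately show ?thesis unfolding has_field_derivative_def by simp
qed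

text \<open>Schwarz's theorem by two mean value arguments: one in direction \<open>v\<close>,
  applied to the increment in direction \<open>w\<close>, and one in direction \<open>w\<close>,
  applied to the first derivative. The quotient equals the mixed derivative at a nearby point, which
  continuity brings back to \<open>p\<close>.\<close>

lemma second_difference_quotient_tendsto:
  fixes f :: "'a::real_normed_vector \<Rightarrow> real"
  assumes S: "open S" "p \<in> S" and f: "smooth_on S f"
  shows "((\<lambda>h. (f (p + h *\<^sub>R v + h *\<^sub>R w) - f (p + h *\<^sub>R v) - f (p + h *\<^sub>R w) + f p) / h\<^sup>2) \<longlongrightarrow>
      frechet_derivative (\<lambda>x. frechet_derivative f (at x) v) (at p) w) (at_right 0)"
proof (rule tendstoI)
  define g where "g = (\<lambda>x. frechet_derivative f (at x) v)"
  define D where "D = (\<lambda>x. frechet_derivative g (at x) w)"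
  have g: "smooth_on S g" unfolding g_def using f by (rule smooth_on_frechet_derivative)
  have "continuous_on S D"
    unfolding D_def using g by (intro smooth_on_imp_continuous_on smooth_on_frechet_derivative)
  then have "isCont D p" using S by (simp add: continuous_on_eq_continuous_at)
  fix e :: real assume "e > 0"
  then obtain d1 where d1: "d1 > 0" "\<And>y. dist y p < d1 \<Longrightarrow> dist (D y) (D p) < e"
    using \<open>isCont D p\<close> \<open>e > 0\<close> unfolding continuous_at_eps_delta by blast
  obtain d2 where d2: "d2 > 0" "ball p d2 \<subseteq> S" using S open_contains_ball by metis
  define d where "d = min d1 d2"
  \<comment> \<open>Small enough that displacements by \<open>s *\<^sub>R v + t *\<^sub>R w\<close>
    with nonnegative \<open>s\<close>, \<open>t\<close> below \<open>h0\<close> stay below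
    \<open>d\<close> in norm; the summand 1 keeps the denominator positive when \<open>v\<close> and
    \<open>w\<close> vanish.\<close>
  define h0 where "h0 = d / (1 + norm v + norm w)"
  have pos: "1 + norm v + norm w > 0" by (simp add: add_pos_nonneg)
  have "h0 > 0" unfolding h0_def d_def using d1 d2 pos by simp
  have near: "p + s *\<^sub>R v + t *\<^sub>R w \<in> S" "dist (D (p + s *\<^sub>R v + t *\<^sub>R w)) (D p) < e"
    if "0 \<le> s" "s < h0" "0 \<le> t" "t < h0" for s t
  proof -
    have "norm (s *\<^sub>R v + t *\<^sub>R w) \<le> s * norm v + t * norm w"
      using that norm_triangle_ineq[of "s *\<^sub>R v" "t *\<^sub>R w"] by simp
    also have "\<dots> \<le> h0 * norm v + h0 * norm w"
      using that by (intro add_mono mult_right_mono) auto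
    also have "\<dots> < h0 * (1 + norm v + norm w)" using \<open>h0 > 0\<close> by (simp add: algebra_simps)
    also have "\<dots> = d" unfolding h0_def using pos by simp
    finally have "dist (p + s *\<^sub>R v + t *\<^sub>R w) p < d" by (simp add: dist_norm add.assoc)
    then show "dist (D (p + s *\<^sub>R v + t *\<^sub>R w)) (D p) < e" "p + s *\<^sub>R v + t *\<^sub>R w \<in> S"
      using d1(2) d2(2) unfolding d_def by (auto simp: mem_ball dist_commute[of p] simp del: dist_commute_lessI)
  qed
  have "dist ((f (p + h *\<^sub>R v + h *\<^sub>R w) - f (p + h *\<^sub>R v) - f (p + h *\<^sub>R w) + f p) / h\<^sup>2) (D p) < e"
    if h: "0 < h" "h < h0" for h
  proof -
    define u where "u = (\<lambda>s. f (p + h *\<^sub>R w + s *\<^sub>R v) - f (p + s *\<^sub>R v))"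
    have "(u has_real_derivative g (p + h *\<^sub>R w + s *\<^sub>R v) - g (p + s *\<^sub>R v)) (at s)"
      if "0 \<le> s" "s \<le> h" for s
      unfolding u_def g_def using near[of s h] near[of s 0] that h
      by (intro DERIV_diff smooth_on_along_line[OF f]) (auto simp: algebra_simps)
    from MVT2[OF h(1) this]
    obtain s where s: "0 < s" "s < h" "u h - u 0 = (h - 0) * (g (p + h *\<^sub>R w + s *\<^sub>R v) - g (p + s *\<^sub>R v))"
      by auto
    have "((\<lambda>t. g (p + s *\<^sub>R v + t *\<^sub>R w)) has_real_derivative D (p + s *\<^sub>R v + t *\<^sub>R w)) (at t)"
      if "0 \<le> t" "t \<le> h" for t
      unfolding D_def using near[of s t] that h s
      by (intro smooth_on_along_line[OF g]) auto
    from MVT2[OF h(1) this]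
    obtain t where t: "0 < t" "t < h"
      "g (p + s *\<^sub>R v + h *\<^sub>R w) - g (p + s *\<^sub>R v + 0 *\<^sub>R w) = (h - 0) * D (p + s *\<^sub>R v + t *\<^sub>R w)"
      by auto
    have "f (p + h *\<^sub>R v + h *\<^sub>R w) - f (p + h *\<^sub>R v) - f (p + h *\<^sub>R w) + f p = u h - u 0"
      unfolding u_def by (simp add: algebra_simps)
    also have "\<dots> = h\<^sup>2 * D (p + s *\<^sub>R v + t *\<^sub>R w)"
      using s(3) t(3) by (simp add: algebra_simps power2_eq_square)
    finally show ?thesis using near[of s t] s t h by simp
  qed
  then show "\<forall>\<^sub>F h in at_right 0. dist ((f (p + h *\<^sub>R v + h *\<^sub>R w) - f (p + h *\<^sub>R v) - f (p + h *\<^sub>R w) + f p) / h\<^sup>2)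
      (frechet_derivative (\<lambda>x. frechet_derivative f (at x) v) (at p) w) < e"
    unfolding eventually_at_right_field D_def g_def using \<open>h0 > 0\<close> by (auto intro!: exI[of _ h0])
qed

text \<open>The second difference quotient is symmetric in \<open>v\<close> and \<open>w\<close>, so
  its two limits agree.\<close>

lemma second_derivative_symmetric:
  fixes f :: "'a::real_normed_vector \<Rightarrow> real"
  assumes "open S" "p \<in> S" "smooth_on S f"
  shows "frechet_derivative (\<lambda>x. frechet_derivative f (at x) v) (at p) w =
         frechet_derivative (\<lambda>x. frechet_derivative f (at x) w) (at p) v"
proof (rule tendsto_unique)
  show "((\<lambda>h. (f (p + h *\<^sub>R v + h *\<^sub>R w) - f (p + h *\<^sub>R v) - f (p + h *\<^sub>R w) + f p) / h\<^sup>2) \<longlongrightarrow>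
      frechet_derivative (\<lambda>x. frechet_derivative f (at x) v) (at p) w) (at_right 0)"
    by (rule second_difference_quotient_tendsto[OF assms])
  show "((\<lambda>h. (f (p + h *\<^sub>R v + h *\<^sub>R w) - f (p + h *\<^sub>R v) - f (p + h *\<^sub>R w) + f p) / h\<^sup>2) \<longlongrightarrow>
      frechet_derivative (\<lambda>x. frechet_derivative f (at x) w) (at p) v) (at_right 0)"
    using second_difference_quotient_tendsto[OF assms, of w v] by (simp add: algebra_simps)
qed simp

section \<open>Smooth maps between manifolds\<close>

lemma chart_exists:
  assumes "smooth_manifold A"
  obtains U \<phi> where "(U, \<phi>) \<in> A" "x \<in> U"
proof -
  have "x \<in> (\<Union>(U, \<phi>)\<in>A. U)" using assms unfolding smooth_manifold_def by simp
  then show ?thesis using that by auto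
qed

lemma
  assumes "smooth_manifold A" "(U, \<phi>) \<in> A"
  shows chart_open: "open U" "open (\<phi> ` U)"
    and chart_inj_on: "inj_on \<phi> U"
    and chart_continuous: "continuous_on U \<phi>" "continuous_on (\<phi> ` U) (inv_into U \<phi>)"
proof -
  obtain \<psi> where h: "open U" "open (\<phi> ` U)" "homeomorphism U (\<phi> ` U) \<phi> \<psi>"
    using assms unfolding smooth_manifold_def by fastforce
  then show "open U" "open (\<phi> ` U)" "continuous_on U \<phi>" by (auto simp: homeomorphism_def)
  show inj: "inj_on \<phi> U" using h(3) by (metis homeomorphism_apply1 inj_onI)
  have "inv_into U \<phi> y = \<psi> y" if "y \<in> \<phi> ` U" for y
    using that inj homeomorphism_apply1[OF h(3)] by (auto simp: inv_into_f_f)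
  then show "continuous_on (\<phi> ` U) (inv_into U \<phi>)"
    using h(3) by (simp add: homeomorphism_def cong: continuous_on_cong)
qed

lemma chart_image_open:
  assumes A: "smooth_manifold A" "(U, \<phi>) \<in> A" and N: "open N" "N \<subseteq> U"
  shows "open (\<phi> ` N)"
proof -
  have "\<phi> ` N = \<phi> ` U \<inter> inv_into U \<phi> -` N"
    using N(2) chart_inj_on[OF A] by (auto simp: inv_into_f_f subset_iff)
  then show ?thesis
    using continuous_open_preimage[OF chart_continuous(2)[OF A] chart_open(2)[OF A] N(1)] by simp
qed

lemma chart_inv: "smooth_manifold A \<Longrightarrow> (U, \<phi>) \<in> A \<Longrightarrow> x \<in> U \<Longrightarrow> inv_into U \<phi> (\<phi> x) = x"
  using chart_inj_on by (metis inv_into_f_f)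

lemma chart_transition:
  assumes "smooth_manifold A" "(U, \<phi>) \<in> A" "(V, \<psi>) \<in> A"
  shows "smooth_on (\<phi> ` (U \<inter> V)) (\<psi> \<circ> inv_into U \<phi>)"
  using assms unfolding smooth_manifold_def by fast

text \<open>One pair of charts around each point is enough: chart transitions on both sides carry
  smoothness to every other pair, and continuity is recovered from the local expression.\<close>

lemma smooth_map_localI:
  assumes A: "smooth_manifold A" and B: "smooth_manifold B"
    and loc: "\<And>x. x \<in> W \<Longrightarrow> \<exists>U \<phi> V \<psi> N. (U, \<phi>) \<in> A \<and> (V, \<psi>) \<in> B \<and> open N \<and> x \<in> N \<and> N \<subseteq> U \<and>
      F ` N \<subseteq> V \<and> smooth_on (\<phi> ` N) (\<psi> \<circ> F \<circ> inv_into U \<phi>)"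
  shows "smooth_map A B W F"
proof -
  have cont: "continuous_on N F"
    if h: "(U, \<phi>) \<in> A" "(V, \<psi>) \<in> B" "open N" "N \<subseteq> U" "F ` N \<subseteq> V"
      "smooth_on (\<phi> ` N) (\<psi> \<circ> F \<circ> inv_into U \<phi>)" for U \<phi> V \<psi> N
  proof -
    have c1: "continuous_on N \<phi>" using chart_continuous(1)[OF A h(1)] h(4) continuous_on_subset by blast
    have c2: "continuous_on N ((\<psi> \<circ> F \<circ> inv_into U \<phi>) \<circ> \<phi>)"
      by (rule continuous_on_compose[OF c1 smooth_on_imp_continuous_on[OF h(6)]])
    have im: "((\<psi> \<circ> F \<circ> inv_into U \<phi>) \<circ> \<phi>) ` N \<subseteq> \<psi> ` V"
      using h(4,5) chart_inv[OF A h(1)] by (auto simp: subset_iff image_subset_iff)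
    have c3: "continuous_on N (inv_into V \<psi> \<circ> ((\<psi> \<circ> F \<circ> inv_into U \<phi>) \<circ> \<phi>))"
      by (rule continuous_on_compose[OF c2 continuous_on_subset[OF chart_continuous(2)[OF B h(2)] im]])
    show ?thesis
    proof (rule continuous_on_eq[OF c3])
      fix x assume "x \<in> N"
      then have "x \<in> U" "F x \<in> V" using h(4,5) by auto
      then show "(inv_into V \<psi> \<circ> ((\<psi> \<circ> F \<circ> inv_into U \<phi>) \<circ> \<phi>)) x = F x"
        using chart_inv[OF A h(1)] chart_inv[OF B h(2)] by simp
    qed
  qed
  have "continuous_on W F"
  proof (rule continuous_at_imp_continuous_on, rule ballI)
    fix x assume "x \<in> W"
    with loc obtain U \<phi> V \<psi> N where h: "(U, \<phi>) \<in> A" "(V, \<psi>) \<in> B" "open N" "x \<in> N" "N \<subseteq> U" "F ` N \<subseteq> V"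
      "smooth_on (\<phi> ` N) (\<psi> \<circ> F \<circ> inv_into U \<phi>)" by metis
    then show "isCont F x" using cont[OF h(1,2,3,5,6,7)] by (simp add: continuous_on_eq_continuous_at)
  qed
  moreover have "smooth_on (\<phi>' ` (U' \<inter> W \<inter> F -` V')) (\<psi>' \<circ> F \<circ> inv_into U' \<phi>')"
    if c: "(U', \<phi>') \<in> A" "(V', \<psi>') \<in> B" for U' \<phi>' V' \<psi>'
  proof (rule smooth_on_local)
    fix y assume "y \<in> \<phi>' ` (U' \<inter> W \<inter> F -` V')"
    then obtain x where x: "x \<in> U'" "x \<in> W" "F x \<in> V'" "y = \<phi>' x" by auto
    with loc obtain U \<phi> V \<psi> N where h: "(U, \<phi>) \<in> A" "(V, \<psi>) \<in> B" "open N" "x \<in> N" "N \<subseteq> U" "F ` N \<subseteq> V"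
      "smooth_on (\<phi> ` N) (\<psi> \<circ> F \<circ> inv_into U \<phi>)" by metis
    define N' where "N' = N \<inter> U' \<inter> F -` V'"
    have "N' = U' \<inter> (N \<inter> F -` V')" unfolding N'_def by auto
    then have oN': "open N'"
      using continuous_open_preimage[OF cont[OF h(1,2,3,5,6,7)] h(3) chart_open(1)[OF B c(2)]]
        chart_open(1)[OF A c(1)] by (simp add: open_Int)
    have N': "x \<in> N'" "N' \<subseteq> N" "N' \<subseteq> U'" "N' \<subseteq> U" "F ` N' \<subseteq> V \<inter> V'"
      unfolding N'_def using x h by auto
    let ?T = "\<phi>' ` N'"
    have oT: "open ?T" by (rule chart_image_open[OF A c(1) oN' N'(3)])
    let ?a = "\<phi> \<circ> inv_into U' \<phi>'" and ?b = "\<psi> \<circ> F \<circ> inv_into U \<phi>" and ?c = "\<psi>' \<circ> inv_into V \<psi>"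
    have s1: "smooth_on ?T ?a"
      using chart_transition[OF A c(1) h(1)] by (rule smooth_on_subset) (use N' in auto)
    have im1: "?a ` ?T \<subseteq> \<phi> ` N'"
      using chart_inv[OF A c(1)] N'(3) by auto
    have oN: "open (\<phi> ` N')" using chart_image_open[OF A h(1) oN' N'(4)] .
    have s2: "smooth_on (\<phi> ` N') ?b" using smooth_on_subset[OF h(7)] N'(2) by blast
    have s12: "smooth_on ?T (?b \<circ> ?a)" by (rule smooth_on_compose[OF oT oN im1 s1 s2])
    have im2: "(?b \<circ> ?a) ` ?T \<subseteq> \<psi> ` (V \<inter> V')"
    proof
      fix z assume "z \<in> (?b \<circ> ?a) ` ?T"
      then obtain w where w: "w \<in> N'" "z = (?b \<circ> ?a) (\<phi>' w)" by auto
      then have "z = \<psi> (F w)" using chart_inv[OF A c(1)] chart_inv[OF A h(1)] N' by (simp add: subset_iff)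
      then show "z \<in> \<psi> ` (V \<inter> V')" using w(1) N'(5) by auto
    qed
    have oV: "open (\<psi> ` (V \<inter> V'))"
      using chart_image_open[OF B h(2)] chart_open(1)[OF B h(2)] chart_open(1)[OF B c(2)] by auto
    have s123: "smooth_on ?T (?c \<circ> (?b \<circ> ?a))"
      by (rule smooth_on_compose[OF oT oV im2 s12 chart_transition[OF B h(2) c(2)]])
    have "smooth_on ?T (\<psi>' \<circ> F \<circ> inv_into U' \<phi>')"
    proof (rule smooth_on_cong[OF oT _ s123])
      fix z assume "z \<in> ?T"
      then obtain w where w: "w \<in> N'" "z = \<phi>' w" by auto
      then have "w \<in> U" "w \<in> U'" "F w \<in> V" using N' by auto
      then show "(?c \<circ> (?b \<circ> ?a)) z = (\<psi>' \<circ> F \<circ> inv_into U' \<phi>') z"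
        using chart_inv[OF A c(1)] chart_inv[OF A h(1)] chart_inv[OF B h(2)] w by simp
    qed
    then show "\<exists>T. open T \<and> y \<in> T \<and> smooth_on T (\<psi>' \<circ> F \<circ> inv_into U' \<phi>')"
      using oT x(4) N'(1) by blast
  qed
  ultimately show ?thesis unfolding smooth_map_def by auto
qed

lemma smooth_map_local:
  assumes A: "smooth_manifold A" and W: "open W" and F: "smooth_map A B W F"
    and c: "(U, \<phi>) \<in> A" "(V, \<psi>) \<in> B"
  defines "N \<equiv> U \<inter> W \<inter> F -` V"
  assumes B: "smooth_manifold B"
  shows "open N" "N \<subseteq> U" "N \<subseteq> W" "F ` N \<subseteq> V" "smooth_on (\<phi> ` N) (\<psi> \<circ> F \<circ> inv_into U \<phi>)"
proof -
  have "continuous_on W F" using F unfolding smooth_map_def by blast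
  from continuous_open_preimage[OF this W chart_open(1)[OF B c(2)]] chart_open(1)[OF A c(1)]
  show "open N" unfolding N_def by (simp add: Int_assoc open_Int)
  show "N \<subseteq> U" "N \<subseteq> W" "F ` N \<subseteq> V" unfolding N_def by auto
  show "smooth_on (\<phi> ` N) (\<psi> \<circ> F \<circ> inv_into U \<phi>)"
    using F c unfolding N_def smooth_map_def by fast
qed

lemma smooth_map_continuous: "smooth_map A B W F \<Longrightarrow> continuous_on W F"
  unfolding smooth_map_def by blast

lemma smooth_map_preimage_open: "open W \<Longrightarrow> smooth_map A B W F \<Longrightarrow> open V \<Longrightarrow> open (W \<inter> F -` V)"
  by (metis continuous_open_preimage smooth_map_continuous)

lemma smooth_map_compose:
  assumes A: "smooth_manifold A" and B: "smooth_manifold B" and C: "smooth_manifold C"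
    and W: "open W" "open V" "F ` W \<subseteq> V" and F: "smooth_map A B W F" and G: "smooth_map B C V G"
  shows "smooth_map A C W (\<lambda>x. G (F x))"
proof (rule smooth_map_localI[OF A C])
  fix x assume x: "x \<in> W"
  obtain U1 \<phi>1 where c1: "(U1, \<phi>1) \<in> A" "x \<in> U1" using chart_exists[OF A] by metis
  obtain U2 \<phi>2 where c2: "(U2, \<phi>2) \<in> B" "F x \<in> U2" using chart_exists[OF B] by metis
  obtain U3 \<phi>3 where c3: "(U3, \<phi>3) \<in> C" "G (F x) \<in> U3" using chart_exists[OF C] by metis
  define N1 where "N1 = U1 \<inter> W \<inter> F -` U2"
  define N2 where "N2 = U2 \<inter> V \<inter> G -` U3"
  note n1 = smooth_map_local[OF A W(1) F c1(1) c2(1) B, folded N1_def]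
  note n2 = smooth_map_local[OF B W(2) G c2(1) c3(1) C, folded N2_def]
  define N where "N = N1 \<inter> (W \<inter> F -` N2)"
  have oN: "open N" unfolding N_def using n1(1) smooth_map_preimage_open[OF W(1) F n2(1)] by auto
  have N: "x \<in> N" "N \<subseteq> N1" "N \<subseteq> U1" "F ` N \<subseteq> N2"
    unfolding N_def N1_def N2_def using x c1 c2 c3 W(3) by auto
  let ?a = "\<phi>2 \<circ> F \<circ> inv_into U1 \<phi>1" and ?b = "\<phi>3 \<circ> G \<circ> inv_into U2 \<phi>2"
  have o1: "open (\<phi>1 ` N)" by (rule chart_image_open[OF A c1(1) oN N(3)])
  have o2: "open (\<phi>2 ` N2)" by (rule chart_image_open[OF B c2(1) n2(1) n2(2)])
  have im: "?a ` (\<phi>1 ` N) \<subseteq> \<phi>2 ` N2"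
    using chart_inv[OF A c1(1)] N by (auto simp: subset_iff)
  have s1: "smooth_on (\<phi>1 ` N) ?a" by (rule smooth_on_subset[OF n1(5)]) (use N in auto)
  have s: "smooth_on (\<phi>1 ` N) (?b \<circ> ?a)" by (rule smooth_on_compose[OF o1 o2 im s1 n2(5)])
  have "smooth_on (\<phi>1 ` N) (\<phi>3 \<circ> (\<lambda>x. G (F x)) \<circ> inv_into U1 \<phi>1)"
  proof (rule smooth_on_cong[OF o1 _ s])
    fix y assume "y \<in> \<phi>1 ` N"
    then obtain w where w: "w \<in> N" "y = \<phi>1 w" by auto
    then have "w \<in> U1" "F w \<in> U2" using N n2(2) by auto
    then show "(?b \<circ> ?a) y = (\<phi>3 \<circ> (\<lambda>x. G (F x)) \<circ> inv_into U1 \<phi>1) y"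
      using w chart_inv[OF A c1(1)] chart_inv[OF B c2(1)] by simp
  qed
  moreover have "(\<lambda>x. G (F x)) ` N \<subseteq> U3" using N(4) n2(4) by auto
  ultimately show "\<exists>U \<phi> V \<psi> N. (U, \<phi>) \<in> A \<and> (V, \<psi>) \<in> C \<and> open N \<and> x \<in> N \<and> N \<subseteq> U \<and>
      (\<lambda>x. G (F x)) ` N \<subseteq> V \<and> smooth_on (\<phi> ` N) (\<psi> \<circ> (\<lambda>x. G (F x)) \<circ> inv_into U \<phi>)"
    using c1(1) c3(1) oN N(1,3) by blast
qed

lemma smooth_map_subset: "smooth_map A B W F \<Longrightarrow> V \<subseteq> W \<Longrightarrow> smooth_map A B V F"
  unfolding smooth_map_def
  by (force intro: continuous_on_subset smooth_on_subset)

lemma smooth_map_cong: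
  assumes A: "smooth_manifold A" and B: "smooth_manifold B"
    and W: "open W" and F: "smooth_map A B W F" and eq: "\<And>x. x \<in> W \<Longrightarrow> F x = G x"
  shows "smooth_map A B W G"
proof (rule smooth_map_localI[OF A B])
  fix x assume x: "x \<in> W"
  obtain U1 \<phi>1 where c1: "(U1, \<phi>1) \<in> A" "x \<in> U1" using chart_exists[OF A] by metis
  obtain U2 \<phi>2 where c2: "(U2, \<phi>2) \<in> B" "F x \<in> U2" using chart_exists[OF B] by metis
  define N1 where "N1 = U1 \<inter> W \<inter> F -` U2"
  note n1 = smooth_map_local[OF A W(1) F c1(1) c2(1) B, folded N1_def]
  have "smooth_on (\<phi>1 ` N1) (\<phi>2 \<circ> G \<circ> inv_into U1 \<phi>1)"
  proof (rule smooth_on_cong[OF _ _ n1(5)])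
    show "open (\<phi>1 ` N1)" by (rule chart_image_open[OF A c1(1) n1(1) n1(2)])
    fix y assume "y \<in> \<phi>1 ` N1"
    then obtain w where w: "w \<in> N1" "y = \<phi>1 w" by auto
    then have "w \<in> U1" "w \<in> W" using n1 by auto
    then show "(\<phi>2 \<circ> F \<circ> inv_into U1 \<phi>1) y = (\<phi>2 \<circ> G \<circ> inv_into U1 \<phi>1) y"
      using w eq chart_inv[OF A c1(1)] by simp
  qed
  moreover have "G ` N1 \<subseteq> U2" using n1(3,4) eq by fastforce
  moreover have "x \<in> N1" using x c1 c2 N1_def by auto
  ultimately show "\<exists>U \<phi> V \<psi> N. (U, \<phi>) \<in> A \<and> (V, \<psi>) \<in> B \<and> open N \<and> x \<in> N \<and> N \<subseteq> U \<and>
      G ` N \<subseteq> V \<and> smooth_on (\<phi> ` N) (\<psi> \<circ> G \<circ> inv_into U \<phi>)"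
    using c1(1) c2(1) n1(1,2) by blast
qed

lemma smooth_map_ident:
  assumes A: "smooth_manifold A"
  shows "smooth_map A A W (\<lambda>x. x)"
  unfolding smooth_map_def
proof (intro conjI ballI, rule continuous_on_id, clarify)
  fix U \<phi> V \<psi> assume c: "(U, \<phi>) \<in> A" "(V, \<psi>) \<in> A"
  have "smooth_on (\<phi> ` (U \<inter> W \<inter> V)) (\<psi> \<circ> inv_into U \<phi>)"
    by (rule smooth_on_subset[OF chart_transition[OF A c]]) auto
  then show "smooth_on (\<phi> ` (U \<inter> W \<inter> (\<lambda>x. x) -` V)) (\<psi> \<circ> (\<lambda>x. x) \<circ> inv_into U \<phi>)"
    by (simp add: o_def)
qed

lemma smooth_map_const:
  assumes A: "smooth_manifold A" and B: "smooth_manifold B"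
  shows "smooth_map A B W (\<lambda>x. c)"
  unfolding smooth_map_def by (auto simp: o_def smooth_on_def Ck_on_const continuous_on_const)

lemma smooth_manifold_real_atlas: "smooth_manifold real_atlas"
proof -
  have "inv_into UNIV (\<lambda>t::real. t) = (\<lambda>t. t)" by (simp add: inv_into_def fun_eq_iff)
  moreover have "homeomorphism UNIV UNIV (\<lambda>t::real. t) (\<lambda>t. t)" by (simp add: homeomorphism_def continuous_on_id)
  ultimately show ?thesis
    unfolding smooth_manifold_def real_atlas_def
    by (auto simp: smooth_on_def o_def Ck_on_bounded_linear_self bounded_linear_ident)
qed

text \<open>Makes results on maps between manifolds, composition above all, available for functions
  with values in vector spaces, one component at a time.\<close>

lemma smooth_fun_real_iff:
  fixes f :: "_ \<Rightarrow> real"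
  assumes A: "smooth_manifold A" and W: "open W"
  shows "smooth_fun A W f \<longleftrightarrow> smooth_map A real_atlas W f"
proof
  assume f: "smooth_fun A W f"
  have "linear (\<lambda>t::real. t)" by (simp add: linear_iff)
  then have s: "smooth_on (\<phi> ` (U \<inter> W)) ((\<lambda>t. t) \<circ> f \<circ> inv_into U \<phi>)" if "(U, \<phi>) \<in> A" for U \<phi>
    using f that unfolding smooth_fun_def by fast
  show "smooth_map A real_atlas W f"
  proof (rule smooth_map_localI[OF A smooth_manifold_real_atlas])
    fix x assume "x \<in> W"
    obtain U \<phi> where c: "(U, \<phi>) \<in> A" "x \<in> U" using chart_exists[OF A] by metis
    show "\<exists>U \<phi> V \<psi> N. (U, \<phi>) \<in> A \<and> (V, \<psi>) \<in> real_atlas \<and> open N \<and> x \<in> N \<and> N \<subseteq> U \<and>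
      f ` N \<subseteq> V \<and> smooth_on (\<phi> ` N) (\<psi> \<circ> f \<circ> inv_into U \<phi>)"
      using c s[OF c(1)] \<open>x \<in> W\<close> open_Int[OF chart_open(1)[OF A c(1)] W] unfolding real_atlas_def
      by (intro exI[of _ U] exI[of _ \<phi>]) (rule exI[of _ UNIV], rule exI[of _ "\<lambda>t. t"], rule exI[of _ "U \<inter> W"], auto)
  qed
next
  assume f: "smooth_map A real_atlas W f"
  show "smooth_fun A W f"
    unfolding smooth_fun_def
  proof (intro allI impI ballI, clarify)
    fix l :: "real \<Rightarrow> real" and U \<phi> assume l: "linear l" and c: "(U, \<phi>) \<in> A"
    have s: "smooth_on (\<phi> ` (U \<inter> W)) (f \<circ> inv_into U \<phi>)"
      using f c unfolding smooth_map_def real_atlas_def by (fastforce simp: o_def)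
    have "open (\<phi> ` (U \<inter> W))"
      using chart_image_open[OF A c] W chart_open(1)[OF A c] by auto
    then show "smooth_on (\<phi> ` (U \<inter> W)) (l \<circ> f \<circ> inv_into U \<phi>)"
      using s l unfolding smooth_on_def
      by (auto simp: o_def linear_conv_bounded_linear intro: Ck_on_bounded_linear)
  qed
qed

lemma smooth_fun_iff:
  fixes f :: "_ \<Rightarrow> 'w::fin_dim_vector"
  shows "smooth_fun A W f \<longleftrightarrow> (\<forall>l. linear l \<longrightarrow> smooth_fun A W (\<lambda>x. l (f x) :: real))"
proof (intro iffI allI impI)
  fix l :: "'w \<Rightarrow> real" assume f: "smooth_fun A W f" and l: "linear l"
  have "linear (m \<circ> l)" if "linear m" for m :: "real \<Rightarrow> real" using l that by (rule linear_compose)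
  then show "smooth_fun A W (\<lambda>x. l (f x))"
    using f unfolding smooth_fun_def by (fastforce simp: o_def)
next
  assume f: "\<forall>l. linear l \<longrightarrow> smooth_fun A W (\<lambda>x. l (f x) :: real)"
  have "linear (\<lambda>t::real. t)" by (simp add: linear_iff)
  then show "smooth_fun A W f"
    using f unfolding smooth_fun_def by (fastforce simp: o_def)
qed

lemma smooth_fun_linear: "smooth_fun A W f \<Longrightarrow> linear l \<Longrightarrow> smooth_fun A W (\<lambda>x. l (f x))"
  for l :: "'v::fin_dim_vector \<Rightarrow> 'w::fin_dim_vector"
  unfolding smooth_fun_iff[of A W f] smooth_fun_iff[of A W "\<lambda>x. l (f x)"]
  using linear_compose[of l] by (auto simp: o_def)

lemma smooth_fun_compose:
  fixes G :: "_ \<Rightarrow> 'w::fin_dim_vector"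
  assumes A: "smooth_manifold A" and B: "smooth_manifold B"
    and W: "open W" "open V" "F ` W \<subseteq> V" and F: "smooth_map A B W F" and G: "smooth_fun B V G"
  shows "smooth_fun A W (\<lambda>x. G (F x))"
  unfolding smooth_fun_iff[of _ _ "\<lambda>x. G (F x)"] smooth_fun_real_iff[OF A W(1)]
proof (intro allI impI)
  fix l :: "'w \<Rightarrow> real" assume "linear l"
  then have "smooth_map B real_atlas V (\<lambda>x. l (G x))"
    using G unfolding smooth_fun_iff[of _ _ G] smooth_fun_real_iff[OF B W(2)] by blast
  from smooth_map_compose[OF A B smooth_manifold_real_atlas W F this]
  show "smooth_map A real_atlas W (\<lambda>x. l (G (F x)))" .
qed

lemma smooth_fun_subset: "smooth_fun A W f \<Longrightarrow> V \<subseteq> W \<Longrightarrow> smooth_fun A V f"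
  unfolding smooth_fun_def by (fast intro: smooth_on_subset)

lemma smooth_fun_cong:
  assumes A: "smooth_manifold A" and W: "open W" and f: "smooth_fun A W f" and eq: "\<And>x. x \<in> W \<Longrightarrow> f x = g x"
  shows "smooth_fun A W g"
  using f smooth_map_cong[OF A smooth_manifold_real_atlas W] eq
  unfolding smooth_fun_iff[of _ _ f] smooth_fun_iff[of _ _ g]
  by (fastforce simp: smooth_fun_real_iff[OF A W])

lemma smooth_fun_const: "smooth_fun A W (\<lambda>x. c)"
  unfolding smooth_fun_def by (auto simp: o_def smooth_on_def Ck_on_const)

lemma smooth_fun_add:
  fixes f :: "_ \<Rightarrow> 'w::fin_dim_vector"
  assumes A: "smooth_manifold A" and W: "open W" and f: "smooth_fun A W f" and g: "smooth_fun A W g"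
  shows "smooth_fun A W (\<lambda>x. f x + g x)"
  unfolding smooth_fun_def
proof (intro allI impI ballI, clarify)
  fix l :: "'w \<Rightarrow> real" and U \<phi> assume l: "linear l" and c: "(U, \<phi>) \<in> A"
  have o: "open (\<phi> ` (U \<inter> W))"
    using chart_image_open[OF A c] W chart_open(1)[OF A c] by auto
  have "smooth_on (\<phi> ` (U \<inter> W)) (l \<circ> f \<circ> inv_into U \<phi>)" "smooth_on (\<phi> ` (U \<inter> W)) (l \<circ> g \<circ> inv_into U \<phi>)"
    using f g l c unfolding smooth_fun_def by fast+
  then show "smooth_on (\<phi> ` (U \<inter> W)) (l \<circ> (\<lambda>x. f x + g x) \<circ> inv_into U \<phi>)"
    using Ck_on_add[OF o, of _ "\<lambda>x. l (f (inv_into U \<phi> x))" "\<lambda>x. l (g (inv_into U \<phi> x))"] l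
    unfolding smooth_on_def by (simp add: o_def linear_add)
qed

lemma smooth_fun_scaleR:
  fixes g :: "_ \<Rightarrow> 'w::fin_dim_vector"
  assumes A: "smooth_manifold A" and W: "open W" and f: "smooth_fun A W f" and g: "smooth_fun A W g"
  shows "smooth_fun A W (\<lambda>x. f x *\<^sub>R g x)"
  unfolding smooth_fun_def
proof (intro allI impI ballI, clarify)
  fix l :: "'w \<Rightarrow> real" and U \<phi> assume l: "linear l" and c: "(U, \<phi>) \<in> A"
  have o: "open (\<phi> ` (U \<inter> W))"
    using chart_image_open[OF A c] W chart_open(1)[OF A c] by auto
  have "linear (\<lambda>t::real. t)" by (simp add: linear_iff)
  then have "smooth_on (\<phi> ` (U \<inter> W)) ((\<lambda>t. t) \<circ> f \<circ> inv_into U \<phi>)" "smooth_on (\<phi> ` (U \<inter> W)) (l \<circ> g \<circ> inv_into U \<phi>)"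
    using f g l c unfolding smooth_fun_def by fast+
  then show "smooth_on (\<phi> ` (U \<inter> W)) (l \<circ> (\<lambda>x. f x *\<^sub>R g x) \<circ> inv_into U \<phi>)"
    using Ck_on_scaleR[OF o, of _ "\<lambda>x. f (inv_into U \<phi> x)" "\<lambda>x. l (g (inv_into U \<phi> x))"] l unfolding smooth_on_def
    by (simp add: o_def linear_scale)
qed

lemma smooth_fun_sum:
  assumes A: "smooth_manifold A" and W: "open W" and f: "\<And>i. i \<in> I \<Longrightarrow> smooth_fun A W (f i)"
  shows "smooth_fun A W (\<lambda>x. \<Sum>i\<in>I. f i x)"
  using f by (induction I rule: infinite_finite_induct) (auto simp: smooth_fun_const intro: smooth_fun_add[OF A W])

section \<open>Products of manifolds and smooth maps into and out of them\<close>

lemma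
  assumes A: "smooth_manifold A" "(U, \<phi>) \<in> A" and B: "smooth_manifold B" "(V, \<psi>) \<in> B"
  shows map_prod_image: "map_prod \<phi> \<psi> ` (U \<times> V) = \<phi> ` U \<times> \<psi> ` V"
    and inv_into_map_prod: "a \<in> \<phi> ` U \<Longrightarrow> b \<in> \<psi> ` V \<Longrightarrow>
      inv_into (U \<times> V) (map_prod \<phi> \<psi>) (a, b) = (inv_into U \<phi> a, inv_into V \<psi> b)"
proof -
  show "map_prod \<phi> \<psi> ` (U \<times> V) = \<phi> ` U \<times> \<psi> ` V" by auto
  have "inj_on (map_prod \<phi> \<psi>) (U \<times> V)"
    using chart_inj_on[OF A] chart_inj_on[OF B] by (rule map_prod_inj_on)
  then show "inv_into (U \<times> V) (map_prod \<phi> \<psi>) (a, b) = (inv_into U \<phi> a, inv_into V \<psi> b)"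
    if "a \<in> \<phi> ` U" "b \<in> \<psi> ` V"
    using that by (intro inv_into_f_eq) (auto simp: inv_into_into f_inv_into_f)
qed

lemma smooth_manifold_prod_atlas:
  assumes A: "smooth_manifold A" and B: "smooth_manifold B"
  shows "smooth_manifold (prod_atlas A B)"
proof -
  have "(\<Union>(U, \<phi>)\<in>prod_atlas A B. U) = UNIV"
  proof (rule sym, rule UNIV_eq_I)
    fix x :: "'a \<times> 'c"
    obtain U \<phi> where "(U, \<phi>) \<in> A" "fst x \<in> U" using chart_exists[OF A] by metis
    moreover obtain V \<psi> where "(V, \<psi>) \<in> B" "snd x \<in> V" using chart_exists[OF B] by metis
    ultimately have "(U \<times> V, map_prod \<phi> \<psi>) \<in> prod_atlas A B" "x \<in> U \<times> V"
      unfolding prod_atlas_def by (auto simp: mem_Times_iff)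
    then show "x \<in> (\<Union>(U, \<phi>)\<in>prod_atlas A B. U)" by blast
  qed
  moreover have "(case c of (U, \<phi>) \<Rightarrow> open U \<and> open (\<phi> ` U) \<and> (\<exists>\<psi>. homeomorphism U (\<phi> ` U) \<phi> \<psi>)) \<and>
    (case c of (U, \<phi>) \<Rightarrow> case d of (V, \<psi>) \<Rightarrow> smooth_on (\<phi> ` (U \<inter> V)) (\<psi> \<circ> inv_into U \<phi>))"
    if "c \<in> prod_atlas A B" "d \<in> prod_atlas A B" for c d
  proof
  from that(1) obtain U \<phi> V \<psi> where c: "c = (U \<times> V, map_prod \<phi> \<psi>)" "(U, \<phi>) \<in> A" "(V, \<psi>) \<in> B"
    unfolding prod_atlas_def by auto
  note im = map_prod_image[OF A c(2) B c(3)] and inv = inv_into_map_prod[OF A c(2) B c(3)]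
  note oU = chart_open[OF A c(2)] chart_open[OF B c(3)]
  let ?inv = "\<lambda>z. (inv_into U \<phi> (fst z), inv_into V \<psi> (snd z))"
  have "homeomorphism (U \<times> V) (\<phi> ` U \<times> \<psi> ` V) (map_prod \<phi> \<psi>) ?inv"
  proof (rule homeomorphismI)
    show "continuous_on (U \<times> V) (map_prod \<phi> \<psi>)"
      unfolding map_prod_def case_prod_beta
      by (intro continuous_on_Pair continuous_on_compose2[OF chart_continuous(1)[OF A c(2)]]
          continuous_on_compose2[OF chart_continuous(1)[OF B c(3)]] continuous_on_fst continuous_on_snd continuous_on_id) auto
    show "continuous_on (\<phi> ` U \<times> \<psi> ` V) ?inv"
      by (intro continuous_on_Pair continuous_on_compose2[OF chart_continuous(2)[OF A c(2)]]
          continuous_on_compose2[OF chart_continuous(2)[OF B c(3)]] continuous_on_fst continuous_on_snd continuous_on_id) auto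
  qed (auto simp: chart_inv[OF A c(2)] chart_inv[OF B c(3)] inv_into_into f_inv_into_f)
  then show "case c of (U, \<phi>) \<Rightarrow> open U \<and> open (\<phi> ` U) \<and> (\<exists>\<psi>. homeomorphism U (\<phi> ` U) \<phi> \<psi>)"
    using oU im c(1) by (auto simp: open_Times simp del: map_prod_surj_on)
  from that(2) obtain U' \<phi>' V' \<psi>' where d: "d = (U' \<times> V', map_prod \<phi>' \<psi>')" "(U', \<phi>') \<in> A" "(V', \<psi>') \<in> B"
    unfolding prod_atlas_def by auto
  have im': "map_prod \<phi> \<psi> ` (U \<times> V \<inter> U' \<times> V') = \<phi> ` (U \<inter> U') \<times> \<psi> ` (V \<inter> V')" by force
  have o: "open (\<phi> ` (U \<inter> U'))" "open (\<psi> ` (V \<inter> V'))"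
    using oU chart_open[OF A d(2)] chart_open[OF B d(3)]
    by (auto intro!: chart_image_open[OF A c(2)] chart_image_open[OF B c(3)])
  have oT: "open (\<phi> ` (U \<inter> U') \<times> \<psi> ` (V \<inter> V'))" using o by (rule open_Times)
  have sf: "smooth_on S fst" "smooth_on S snd" if "open S" for S :: "('b \<times> 'd) set"
    using that by (auto simp: smooth_on_def Ck_on_bounded_linear_self bounded_linear_fst bounded_linear_snd)
  have s1: "smooth_on (\<phi> ` (U \<inter> U') \<times> \<psi> ` (V \<inter> V')) ((\<phi>' \<circ> inv_into U \<phi>) \<circ> fst)"
    by (rule smooth_on_compose[OF oT o(1) _ sf(1)[OF oT] chart_transition[OF A c(2) d(2)]]) auto
  have s2: "smooth_on (\<phi> ` (U \<inter> U') \<times> \<psi> ` (V \<inter> V')) ((\<psi>' \<circ> inv_into V \<psi>) \<circ> snd)"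
    by (rule smooth_on_compose[OF oT o(2) _ sf(2)[OF oT] chart_transition[OF B c(3) d(3)]]) auto
  have s: "smooth_on (\<phi> ` (U \<inter> U') \<times> \<psi> ` (V \<inter> V')) (\<lambda>z. (((\<phi>' \<circ> inv_into U \<phi>) \<circ> fst) z, ((\<psi>' \<circ> inv_into V \<psi>) \<circ> snd) z))"
    using s1 s2 Ck_on_Pair[OF oT] unfolding smooth_on_def by blast
  have "smooth_on (\<phi> ` (U \<inter> U') \<times> \<psi> ` (V \<inter> V')) (map_prod \<phi>' \<psi>' \<circ> inv_into (U \<times> V) (map_prod \<phi> \<psi>))"
    by (rule smooth_on_cong[OF oT _ s]) (auto simp: inv)
  then show "case c of (U, \<phi>) \<Rightarrow> case d of (V, \<psi>) \<Rightarrow> smooth_on (\<phi> ` (U \<inter> V)) (\<psi> \<circ> inv_into U \<phi>)"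
    using c(1) d(1) im' by simp
  qed
  ultimately show ?thesis
    unfolding smooth_manifold_def by fast
qed

lemma smooth_map_Pair:
  assumes A: "smooth_manifold A" and B: "smooth_manifold B" and C: "smooth_manifold C"
    and W: "open W" and F: "smooth_map A B W F" and G: "smooth_map A C W G"
  shows "smooth_map A (prod_atlas B C) W (\<lambda>x. (F x, G x))"
proof (rule smooth_map_localI[OF A smooth_manifold_prod_atlas[OF B C]])
  fix x assume x: "x \<in> W"
  obtain U1 \<phi>1 where c1: "(U1, \<phi>1) \<in> A" "x \<in> U1" using chart_exists[OF A] by metis
  obtain U2 \<phi>2 where c2: "(U2, \<phi>2) \<in> B" "F x \<in> U2" using chart_exists[OF B] by metis
  obtain U3 \<phi>3 where c3: "(U3, \<phi>3) \<in> C" "G x \<in> U3" using chart_exists[OF C] by metis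
  define N1 where "N1 = U1 \<inter> W \<inter> F -` U2"
  define N2 where "N2 = U1 \<inter> W \<inter> G -` U3"
  note n1 = smooth_map_local[OF A W(1) F c1(1) c2(1) B, folded N1_def]
  note n2 = smooth_map_local[OF A W(1) G c1(1) c3(1) C, folded N2_def]
  define N where "N = N1 \<inter> N2"
  have N: "open N" "x \<in> N" "N \<subseteq> U1" "N \<subseteq> N1" "N \<subseteq> N2" "F ` N \<subseteq> U2" "G ` N \<subseteq> U3"
    unfolding N_def using n1 n2 x c1 c2 c3 unfolding N1_def N2_def by auto
  have o1: "open (\<phi>1 ` N)" by (rule chart_image_open[OF A c1(1) N(1,3)])
  have s1: "smooth_on (\<phi>1 ` N) (\<phi>2 \<circ> F \<circ> inv_into U1 \<phi>1)" by (rule smooth_on_subset[OF n1(5)]) (use N in auto)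
  have s2: "smooth_on (\<phi>1 ` N) (\<phi>3 \<circ> G \<circ> inv_into U1 \<phi>1)" by (rule smooth_on_subset[OF n2(5)]) (use N in auto)
  have "smooth_on (\<phi>1 ` N) (map_prod \<phi>2 \<phi>3 \<circ> (\<lambda>x. (F x, G x)) \<circ> inv_into U1 \<phi>1)"
    using Ck_on_Pair[OF o1, of _ "\<phi>2 \<circ> F \<circ> inv_into U1 \<phi>1" "\<phi>3 \<circ> G \<circ> inv_into U1 \<phi>1"] s1 s2
    unfolding smooth_on_def by (simp add: o_def)
  moreover have "(U2 \<times> U3, map_prod \<phi>2 \<phi>3) \<in> prod_atlas B C" unfolding prod_atlas_def using c2 c3 by blast
  moreover have "(\<lambda>x. (F x, G x)) ` N \<subseteq> U2 \<times> U3" using N by auto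
  ultimately show "\<exists>U \<phi> V \<psi> N. (U, \<phi>) \<in> A \<and> (V, \<psi>) \<in> prod_atlas B C \<and> open N \<and> x \<in> N \<and> N \<subseteq> U \<and>
      (\<lambda>x. (F x, G x)) ` N \<subseteq> V \<and> smooth_on (\<phi> ` N) (\<psi> \<circ> (\<lambda>x. (F x, G x)) \<circ> inv_into U \<phi>)"
    using c1(1) N(1,2,3) by blast
qed

lemma
  fixes A :: "('a::{t2_space,second_countable_topology}, 'e::{real_normed_vector,fin_dim_vector}) atlas"
    and B :: "('b::{t2_space,second_countable_topology}, 'f::{real_normed_vector,fin_dim_vector}) atlas"
  assumes A: "smooth_manifold A" and B: "smooth_manifold B"
  shows smooth_map_fst: "smooth_map (prod_atlas A B) A W fst"
    and smooth_map_snd: "smooth_map (prod_atlas A B) B W snd"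
proof -
  have sf: "smooth_on S fst" "smooth_on S snd" if "open S" for S :: "('e \<times> 'f) set"
    using that by (auto simp: smooth_on_def Ck_on_bounded_linear_self bounded_linear_fst bounded_linear_snd)
  have ex: "\<exists>U \<phi> V \<psi>. (U, \<phi>) \<in> A \<and> (V, \<psi>) \<in> B \<and> open (U \<times> V) \<and> x \<in> U \<times> V \<and> (U \<times> V, map_prod \<phi> \<psi>) \<in> prod_atlas A B \<and>
     smooth_on (map_prod \<phi> \<psi> ` (U \<times> V)) (\<phi> \<circ> fst \<circ> inv_into (U \<times> V) (map_prod \<phi> \<psi>)) \<and>
     smooth_on (map_prod \<phi> \<psi> ` (U \<times> V)) (\<psi> \<circ> snd \<circ> inv_into (U \<times> V) (map_prod \<phi> \<psi>))" for x
  proof -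
    obtain U \<phi> where c: "(U, \<phi>) \<in> A" "fst x \<in> U" using chart_exists[OF A] by metis
    obtain V \<psi> where d: "(V, \<psi>) \<in> B" "snd x \<in> V" using chart_exists[OF B] by metis
    have o: "open (\<phi> ` U \<times> \<psi> ` V)" "open (U \<times> V)"
      using chart_open[OF A c(1)] chart_open[OF B d(1)] by (auto simp: open_Times)
    have "smooth_on (\<phi> ` U \<times> \<psi> ` V) (\<phi> \<circ> fst \<circ> inv_into (U \<times> V) (map_prod \<phi> \<psi>))"
      by (rule smooth_on_cong[OF o(1) _ sf(1)[OF o(1)]]) (auto simp: inv_into_map_prod[OF A c(1) B d(1)] f_inv_into_f)
    moreover have "smooth_on (\<phi> ` U \<times> \<psi> ` V) (\<psi> \<circ> snd \<circ> inv_into (U \<times> V) (map_prod \<phi> \<psi>))"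
      by (rule smooth_on_cong[OF o(1) _ sf(2)[OF o(1)]]) (auto simp: inv_into_map_prod[OF A c(1) B d(1)] f_inv_into_f)
    moreover have "(U \<times> V, map_prod \<phi> \<psi>) \<in> prod_atlas A B" unfolding prod_atlas_def using c d by blast
    ultimately show ?thesis using c d o unfolding map_prod_image[OF A c(1) B d(1)]
      by (intro exI[of _ U] exI[of _ \<phi>] exI[of _ V] exI[of _ \<psi>])
         (simp add: mem_Times_iff map_prod_image[OF A c(1) B d(1)])
  qed
  show "smooth_map (prod_atlas A B) A W fst"
  proof (rule smooth_map_localI[OF smooth_manifold_prod_atlas[OF A B] A])
    fix x :: "'a \<times> 'b"
    from ex[of x] show "\<exists>U \<phi> V \<psi> N. (U, \<phi>) \<in> prod_atlas A B \<and> (V, \<psi>) \<in> A \<and> open N \<and> x \<in> N \<and> N \<subseteq> U \<and>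
      fst ` N \<subseteq> V \<and> smooth_on (\<phi> ` N) (\<psi> \<circ> fst \<circ> inv_into U \<phi>)"
      by (elim exE) (rule exI, rule exI, rule exI, rule exI, rule exI, (rule conjI, blast)+, auto)
  qed
  show "smooth_map (prod_atlas A B) B W snd"
  proof (rule smooth_map_localI[OF smooth_manifold_prod_atlas[OF A B] B])
    fix x :: "'a \<times> 'b"
    from ex[of x] show "\<exists>U \<phi> V \<psi> N. (U, \<phi>) \<in> prod_atlas A B \<and> (V, \<psi>) \<in> B \<and> open N \<and> x \<in> N \<and> N \<subseteq> U \<and>
      snd ` N \<subseteq> V \<and> smooth_on (\<phi> ` N) (\<psi> \<circ> snd \<circ> inv_into U \<phi>)"
      by (elim exE) (rule exI, rule exI, rule exI, rule exI, rule exI, (rule conjI, blast)+, auto)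
  qed
qed

section \<open>Tangent vectors and curves\<close>

text \<open>Version of \<open>smooth_at\<close> for values in a finite-dimensional space, as needed
  for sections and forms.\<close>

definition smooth_near ::
  "('a::topological_space, 'e::real_normed_vector) atlas \<Rightarrow> 'a \<Rightarrow> ('a \<Rightarrow> 'w::fin_dim_vector) \<Rightarrow> bool" where
  "smooth_near A x f \<longleftrightarrow> (\<exists>U. open U \<and> x \<in> U \<and> smooth_fun A U f)"

lemma smooth_at_eq_near: "smooth_at A x f = smooth_near A x f"
  unfolding smooth_at_def smooth_near_def ..

lemma smooth_nearI: "open U \<Longrightarrow> x \<in> U \<Longrightarrow> smooth_fun A U f \<Longrightarrow> smooth_near A x f"
  unfolding smooth_near_def by blast

lemma smooth_near_const: "smooth_near A x (\<lambda>x. c)"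
  unfolding smooth_near_def by (rule exI[of _ UNIV]) (simp add: smooth_fun_const)

lemma smooth_near_add:
  assumes A: "smooth_manifold A" and "smooth_near A x f" "smooth_near A x g"
  shows "smooth_near A x (\<lambda>y. f y + g y)"
proof -
  obtain U V where "open U" "x \<in> U" "smooth_fun A U f" "open V" "x \<in> V" "smooth_fun A V g"
    using assms unfolding smooth_near_def by auto
  then show ?thesis
    by (intro smooth_nearI[of "U \<inter> V"] smooth_fun_add[OF A]) (auto intro: smooth_fun_subset)
qed

lemma smooth_near_scaleR:
  assumes A: "smooth_manifold A" and "smooth_near A x f" "smooth_near A x g"
  shows "smooth_near A x (\<lambda>y. f y *\<^sub>R g y)"
proof -
  obtain U V where "open U" "x \<in> U" "smooth_fun A U f" "open V" "x \<in> V" "smooth_fun A V g"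
    using assms unfolding smooth_near_def by auto
  then show ?thesis
    by (intro smooth_nearI[of "U \<inter> V"] smooth_fun_scaleR[OF A]) (auto intro: smooth_fun_subset)
qed

lemma smooth_near_mult: "smooth_manifold A \<Longrightarrow> smooth_near A x f \<Longrightarrow> smooth_near A x g \<Longrightarrow> smooth_near A x (\<lambda>y. f y * g y)"
  for f g :: "_ \<Rightarrow> real"
  using smooth_near_scaleR[of A x f g] by simp

lemma smooth_near_sum:
  assumes A: "smooth_manifold A" and f: "\<And>i. i \<in> I \<Longrightarrow> smooth_near A x (f i)"
  shows "smooth_near A x (\<lambda>y. \<Sum>i\<in>I. f i y)"
  using f by (induction I rule: infinite_finite_induct) (auto simp: smooth_near_const intro: smooth_near_add[OF A])

lemma smooth_near_linear: "smooth_near A x f \<Longrightarrow> linear l \<Longrightarrow> smooth_near A x (\<lambda>y. l (f y))"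
  for l :: "'v::fin_dim_vector \<Rightarrow> 'w::fin_dim_vector"
  unfolding smooth_near_def using smooth_fun_linear by blast

lemma smooth_near_cong:
  assumes A: "smooth_manifold A" and f: "smooth_near A x f" and eq: "eventually (\<lambda>y. f y = g y) (nhds x)"
  shows "smooth_near A x g"
proof -
  obtain U where U: "open U" "x \<in> U" "smooth_fun A U f" using f unfolding smooth_near_def by auto
  obtain V where V: "open V" "x \<in> V" "\<And>y. y \<in> V \<Longrightarrow> f y = g y" using eq unfolding eventually_nhds by auto
  have "smooth_fun A (U \<inter> V) g"
    by (rule smooth_fun_cong[OF A _ smooth_fun_subset[OF U(3), of "U \<inter> V"]]) (simp_all add: open_Int U V)
  then show ?thesis
    using U(1,2) V(1,2) by (auto simp: smooth_near_def)
qed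

lemma smooth_near_compose:
  assumes A: "smooth_manifold A" and B: "smooth_manifold B"
    and W: "open W" "x \<in> W" and F: "smooth_map A B W F" and f: "smooth_near B (F x) f"
  shows "smooth_near A x (\<lambda>y. f (F y))"
proof -
  obtain V where V: "open V" "F x \<in> V" "smooth_fun B V f" using f unfolding smooth_near_def by auto
  have o: "open (W \<inter> F -` V)" using smooth_map_preimage_open[OF W(1) F V(1)] .
  have "smooth_fun A (W \<inter> F -` V) (\<lambda>y. f (F y))"
    by (rule smooth_fun_compose[where V = V, OF A B o V(1) _ smooth_map_subset[OF F] V(3)]) auto
  then show ?thesis
    using W(2) V(2) by (rule_tac smooth_nearI[OF o]) auto
qed

lemma tangentD:
  assumes "v \<in> tangent_space A x"
  shows "\<not> smooth_near A x f \<Longrightarrow> v f = 0"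
    and "smooth_near A x f \<Longrightarrow> smooth_near A x g \<Longrightarrow> v (\<lambda>y. f y + g y) = v f + v g"
    and "smooth_near A x f \<Longrightarrow> smooth_near A x g \<Longrightarrow> v (\<lambda>y. f y * g y) = f x * v g + g x * v f"
    and "smooth_near A x f \<Longrightarrow> smooth_near A x g \<Longrightarrow> eventually (\<lambda>y. f y = g y) (nhds x) \<Longrightarrow> v f = v g"
    and "smooth_near A x f \<Longrightarrow> v (\<lambda>y. c * f y) = c * v f"
  using assms unfolding tangent_space_def smooth_at_eq_near mem_Collect_eq by blast+

lemma tangentI:
  assumes "\<And>f. \<not> smooth_near A x f \<Longrightarrow> v f = 0"
    and "\<And>f g. smooth_near A x f \<Longrightarrow> smooth_near A x g \<Longrightarrow> v (\<lambda>y. f y + g y) = v f + v g"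
    and "\<And>f g. smooth_near A x f \<Longrightarrow> smooth_near A x g \<Longrightarrow> v (\<lambda>y. f y * g y) = f x * v g + g x * v f"
    and "\<And>f g. smooth_near A x f \<Longrightarrow> smooth_near A x g \<Longrightarrow> eventually (\<lambda>y. f y = g y) (nhds x) \<Longrightarrow> v f = v g"
    and "\<And>f c. smooth_near A x f \<Longrightarrow> v (\<lambda>y. c * f y) = c * v f"
  shows "v \<in> tangent_space A x"
  unfolding tangent_space_def smooth_at_eq_near mem_Collect_eq
  by (intro conjI allI impI) (blast intro: assms)+

lemma tangent_cong:
  assumes "smooth_manifold A" "v \<in> tangent_space A x" "smooth_near A x f" "eventually (\<lambda>y. f y = g y) (nhds x)"
  shows "v f = v g"
  using tangentD(4)[OF assms(2,3) smooth_near_cong[OF assms(1,3,4)] assms(4)] .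

lemma tangent_sum:
  assumes A: "smooth_manifold A" and v: "v \<in> tangent_space A x" and f: "\<And>i. i \<in> I \<Longrightarrow> smooth_near A x (f i)"
  shows "v (\<lambda>y. \<Sum>i\<in>I. f i y) = (\<Sum>i\<in>I. v (f i))"
  using f
proof (induction I rule: infinite_finite_induct)
  case (insert i I)
  then show ?case
    using tangentD(2)[OF v, of "f i" "\<lambda>y. \<Sum>i\<in>I. f i y"] smooth_near_sum[OF A, of I x f] by simp
qed (use tangentD(5)[OF v smooth_near_const[of _ _ 0], of 0] in auto)

lemma tangent_add:
  assumes v: "v \<in> tangent_space A x" and w: "w \<in> tangent_space A x"
  shows "(\<lambda>f. v f + w f) \<in> tangent_space A x"
proof (rule tangentI)
  fix f g :: "_ \<Rightarrow> real" and c
  show "\<not> smooth_near A x f \<Longrightarrow> v f + w f = 0" using tangentD(1)[OF v, of f] tangentD(1)[OF w, of f] by simp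
  assume f: "smooth_near A x f"
  show "v (\<lambda>y. c * f y) + w (\<lambda>y. c * f y) = c * (v f + w f)"
    by (simp add: tangentD(5)[OF v f] tangentD(5)[OF w f] algebra_simps)
  assume g: "smooth_near A x g"
  show "v (\<lambda>y. f y + g y) + w (\<lambda>y. f y + g y) = (v f + w f) + (v g + w g)"
    by (simp add: tangentD(2)[OF v f g] tangentD(2)[OF w f g])
  show "v (\<lambda>y. f y * g y) + w (\<lambda>y. f y * g y) = f x * (v g + w g) + g x * (v f + w f)"
    by (simp add: tangentD(3)[OF v f g] tangentD(3)[OF w f g] algebra_simps)
  show "eventually (\<lambda>y. f y = g y) (nhds x) \<Longrightarrow> v f + w f = v g + w g"
    by (simp only: tangentD(4)[OF v f g] tangentD(4)[OF w f g])
qed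

text \<open>The derivation \<open>v\<close> applied to components of \<open>f\<close> is additive
  and homogeneous in the functional, hence represented by a unique vector; this is the vector
  described in the definition of \<open>dir_deriv\<close>.\<close>

lemma dir_deriv:
  fixes f :: "_ \<Rightarrow> 'w::fin_dim_vector"
  assumes v: "v \<in> tangent_space A x" and f: "smooth_near A x f" and l: "linear l"
  shows "l (dir_deriv v f) = v (\<lambda>y. l (f y))"
proof -
  have "\<exists>!w. \<forall>l. linear l \<longrightarrow> l w = v (\<lambda>y. l (f y))"
  proof (rule fin_dim_reflexive[of "\<lambda>l. v (\<lambda>y. l (f y))"])
    fix l m :: "'w \<Rightarrow> real" and c assume "linear l" "linear m"
    then show "v (\<lambda>y. l (f y) + m (f y)) = v (\<lambda>y. l (f y)) + v (\<lambda>y. m (f y))"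
      using tangentD(2)[OF v smooth_near_linear[OF f] smooth_near_linear[OF f]] by blast
  next
    fix l :: "'w \<Rightarrow> real" and c assume "linear l"
    then show "v (\<lambda>y. c * l (f y)) = c * v (\<lambda>y. l (f y))"
      using tangentD(5)[OF v smooth_near_linear[OF f]] by blast
  qed
  from theI'[OF this] show ?thesis
    unfolding dir_deriv_def o_def using l by blast
qed

lemma dir_deriv_eqI:
  fixes f :: "_ \<Rightarrow> 'w::fin_dim_vector"
  assumes v: "v \<in> tangent_space A x" and f: "smooth_near A x f"
    and eq: "\<And>l::'w \<Rightarrow> real. linear l \<Longrightarrow> v (\<lambda>y. l (f y)) = l w"
  shows "dir_deriv v f = w"
  using dir_deriv[OF v f] eq by (metis functionals_separate)

lemma smooth_fun_real_atlas: "smooth_fun real_atlas N f \<Longrightarrow> smooth_on N f" for f :: "real \<Rightarrow> real"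
proof -
  assume f: "smooth_fun real_atlas N f"
  have i: "inv_into UNIV (\<lambda>t::real. t) = (\<lambda>t. t)" by (simp add: inv_into_def fun_eq_iff)
  have "linear (\<lambda>t::real. t)" by (simp add: linear_iff)
  then show ?thesis using f i unfolding smooth_fun_def real_atlas_def by (force simp: o_def)
qed

lemma smooth_fun_real_atlas_prod:
  fixes f :: "real \<times> real \<Rightarrow> real"
  assumes f: "smooth_fun (prod_atlas real_atlas real_atlas) N f"
  shows "smooth_on N f"
proof -
  have m: "(\<lambda>z::real \<times> real. (fst z, snd z)) = (\<lambda>z. z)" by simp
  have i: "inv_into UNIV (\<lambda>t::real\<times>real. t) = (\<lambda>t. t)" by (simp add: inv_into_def fun_eq_iff)
  have "(UNIV \<times> UNIV, map_prod (\<lambda>t. t) (\<lambda>t. t)) \<in> prod_atlas real_atlas real_atlas"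
    unfolding prod_atlas_def real_atlas_def by blast
  then have "(UNIV, \<lambda>t. t) \<in> prod_atlas real_atlas real_atlas"
    by (simp add: map_prod_def case_prod_beta m)
  moreover have "linear (\<lambda>t::real. t)" by (simp add: linear_iff)
  ultimately show ?thesis using f i unfolding smooth_fun_def by (force simp: o_def)
qed

lemma smooth_at_curve_has_derivative:
  assumes A: "smooth_manifold A" and N: "open N" "0 \<in> N" and c: "smooth_map real_atlas A N c"
    and f: "smooth_near A (c 0) f"
  shows "((\<lambda>t. f (c t)) has_real_derivative velocity A c f) (at 0)"
proof -
  from smooth_near_compose[OF smooth_manifold_real_atlas A N c f]
  obtain M where M: "open M" "0 \<in> M" "smooth_fun real_atlas M (\<lambda>t. f (c t))"
    unfolding smooth_near_def by auto
  then have "smooth_on M (\<lambda>t. f (c t))" using smooth_fun_real_atlas by blast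
  then have "(\<lambda>t. f (c t)) differentiable (at 0)" using M(2) smooth_on_imp_differentiable by blast
  then have "((\<lambda>t. f (c t)) has_real_derivative deriv (\<lambda>t. f (c t)) 0) (at 0)"
    using DERIV_deriv_iff_real_differentiable by blast
  then show ?thesis using f unfolding velocity_def smooth_at_eq_near by (simp add: o_def)
qed

lemma velocity_tangent:
  fixes A :: "('a::{t2_space,second_countable_topology}, 'e::{real_normed_vector,fin_dim_vector}) atlas"
  assumes A: "smooth_manifold A" and N: "open N" "0 \<in> N" and c: "smooth_map real_atlas A N c"
  shows "velocity A c \<in> tangent_space A (c 0)"
proof (rule tangentI)
  note D = smooth_at_curve_has_derivative[OF A N c]
  show "velocity A c f = 0" if "\<not> smooth_near A (c 0) f" for f
    using that by (simp add: velocity_def smooth_at_eq_near)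
  fix f :: "'a \<Rightarrow> real" assume f: "smooth_near A (c 0) f"
  show "velocity A c (\<lambda>y. a * f y) = a * velocity A c f" for a
    using DERIV_unique[OF D[OF smooth_near_mult[OF A smooth_near_const f]] DERIV_cmult[OF D[OF f]]] .
  fix g :: "'a \<Rightarrow> real" assume g: "smooth_near A (c 0) g"
  show "velocity A c (\<lambda>y. f y + g y) = velocity A c f + velocity A c g"
    using DERIV_unique[OF D[OF smooth_near_add[OF A f g]] DERIV_add[OF D[OF f] D[OF g]]] .
  show "velocity A c (\<lambda>y. f y * g y) = f (c 0) * velocity A c g + g (c 0) * velocity A c f"
    using DERIV_unique[OF D[OF smooth_near_mult[OF A f g]] DERIV_mult[OF D[OF f] D[OF g]]] by (simp add: algebra_simps)
  assume eq: "eventually (\<lambda>y. f y = g y) (nhds (c 0))"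
  then obtain V where V: "open V" "c 0 \<in> V" "\<And>y. y \<in> V \<Longrightarrow> f y = g y" unfolding eventually_nhds by auto
  have "open (N \<inter> c -` V)" using smooth_map_preimage_open[OF N(1) c V(1)] .
  then have "((\<lambda>t. g (c t)) has_real_derivative velocity A c f) (at 0)"
    by (rule has_field_derivative_transform_within_open[OF D[OF f]]) (use N V in auto)
  then show "velocity A c f = velocity A c g" using D[OF g] DERIV_unique by blast
qed

lemma pushforward_tangent:
  fixes A :: "('a::{t2_space,second_countable_topology}, 'e::{real_normed_vector,fin_dim_vector}) atlas"
    and B :: "('b::{t2_space,second_countable_topology}, 'f::{real_normed_vector,fin_dim_vector}) atlas"
  assumes A: "smooth_manifold A" and B: "smooth_manifold B"
    and W: "open W" "x \<in> W" and F: "smooth_map A B W F" and v: "v \<in> tangent_space A x"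
  shows "pushforward B F x v \<in> tangent_space B (F x)"
proof (rule tangentI)
  note n = smooth_near_compose[OF A B W F]
  show "pushforward B F x v f = 0" if "\<not> smooth_near B (F x) f" for f
    using that by (simp add: pushforward_def smooth_at_eq_near)
  fix f :: "'b \<Rightarrow> real" assume f: "smooth_near B (F x) f"
  show "pushforward B F x v (\<lambda>y. a * f y) = a * pushforward B F x v f" for a
    using tangentD(5)[OF v n[OF f]] f smooth_near_mult[OF B smooth_near_const f]
    by (simp add: pushforward_def smooth_at_eq_near o_def)
  fix g :: "'b \<Rightarrow> real" assume g: "smooth_near B (F x) g"
  show "pushforward B F x v (\<lambda>y. f y + g y) = pushforward B F x v f + pushforward B F x v g"
    using tangentD(2)[OF v n[OF f] n[OF g]] f g smooth_near_add[OF B f g]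
    by (simp add: pushforward_def smooth_at_eq_near o_def)
  show "pushforward B F x v (\<lambda>y. f y * g y) = f (F x) * pushforward B F x v g + g (F x) * pushforward B F x v f"
    using tangentD(3)[OF v n[OF f] n[OF g]] f g smooth_near_mult[OF B f g]
    by (simp add: pushforward_def smooth_at_eq_near o_def)
  assume "eventually (\<lambda>y. f y = g y) (nhds (F x))"
  then obtain V where V: "open V" "F x \<in> V" "\<And>y. y \<in> V \<Longrightarrow> f y = g y" unfolding eventually_nhds by auto
  then have "eventually (\<lambda>y. f (F y) = g (F y)) (nhds x)"
    unfolding eventually_nhds using smooth_map_preimage_open[OF W(1) F V(1)] W
    by (intro exI[of _ "W \<inter> F -` V"]) auto
  then show "pushforward B F x v f = pushforward B F x v g"
    using tangentD(4)[OF v n[OF f] n[OF g]] f g by (simp add: pushforward_def smooth_at_eq_near o_def)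
qed

text \<open>In a chart, the derivative in the real parameter is a partial derivative of a smooth
  function, restricted to parameter 0. It gives smooth dependence on the base point when
  differentiating along families of curves.\<close>

lemma smooth_fun_partial:
  fixes A :: "('a::{t2_space,second_countable_topology}, 'e::{real_normed_vector,fin_dim_vector}) atlas"
    and F :: "'a \<times> real \<Rightarrow> real"
  assumes A: "smooth_manifold A" and W: "open W" and F: "smooth_fun (prod_atlas A real_atlas) W F"
  shows "smooth_fun A {x. (x, 0) \<in> W} (\<lambda>x. deriv (\<lambda>s. F (x, s)) 0)"
proof -
  let ?R = real_atlas and ?W0 = "{x. (x, 0) \<in> W}" and ?d = "\<lambda>x. deriv (\<lambda>s. F (x, s)) 0"
  have W0: "open ?W0"
    using open_vimage[OF W continuous_on_Pair[OF continuous_on_id continuous_on_const[of UNIV 0]]]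
    by (simp add: vimage_def)
  have R: "(UNIV, \<lambda>t. t) \<in> ?R" by (simp add: real_atlas_def)
  have d: "smooth_on (\<phi> ` (U \<inter> ?W0)) (?d \<circ> inv_into U \<phi>)" if c: "(U, \<phi>) \<in> A" for U \<phi>
  proof -
    let ?\<Phi> = "map_prod \<phi> (\<lambda>t::real. t)"
    define F' where "F' = F \<circ> inv_into (U \<times> UNIV) ?\<Phi>"
    define T where "T = ?\<Phi> ` (U \<times> UNIV \<inter> W)"
    have c': "(U \<times> UNIV, ?\<Phi>) \<in> prod_atlas A ?R" unfolding prod_atlas_def using c R by blast
    note P = smooth_manifold_prod_atlas[OF A smooth_manifold_real_atlas]
    have oT: "open T" unfolding T_def
      using chart_image_open[OF P c'] chart_open(1)[OF P c'] W by auto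
    have "smooth_on T ((\<lambda>t. t) \<circ> F \<circ> inv_into (U \<times> UNIV) ?\<Phi>)"
      using F c' unfolding smooth_fun_def T_def by (fastforce simp: linear_iff)
    then have sF: "smooth_on T F'" by (simp add: F'_def o_def)
    note sD = smooth_on_frechet_derivative[OF sF, of "(0, 1)"]
    have oI: "open (\<phi> ` (U \<inter> ?W0))" using chart_image_open[OF A c] chart_open(1)[OF A c] W0 by auto
    have s0: "smooth_on (\<phi> ` (U \<inter> ?W0)) (\<lambda>e. (e, 0::real))"
      unfolding smooth_on_def
      by (intro allI Ck_on_bounded_linear_self oI bounded_linear_Pair bounded_linear_ident bounded_linear_zero)
    have im: "(\<lambda>e. (e, 0::real)) ` (\<phi> ` (U \<inter> ?W0)) \<subseteq> T" unfolding T_def by force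
    have s: "smooth_on (\<phi> ` (U \<inter> ?W0)) ((\<lambda>x. frechet_derivative F' (at x) (0, 1)) \<circ> (\<lambda>e. (e, 0)))"
      by (rule smooth_on_compose[OF oI oT im s0 sD])
    show ?thesis
    proof (rule smooth_on_cong[OF oI _ s])
      fix e assume "e \<in> \<phi> ` (U \<inter> ?W0)"
      then obtain x where x: "x \<in> U" "(x, 0) \<in> W" "e = \<phi> x" by auto
      have e0: "(e, 0) \<in> T" unfolding T_def using x by force
      from smooth_on_along_line[OF sF, of "(e, 0)" 0 "(0, 1)"] e0
      have "((\<lambda>s. F' (e, s)) has_real_derivative frechet_derivative F' (at (e, 0)) (0, 1)) (at 0)" by simp
      moreover have "F' (e, s) = F (x, s)" for s
        unfolding F'_def using inv_into_map_prod[OF A c smooth_manifold_real_atlas R, of e s] x(1,3) chart_inv[OF A c x(1)]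
        by (simp add: inv_into_def)
      ultimately have "?d x = frechet_derivative F' (at (e, 0)) (0, 1)" by (simp add: DERIV_imp_deriv)
      then show "((\<lambda>x. frechet_derivative F' (at x) (0, 1)) \<circ> (\<lambda>e. (e, 0))) e = (?d \<circ> inv_into U \<phi>) e"
        using x chart_inv[OF A c x(1)] by simp
    qed
  qed
  show ?thesis
    unfolding smooth_fun_real_iff[OF A W0]
  proof (rule smooth_map_localI[OF A smooth_manifold_real_atlas])
    fix x assume x: "x \<in> ?W0"
    obtain U \<phi> where c: "(U, \<phi>) \<in> A" "x \<in> U" using chart_exists[OF A] by metis
    show "\<exists>U \<phi> V \<psi> N. (U, \<phi>) \<in> A \<and> (V, \<psi>) \<in> ?R \<and> open N \<and> x \<in> N \<and> N \<subseteq> U \<and>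
      ?d ` N \<subseteq> V \<and> smooth_on (\<phi> ` N) (\<psi> \<circ> ?d \<circ> inv_into U \<phi>)"
      using c d[OF c(1)] x open_Int[OF chart_open(1)[OF A c(1)] W0] R
      by (intro exI[of _ U] exI[of _ \<phi>])
         (rule exI[of _ UNIV], rule exI[of _ "\<lambda>t. t"], rule exI[of _ "U \<inter> ?W0"], auto simp: o_def)
  qed
qed

text \<open>Schwarz's theorem for iterated \<open>deriv\<close>. The inner derivative is identified
  with a Frechet derivative only near 0, which suffices for the outer one.\<close>

lemma partial_derivatives_commute:
  fixes K :: "real \<times> real \<Rightarrow> real"
  assumes S: "open S" "(0, 0) \<in> S" and K: "smooth_on S K"
  shows "deriv (\<lambda>s. deriv (\<lambda>r. K (s, r)) 0) 0 = deriv (\<lambda>r. deriv (\<lambda>s. K (s, r)) 0) 0"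
proof -
  have D: "deriv (\<lambda>s. frechet_derivative K (at (s *\<^sub>R w)) v) 0 =
      frechet_derivative (\<lambda>x. frechet_derivative K (at x) v) (at (0, 0)) w" for v w
    using smooth_on_along_line[OF smooth_on_frechet_derivative[OF K], of "(0, 0)" 0 w v] S(2)
    by (simp add: DERIV_imp_deriv zero_prod_def[symmetric])
  have ev: "\<forall>\<^sub>F s in nhds 0. s *\<^sub>R w \<in> S" for w :: "real \<times> real"
  proof -
    have "open ((\<lambda>s. s *\<^sub>R w) -` S)" by (rule open_vimage[OF S(1)]) (intro continuous_intros)
    then show ?thesis unfolding eventually_nhds using S(2)
      by (intro exI[of _ "(\<lambda>s. s *\<^sub>R w) -` S"]) (auto simp: zero_prod_def)
  qed
  have "\<forall>\<^sub>F s in nhds 0. deriv (\<lambda>r. K (s, r)) 0 = frechet_derivative K (at (s *\<^sub>R (1, 0))) (0, 1)"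
    using ev[of "(1, 0)"]
  proof eventually_elim
    case (elim s)
    then show ?case using smooth_on_along_line[OF K, of "(s, 0)" 0 "(0, 1)"] by (simp add: DERIV_imp_deriv)
  qed
  then have 1: "deriv (\<lambda>s. deriv (\<lambda>r. K (s, r)) 0) 0 =
      frechet_derivative (\<lambda>x. frechet_derivative K (at x) (0, 1)) (at (0, 0)) (1, 0)"
    unfolding D[of "(1, 0)" "(0, 1)", symmetric] by (rule deriv_cong_ev[OF _ refl])
  have "\<forall>\<^sub>F r in nhds 0. deriv (\<lambda>s. K (s, r)) 0 = frechet_derivative K (at (r *\<^sub>R (0, 1))) (1, 0)"
    using ev[of "(0, 1)"]
  proof eventually_elim
    case (elim r)
    then show ?case using smooth_on_along_line[OF K, of "(0, r)" 0 "(1, 0)"] by (simp add: DERIV_imp_deriv)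
  qed
  then have 2: "deriv (\<lambda>r. deriv (\<lambda>s. K (s, r)) 0) 0 =
      frechet_derivative (\<lambda>x. frechet_derivative K (at x) (1, 0)) (at (0, 0)) (0, 1)"
    unfolding D[of "(0, 1)" "(1, 0)", symmetric] by (rule deriv_cong_ev[OF _ refl])
  show ?thesis
    unfolding 1 2 using second_derivative_symmetric[OF S K] by blast
qed

text \<open>Conjugation by \<open>c t\<close> contains both \<open>c t\<close> and its inverse
  \<open>c (- t)\<close>. Separating the two occurrences gives a function of two parameters, which
  this chain rule differentiates along \<open>(t, - t)\<close>.\<close>

lemma antidiagonal_derivative:
  fixes K :: "real \<times> real \<Rightarrow> real"
  assumes S: "(0, 0) \<in> S" and K: "smooth_on S K"
  shows "((\<lambda>t. K (t, - t)) has_real_derivative (deriv (\<lambda>t. K (t, 0)) 0 - deriv (\<lambda>t. K (0, t)) 0)) (at 0)"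
proof -
  let ?D = "frechet_derivative K (at (0, 0))"
  note L = smooth_on_along_line[OF K, of "(0, 0)" 0]
  have "((\<lambda>t. K (t, - t)) has_real_derivative ?D (1, -1)) (at 0)"
    using L[of "(1, -1)"] S by simp
  moreover have "deriv (\<lambda>t. K (t, 0)) 0 = ?D (1, 0)" "deriv (\<lambda>t. K (0, t)) 0 = ?D (0, 1)"
    using L[of "(1, 0)"] L[of "(0, 1)"] S by (simp_all add: DERIV_imp_deriv)
  moreover have "?D (1, -1) = ?D (1, 0) - ?D (0, 1)"
  proof -
    have "linear ?D" using smooth_on_imp_differentiable[OF K S] linear_frechet_derivative by blast
    then have "?D ((1, 0) - (0, 1)) = ?D (1, 0) - ?D (0, 1)" by (rule linear_diff)
    then show ?thesis by simp
  qed
  ultimately show ?thesis by simp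
qed

section \<open>Lie groups and the adjoint action\<close>

text \<open>Energy estimate in the style of Gronwall: the sum of squares \<open>E\<close> satisfies
  \<open>\<bar>E' t\<bar> \<le> K * E t\<close>, so multiplication by a suitable exponential gives a
  monotone function that vanishes at 0.\<close>

lemma linear_ode_zero:
  fixes z :: "'b \<Rightarrow> real \<Rightarrow> real"
  assumes B: "finite B"
    and D: "\<And>b t. b \<in> B \<Longrightarrow> (z b has_real_derivative (\<Sum>d\<in>B. M b d * z d t)) (at t)"
    and z0: "\<And>b. b \<in> B \<Longrightarrow> z b 0 = 0"
    and b: "b \<in> B"
  shows "z b t = 0"
proof -
  define E where "E = (\<lambda>t. \<Sum>b\<in>B. (z b t)\<^sup>2)"
  define E' where "E' = (\<lambda>t. \<Sum>b\<in>B. 2 * (z b t * (\<Sum>d\<in>B. M b d * z d t)))"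
  \<comment> \<open>Every product \<open>z b t * z d t\<close> is bounded by \<open>E t\<close>, so
    only the coefficients enter; the factor 2 comes from differentiating squares.\<close>
  define K where "K = (\<Sum>b\<in>B. \<Sum>d\<in>B. 2 * \<bar>M b d\<bar>)"
  have DE: "(E has_real_derivative E' t) (at t)" for t
    unfolding E_def E'_def by (auto intro!: derivative_eq_intros D sum.cong)
  have E0: "E t \<ge> 0" for t unfolding E_def by (intro sum_nonneg) simp
  have zE: "(z b t)\<^sup>2 \<le> E t" if "b \<in> B" for b t
    unfolding E_def using that B by (intro member_le_sum) auto
  have prod: "\<bar>z b t * z d t\<bar> \<le> E t" if "b \<in> B" "d \<in> B" for b d t
  proof -
    have "2 * \<bar>z b t * z d t\<bar> \<le> (z b t)\<^sup>2 + (z d t)\<^sup>2"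
      using sum_squares_bound[of "\<bar>z b t\<bar>" "\<bar>z d t\<bar>"] by (simp add: abs_mult)
    then show ?thesis using zE[OF that(1), of t] zE[OF that(2), of t] by linarith
  qed
  have bound: "\<bar>E' t\<bar> \<le> K * E t" for t
  proof -
    have "\<bar>E' t\<bar> = \<bar>\<Sum>b\<in>B. \<Sum>d\<in>B. 2 * M b d * (z b t * z d t)\<bar>"
      unfolding E'_def by (simp add: sum_distrib_left algebra_simps)
    also have "\<dots> \<le> (\<Sum>b\<in>B. \<Sum>d\<in>B. \<bar>2 * M b d * (z b t * z d t)\<bar>)"
      by (rule order_trans[OF sum_abs sum_mono[OF sum_abs]])
    also have "\<dots> \<le> (\<Sum>b\<in>B. \<Sum>d\<in>B. 2 * \<bar>M b d\<bar> * E t)"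
    proof (intro sum_mono)
      fix b d assume "b \<in> B" "d \<in> B"
      then show "\<bar>2 * M b d * (z b t * z d t)\<bar> \<le> 2 * \<bar>M b d\<bar> * E t"
        using mult_left_mono[OF prod, of b d "2 * \<bar>M b d\<bar>" t] by (simp add: abs_mult)
    qed
    also have "\<dots> = K * E t" unfolding K_def by (simp add: sum_distrib_right)
    finally show ?thesis .
  qed
  have "E 0 = 0" unfolding E_def using z0 by simp
  \<comment> \<open>The exponential factor depends on the direction of time:
    \<open>exp (- K * s)\<close> makes the product nonincreasing to the right of 0,
    \<open>exp (K * s)\<close> makes it nondecreasing to the left.\<close>
  have "E t \<le> 0"
  proof (cases "t \<ge> 0")
    case True
    have "E t * exp (- K * t) \<le> E 0 * exp (- K * 0)"
    proof (rule DERIV_nonpos_imp_nonincreasing[OF True, of "\<lambda>s. E s * exp (- K * s)"])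
      fix s :: real
      have "((\<lambda>s. E s * exp (- K * s)) has_real_derivative (E' s - K * E s) * exp (- K * s)) (at s)"
        by (auto intro!: derivative_eq_intros DE simp: algebra_simps)
      moreover have "(E' s - K * E s) * exp (- K * s) \<le> 0"
        using bound[of s] by (intro mult_nonpos_nonneg) auto
      ultimately show "\<exists>y. ((\<lambda>s. E s * exp (- K * s)) has_real_derivative y) (at s) \<and> y \<le> 0" by blast
    qed
    then show ?thesis using \<open>E 0 = 0\<close> by (simp add: mult_le_0_iff)
  next
    case False
    have "E t * exp (K * t) \<le> E 0 * exp (K * 0)"
    proof (rule DERIV_nonneg_imp_nondecreasing[of t 0 "\<lambda>s. E s * exp (K * s)"])
      show "t \<le> 0" using False by simp
      fix s :: real
      have "((\<lambda>s. E s * exp (K * s)) has_real_derivative (E' s + K * E s) * exp (K * s)) (at s)"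
        by (auto intro!: derivative_eq_intros DE simp: algebra_simps)
      moreover have "(E' s + K * E s) * exp (K * s) \<ge> 0"
        using bound[of s] by (intro mult_nonneg_nonneg) auto
      ultimately show "\<exists>y. ((\<lambda>s. E s * exp (K * s)) has_real_derivative y) (at s) \<and> y \<ge> 0" by blast
    qed
    then show ?thesis using \<open>E 0 = 0\<close> by (simp add: mult_le_0_iff)
  qed
  with zE[OF b, of t] have "(z b t)\<^sup>2 \<le> 0" by (rule order_trans)
  then show ?thesis by simp
qed

locale lie_group_with_algebra =
  fixes G :: "'x::{t2_space,second_countable_topology} monoid" (structure)
    and A :: "('x, 'e::{real_normed_vector,fin_dim_vector}) atlas"
    and \<iota> :: "'g::fin_dim_vector \<Rightarrow> ('x \<Rightarrow> real) \<Rightarrow> real"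
    and lb :: "'g \<Rightarrow> 'g \<Rightarrow> 'g"
  assumes lie_group: "lie_group G A" and lie_algebra_of_group: "lie_algebra_of_group G A \<iota> lb"
begin

abbreviation gen :: "'g \<Rightarrow> (real \<Rightarrow> 'x) \<Rightarrow> bool" where "gen \<equiv> generates G A \<iota>"
abbreviation Adj :: "'x \<Rightarrow> 'g \<Rightarrow> 'g" where "Adj \<equiv> Ad G A \<iota>"

lemma man: "smooth_manifold A" and carrier_UNIV [simp]: "carrier G = UNIV"
  using lie_group unfolding lie_group_def by auto

sublocale group G
  using lie_group unfolding lie_group_def by auto

lemma lie_alg: "lie_algebra lb"
  using lie_algebra_of_group unfolding lie_algebra_of_group_def by auto

lemma smooth_map_mult:
  assumes C: "smooth_manifold C" "open W" and F: "smooth_map C A W F" and H: "smooth_map C A W H"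
  shows "smooth_map C A W (\<lambda>x. F x \<otimes> H x)"
proof -
  have "smooth_map (prod_atlas A A) A UNIV (\<lambda>(x, y). x \<otimes> y)"
    using lie_group unfolding lie_group_def by auto
  from smooth_map_compose[OF C(1) smooth_manifold_prod_atlas[OF man man] man C(2) open_UNIV _
      smooth_map_Pair[OF C(1) man man C(2) F H] this]
  show ?thesis by simp
qed

lemma smooth_map_inv:
  assumes C: "smooth_manifold C" "open W" and F: "smooth_map C A W F"
  shows "smooth_map C A W (\<lambda>x. inv (F x))"
proof -
  have "smooth_map A A UNIV (\<lambda>x. inv x)"
    using lie_group unfolding lie_group_def by auto
  from smooth_map_compose[OF C(1) man man C(2) open_UNIV _ F this] show ?thesis by simp
qed

lemma conj_smooth: "smooth_map A A UNIV (\<lambda>h. x \<otimes> h \<otimes> inv x)"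
  by (rule smooth_map_mult[OF man open_UNIV smooth_map_mult[OF man open_UNIV
      smooth_map_const[OF man man] smooth_map_ident[OF man]] smooth_map_const[OF man man]])

lemma iota_tangent: "\<iota> X \<in> tangent_space A \<one>"
  and iota_surj: "v \<in> tangent_space A \<one> \<Longrightarrow> \<exists>X. \<iota> X = v"
  and iota_inj: "inj \<iota>"
  and iota_add: "\<iota> (X + Y) f = \<iota> X f + \<iota> Y f"
  and iota_scale: "\<iota> (c *\<^sub>R X) f = c * \<iota> X f"
  and iota_bracket: "smooth_near A \<one> f \<Longrightarrow>
        \<iota> (lb X Y) f = \<iota> X (\<lambda>h. \<iota> Y (\<lambda>h'. f (h \<otimes> h'))) - \<iota> Y (\<lambda>h. \<iota> X (\<lambda>h'. f (h \<otimes> h')))"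
proof -
  note h = lie_algebra_of_group[unfolded lie_algebra_of_group_def bij_betw_def smooth_at_eq_near]
  have r: "range \<iota> = tangent_space A \<one>" using h by blast
  show "\<iota> X \<in> tangent_space A \<one>" using r by blast
  show "v \<in> tangent_space A \<one> \<Longrightarrow> \<exists>X. \<iota> X = v" unfolding r[symmetric] by blast
  show "inj \<iota>" using h by blast
  show "\<iota> (X + Y) f = \<iota> X f + \<iota> Y f" using h by blast
  show "\<iota> (c *\<^sub>R X) f = c * \<iota> X f" using h by blast
  show "smooth_near A \<one> f \<Longrightarrow>
        \<iota> (lb X Y) f = \<iota> X (\<lambda>h. \<iota> Y (\<lambda>h'. f (h \<otimes> h'))) - \<iota> Y (\<lambda>h. \<iota> X (\<lambda>h'. f (h \<otimes> h')))"
    using h by blast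
qed

lemma iota_zero: "\<iota> 0 f = 0"
  using iota_scale[of 0 0 f] by simp

lemma iota_eqI:
  assumes "\<And>f. smooth_near A \<one> f \<Longrightarrow> \<iota> X f = \<iota> Y f"
  shows "X = Y"
proof -
  have "\<iota> X f = \<iota> Y f" for f
    using assms[of f] tangentD(1)[OF iota_tangent, of f] by (cases "smooth_near A \<one> f") auto
  then show ?thesis using iota_inj by (meson ext injD)
qed

text \<open>Functionals given by germs form a subspace of the dual and separate points because
  \<iota> is injective, so they are all functionals. Linear functionals of curves in the Lie algebra
  can thus be computed by differentiating functions on the group.\<close>

lemma functional_representation:
  assumes "linear l"
  obtains f where "smooth_near A \<one> f" "\<And>Z. l Z = \<iota> Z f"
proof -
  let ?R = "{(\<lambda>Z. \<iota> Z f) | f. smooth_near A \<one> f}"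
  have "l \<in> ?R"
  proof (rule separating_functionals_span[OF _ _ _ _ _ assms])
    show "linear m" if "m \<in> ?R" for m using that by (auto simp: linear_iff iota_add iota_scale)
    show "(\<lambda>Z. 0) \<in> ?R"
      using smooth_near_const[of A \<one> 0] tangentD(5)[OF iota_tangent smooth_near_const[of A \<one> 0], of _ 0]
      by (auto intro!: exI[of _ "\<lambda>_. 0"])
    show "(\<lambda>Z. m Z + n Z) \<in> ?R" if mn: "m \<in> ?R" "n \<in> ?R" for m n
    proof -
      obtain f g where fg: "m = (\<lambda>Z. \<iota> Z f)" "smooth_near A \<one> f" "n = (\<lambda>Z. \<iota> Z g)" "smooth_near A \<one> g"
        using mn by auto
      then show ?thesis
        using tangentD(2)[OF iota_tangent fg(2,4)] smooth_near_add[OF man fg(2,4)]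
        by (auto intro!: exI[of _ "\<lambda>y. f y + g y"])
    qed
    show "(\<lambda>Z. c * m Z) \<in> ?R" if m: "m \<in> ?R" for m c
    proof -
      obtain f where f: "m = (\<lambda>Z. \<iota> Z f)" "smooth_near A \<one> f" using m by auto
      then show ?thesis
        using tangentD(5)[OF iota_tangent f(2)] smooth_near_mult[OF man smooth_near_const f(2), of c]
        by (auto intro!: exI[of _ "\<lambda>y. c * f y"])
    qed
    show "Z = 0" if "\<And>m. m \<in> ?R \<Longrightarrow> m Z = 0" for Z
    proof (rule iota_eqI)
      fix f :: "'x \<Rightarrow> real" assume "smooth_near A \<one> f"
      then show "\<iota> Z f = \<iota> 0 f" using that[of "\<lambda>Z. \<iota> Z f"] iota_zero by auto
    qed
  qed
  then show ?thesis using that by auto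
qed

section \<open>One-parameter subgroups and the adjoint action\<close>

lemma
  assumes "gen X c"
  shows gen_smooth: "smooth_map real_atlas A UNIV c"
    and gen_add: "c (s + t) = c s \<otimes> c t"
    and gen_velocity: "velocity A c = \<iota> X"
    and gen_0: "c 0 = \<one>"
    and gen_minus: "c (- t) = inv (c t)"
proof -
  show "smooth_map real_atlas A UNIV c" and "velocity A c = \<iota> X"
    using assms unfolding generates_def by auto
  show h: "c (s + t) = c s \<otimes> c t" for s t
    using assms unfolding generates_def by auto
  show c0: "c 0 = \<one>" using h[of 0 0] by simp
  show "c (- t) = inv (c t)" using h[of "- t" t] c0 by (simp add: inv_equality)
qed

lemma gen_deriv:
  assumes c: "gen X c" and f: "smooth_near A \<one> f"
  shows "((\<lambda>t. f (c t)) has_real_derivative \<iota> X f) (at 0)"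
  using smooth_at_curve_has_derivative[OF man open_UNIV _ gen_smooth[OF c]] f
  by (simp add: gen_0[OF c] gen_velocity[OF c])

lemma velocity_eq_iota:
  assumes c: "smooth_map real_atlas A UNIV c" "c 0 = \<one>"
    and D: "\<And>f. smooth_near A \<one> f \<Longrightarrow> ((\<lambda>t. f (c t)) has_real_derivative \<iota> X f) (at 0)"
  shows "velocity A c = \<iota> X"
proof
  fix f
  show "velocity A c f = \<iota> X f"
    using DERIV_imp_deriv[OF D[of f]] tangentD(1)[OF iota_tangent, of f] c(2)
    by (simp add: velocity_def smooth_at_eq_near o_def)
qed

lemma gen_scaleR:
  assumes c: "gen X c"
  shows "gen (a *\<^sub>R X) (\<lambda>t. c (a * t))"
proof -
  have m: "smooth_map real_atlas real_atlas UNIV (\<lambda>t. a * t)"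
    unfolding smooth_fun_real_iff[OF smooth_manifold_real_atlas open_UNIV, symmetric]
    using smooth_fun_scaleR[OF smooth_manifold_real_atlas open_UNIV smooth_fun_const, of "\<lambda>t. t" a]
      smooth_map_ident[OF smooth_manifold_real_atlas, of UNIV]
      smooth_fun_real_iff[OF smooth_manifold_real_atlas open_UNIV, of "\<lambda>t. t"] by simp
  have s: "smooth_map real_atlas A UNIV (\<lambda>t. c (a * t))"
    by (rule smooth_map_compose[OF smooth_manifold_real_atlas smooth_manifold_real_atlas man open_UNIV open_UNIV _ m gen_smooth[OF c]]) simp
  have "velocity A (\<lambda>t. c (a * t)) = \<iota> (a *\<^sub>R X)"
  proof (rule velocity_eq_iota[OF s])
    show "c (a * 0) = \<one>" using gen_0[OF c] by simp
    fix f :: "'x \<Rightarrow> real" assume f: "smooth_near A \<one> f"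
    have "((\<lambda>t. f (c t)) has_real_derivative \<iota> X f) (at (a * 0))" using gen_deriv[OF c f] by simp
    moreover have "((\<lambda>t. a * t) has_real_derivative a) (at 0)" by (auto intro!: derivative_eq_intros)
    ultimately have "((\<lambda>t. f (c (a * t))) has_real_derivative \<iota> X f * a) (at 0)"
      using DERIV_chain2[of "\<lambda>t. f (c t)" "\<iota> X f" "\<lambda>t. a * t" 0 a UNIV] by simp
    then show "((\<lambda>t. f (c (a * t))) has_real_derivative \<iota> (a *\<^sub>R X) f) (at 0)"
      by (simp add: iota_scale mult.commute)
  qed
  then show ?thesis using s gen_add[OF c] by (simp add: generates_def distrib_left)
qed

text \<open>The pushforward under conjugation is again a tangent vector at the identity, hence in
  the range of \<iota>, so the \<open>inv_into\<close> in the definition of \<open>Ad\<close> is a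
  true inverse there.\<close>

lemma iota_Ad: "\<iota> (Adj x X) = pushforward A (\<lambda>h. x \<otimes> h \<otimes> inv x) \<one> (\<iota> X)"
proof -
  have "pushforward A (\<lambda>h. x \<otimes> h \<otimes> inv x) \<one> (\<iota> X) \<in> tangent_space A \<one>"
    using pushforward_tangent[OF man man open_UNIV _ conj_smooth iota_tangent, of x] by simp
  then obtain Y where "\<iota> Y = pushforward A (\<lambda>h. x \<otimes> h \<otimes> inv x) \<one> (\<iota> X)" using iota_surj by blast
  then show ?thesis unfolding Ad_def by (metis f_inv_into_f rangeI)
qed

lemma conj_smooth_near: "smooth_near A \<one> f \<Longrightarrow> smooth_near A \<one> (\<lambda>h. f (x \<otimes> h \<otimes> inv x))"
  using smooth_near_compose[OF man man open_UNIV _ conj_smooth, of \<one> x f] by simp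

lemma iota_Ad_apply: "smooth_near A \<one> f \<Longrightarrow> \<iota> (Adj x X) f = \<iota> X (\<lambda>h. f (x \<otimes> h \<otimes> inv x))"
  unfolding iota_Ad pushforward_def smooth_at_eq_near by (simp add: o_def)

lemma Ad_linear: "linear (Adj x)"
  by (rule linearI) (rule iota_eqI, simp add: iota_Ad_apply iota_add iota_scale)+

lemma Ad_one: "Adj \<one> X = X"
  by (rule iota_eqI) (simp add: iota_Ad_apply)

lemma Ad_mult: "Adj (x \<otimes> y) X = Adj x (Adj y X)"
proof (rule iota_eqI)
  fix f :: "'x \<Rightarrow> real" assume f: "smooth_near A \<one> f"
  show "\<iota> (Adj (x \<otimes> y) X) f = \<iota> (Adj x (Adj y X)) f"
    by (simp only: iota_Ad_apply[OF f] iota_Ad_apply[OF conj_smooth_near[OF f]])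
       (simp add: inv_mult_group m_assoc)
qed

lemma Ad_inv: "Adj (inv x) (Adj x X) = X" "Adj x (Adj (inv x) X) = X"
  using Ad_mult[of "inv x" x X] Ad_mult[of x "inv x" X] Ad_one by simp_all

lemma gen_conj:
  assumes c: "gen X c"
  shows "gen (Adj x X) (\<lambda>t. x \<otimes> c t \<otimes> inv x)"
proof -
  have s: "smooth_map real_atlas A UNIV (\<lambda>t. x \<otimes> c t \<otimes> inv x)"
    by (rule smooth_map_compose[OF smooth_manifold_real_atlas man man open_UNIV open_UNIV _ gen_smooth[OF c] conj_smooth]) simp
  have "velocity A (\<lambda>t. x \<otimes> c t \<otimes> inv x) = \<iota> (Adj x X)"
  proof (rule velocity_eq_iota[OF s])
    show "x \<otimes> c 0 \<otimes> inv x = \<one>" using gen_0[OF c] by simp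
    fix f :: "'x \<Rightarrow> real" assume f: "smooth_near A \<one> f"
    show "((\<lambda>t. f (x \<otimes> c t \<otimes> inv x)) has_real_derivative \<iota> (Adj x X) f) (at 0)"
      using gen_deriv[OF c conj_smooth_near[OF f]] iota_Ad_apply[OF f] by simp
  qed
  moreover have "x \<otimes> c (s + t) \<otimes> inv x = (x \<otimes> c s \<otimes> inv x) \<otimes> (x \<otimes> c t \<otimes> inv x)" for s t
    unfolding gen_add[OF c] by (simp add: m_assoc) (simp add: m_assoc[symmetric])
  ultimately show ?thesis using s by (simp add: generates_def)
qed

text \<open>One construction with two uses: for \<open>b\<close> the inverse of \<open>a\<close>,
  the derivative is the adjoint action of \<open>a\<close> on \<open>Y\<close>, tested on
  \<open>f\<close>; for \<open>b\<close> the identity, it is the left invariant field of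
  \<open>Y\<close> at \<open>a\<close>, applied to \<open>f\<close>.\<close>

lemma
  assumes e: "gen Y e" and N: "open N" and f: "smooth_fun A N f"
  shows two_sided_derivative_smooth:
      "smooth_fun (prod_atlas A A) {z. fst z \<otimes> snd z \<in> N} (\<lambda>z. deriv (\<lambda>s. f (fst z \<otimes> e s \<otimes> snd z)) 0)"
    and two_sided_derivative_open: "open {z. fst z \<otimes> snd z \<in> N}"
    and two_sided_derivative_iota: "a \<otimes> b \<in> N \<Longrightarrow> deriv (\<lambda>s. f (a \<otimes> e s \<otimes> b)) 0 = \<iota> Y (\<lambda>h. f (a \<otimes> h \<otimes> b))"
proof -
  note AA = smooth_manifold_prod_atlas[OF man man]
  note P = smooth_manifold_prod_atlas[OF AA smooth_manifold_real_atlas]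
  let ?P = "prod_atlas (prod_atlas A A) real_atlas"
  define F where "F = (\<lambda>z::('x \<times> 'x) \<times> real. fst (fst z) \<otimes> e (snd z) \<otimes> snd (fst z))"
  have 1: "smooth_map ?P A UNIV (\<lambda>z. fst (fst z))"
    by (rule smooth_map_compose[OF P AA man open_UNIV open_UNIV _ smooth_map_fst[OF AA smooth_manifold_real_atlas] smooth_map_fst[OF man man]]) simp
  have 2: "smooth_map ?P A UNIV (\<lambda>z. snd (fst z))"
    by (rule smooth_map_compose[OF P AA man open_UNIV open_UNIV _ smooth_map_fst[OF AA smooth_manifold_real_atlas] smooth_map_snd[OF man man]]) simp
  have 3: "smooth_map ?P A UNIV (\<lambda>z. e (snd z))"
    by (rule smooth_map_compose[OF P smooth_manifold_real_atlas man open_UNIV open_UNIV _ smooth_map_snd[OF AA smooth_manifold_real_atlas] gen_smooth[OF e]]) simp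
  have F: "smooth_map ?P A UNIV F"
    unfolding F_def by (rule smooth_map_mult[OF P open_UNIV smooth_map_mult[OF P open_UNIV 1 3] 2])
  have o: "open (F -` N)" using smooth_map_preimage_open[OF open_UNIV F N] by simp
  have "smooth_fun ?P (F -` N) (\<lambda>z. f (F z))"
    by (rule smooth_fun_compose[OF P man o N _ smooth_map_subset[OF F] f]) auto
  from smooth_fun_partial[OF AA o this]
  show "smooth_fun (prod_atlas A A) {z. fst z \<otimes> snd z \<in> N} (\<lambda>z. deriv (\<lambda>s. f (fst z \<otimes> e s \<otimes> snd z)) 0)"
    by (simp add: F_def gen_0[OF e])
  have m: "smooth_map (prod_atlas A A) A UNIV (\<lambda>z. fst z \<otimes> snd z)"
    by (rule smooth_map_mult[OF AA open_UNIV smooth_map_fst[OF man man] smooth_map_snd[OF man man]])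
  show "open {z. fst z \<otimes> snd z \<in> N}"
    using smooth_map_preimage_open[OF open_UNIV m N] by (simp add: vimage_def)
  assume ab: "a \<otimes> b \<in> N"
  have s: "smooth_map A A UNIV (\<lambda>h. a \<otimes> h \<otimes> b)"
    by (rule smooth_map_mult[OF man open_UNIV smooth_map_mult[OF man open_UNIV
        smooth_map_const[OF man man] smooth_map_ident[OF man]] smooth_map_const[OF man man]])
  have "smooth_near A \<one> (\<lambda>h. f (a \<otimes> h \<otimes> b))"
    using smooth_near_compose[OF man man open_UNIV _ s, of \<one> f] smooth_nearI[OF N _ f, of "a \<otimes> b"] ab by simp
  from DERIV_imp_deriv[OF gen_deriv[OF e this]]
  show "deriv (\<lambda>s. f (a \<otimes> e s \<otimes> b)) 0 = \<iota> Y (\<lambda>h. f (a \<otimes> h \<otimes> b))" .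
qed

text \<open>Expresses the iterated left invariant derivatives of \<open>iota_bracket\<close> by
  derivatives along curves. The outer derivative needs the inner one to be smooth in the base
  point.\<close>

lemma left_derivative:
  assumes e: "gen Y e" and f: "smooth_near A \<one> f" and c: "gen X c"
  shows "deriv (\<lambda>t. deriv (\<lambda>s. f (c t \<otimes> e s)) 0) 0 = \<iota> X (\<lambda>h. \<iota> Y (\<lambda>h'. f (h \<otimes> h')))"
proof -
  obtain N where N: "open N" "\<one> \<in> N" "smooth_fun A N f" using f unfolding smooth_near_def by auto
  note s = two_sided_derivative_smooth[OF e N(1,3)] and o = two_sided_derivative_open[OF e N(1,3)]
    and i = two_sided_derivative_iota[OF e N(1,3)]
  note AA = smooth_manifold_prod_atlas[OF man man]
  have p: "smooth_map A (prod_atlas A A) UNIV (\<lambda>h. (h, \<one>))"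
    by (rule smooth_map_Pair[OF man man man open_UNIV smooth_map_ident[OF man] smooth_map_const[OF man man]])
  have n: "smooth_near A \<one> (\<lambda>h. deriv (\<lambda>s. f (h \<otimes> e s)) 0)"
    using smooth_near_compose[OF man AA open_UNIV _ p, of \<one> "\<lambda>z. deriv (\<lambda>s. f (fst z \<otimes> e s \<otimes> snd z)) 0"]
      smooth_nearI[OF o _ s] N(2) by simp
  have "deriv (\<lambda>t. deriv (\<lambda>s. f (c t \<otimes> e s)) 0) 0 = \<iota> X (\<lambda>h. deriv (\<lambda>s. f (h \<otimes> e s)) 0)"
    by (rule DERIV_imp_deriv[OF gen_deriv[OF c n]])
  also have "\<dots> = \<iota> X (\<lambda>h. \<iota> Y (\<lambda>h'. f (h \<otimes> h')))"
  proof (rule tangent_cong[OF man iota_tangent n])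
    show "\<forall>\<^sub>F h in nhds \<one>. deriv (\<lambda>s. f (h \<otimes> e s)) 0 = \<iota> Y (\<lambda>h'. f (h \<otimes> h'))"
      unfolding eventually_nhds using N i[of _ \<one>] by (intro exI[of _ N]) simp
  qed
  finally show ?thesis .
qed

text \<open>Let \<open>K (a, b)\<close> be the derivative at \<open>s = 0\<close> of
  \<open>f (c a \<otimes> e s \<otimes> c b)\<close>. The function in question is
  \<open>K (t, - t)\<close>; its derivative is the difference of two partial derivatives, and these
  are the two terms of the commutator of left invariant fields in
  \<open>iota_bracket\<close>.\<close>

lemma Ad_deriv_0:
  assumes c: "gen X c" and e: "gen Y e" and l: "linear l"
  shows "((\<lambda>t. l (Adj (c t) Y)) has_real_derivative l (lb X Y)) (at 0)"
proof -
  obtain f where f: "smooth_near A \<one> f" and lf: "\<And>Z. l Z = \<iota> Z f"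
    using functional_representation[OF l] by blast
  obtain N where N: "open N" "\<one> \<in> N" "smooth_fun A N f" using f unfolding smooth_near_def by auto
  let ?RR = "prod_atlas real_atlas real_atlas"
  note RR = smooth_manifold_prod_atlas[OF smooth_manifold_real_atlas smooth_manifold_real_atlas]
  note AA = smooth_manifold_prod_atlas[OF man man]
  have sc: "smooth_map ?RR A UNIV (\<lambda>z. c (fst z))" "smooth_map ?RR A UNIV (\<lambda>z. c (snd z))"
    "smooth_map ?RR A UNIV (\<lambda>z. e (fst z))"
    by (rule smooth_map_compose[OF RR smooth_manifold_real_atlas man open_UNIV open_UNIV],
        simp, intro smooth_map_fst smooth_map_snd smooth_manifold_real_atlas, intro gen_smooth[OF c] gen_smooth[OF e])+
  define \<Psi> where "\<Psi> = (\<lambda>z. deriv (\<lambda>s. f (fst z \<otimes> e s \<otimes> snd z)) 0)"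
  define K where "K = (\<lambda>z. \<Psi> (c (fst z), c (snd z)))"
  have p: "smooth_map ?RR (prod_atlas A A) UNIV (\<lambda>z. (c (fst z), c (snd z)))"
    by (rule smooth_map_Pair[OF RR man man open_UNIV sc(1,2)])
  note s\<Psi> = two_sided_derivative_smooth[OF e N(1,3), folded \<Psi>_def] and o\<Psi> = two_sided_derivative_open[OF e N(1,3)]
  define S where "S = (\<lambda>z. (c (fst z), c (snd z))) -` {z. fst z \<otimes> snd z \<in> N}"
  have oS: "open S" unfolding S_def using smooth_map_preimage_open[OF open_UNIV p o\<Psi>] by simp
  have S0: "(0, 0) \<in> S" unfolding S_def using gen_0[OF c] N by simp
  have "smooth_fun ?RR S K" unfolding K_def
    by (rule smooth_fun_compose[OF RR AA oS o\<Psi> _ smooth_map_subset[OF p] s\<Psi>]) (auto simp: S_def)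
  then have sK: "smooth_on S K" by (rule smooth_fun_real_atlas_prod)
  have lK: "l (Adj (c t) Y) = K (t, - t)" for t
    unfolding lf iota_Ad_apply[OF f] K_def \<Psi>_def
    using two_sided_derivative_iota[OF e N(1,3), of "c t" "inv (c t)"] N(2) by (simp add: gen_minus[OF c])
  have K1: "deriv (\<lambda>t. K (t, 0)) 0 = \<iota> X (\<lambda>h. \<iota> Y (\<lambda>h'. f (h \<otimes> h')))"
    unfolding K_def \<Psi>_def using left_derivative[OF e f c] by (simp add: gen_0[OF c])
  \<comment> \<open>Here \<open>c\<close> stands to the right of \<open>e\<close>, so the iterated
    derivative comes in the wrong order for \<open>left_derivative\<close>; exchanging the two
    derivatives repairs this.\<close>
  have K2: "deriv (\<lambda>t. K (0, t)) 0 = \<iota> Y (\<lambda>h. \<iota> X (\<lambda>h'. f (h \<otimes> h')))"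
  proof -
    define L where "L = (\<lambda>z. f (e (fst z) \<otimes> c (snd z)))"
    define T where "T = (\<lambda>z. e (fst z) \<otimes> c (snd z)) -` N"
    have m: "smooth_map ?RR A UNIV (\<lambda>z. e (fst z) \<otimes> c (snd z))"
      by (rule smooth_map_mult[OF RR open_UNIV sc(3,2)])
    have oT: "open T" unfolding T_def using smooth_map_preimage_open[OF open_UNIV m N(1)] by simp
    have "smooth_fun ?RR T L" unfolding L_def
      by (rule smooth_fun_compose[OF RR man oT N(1) _ smooth_map_subset[OF m] N(3)]) (auto simp: T_def)
    then have sL: "smooth_on T L" by (rule smooth_fun_real_atlas_prod)
    have T0: "(0, 0) \<in> T" unfolding T_def using gen_0[OF c] gen_0[OF e] N by simp
    have "deriv (\<lambda>t. K (0, t)) 0 = deriv (\<lambda>r. deriv (\<lambda>s. L (s, r)) 0) 0"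
      unfolding K_def \<Psi>_def L_def by (simp add: gen_0[OF c])
    also have "\<dots> = deriv (\<lambda>s. deriv (\<lambda>r. L (s, r)) 0) 0"
      using partial_derivatives_commute[OF oT T0 sL] by simp
    also have "\<dots> = \<iota> Y (\<lambda>h. \<iota> X (\<lambda>h'. f (h \<otimes> h')))"
      unfolding L_def using left_derivative[OF c f e] by simp
    finally show ?thesis .
  qed
  show ?thesis
    unfolding lK using antidiagonal_derivative[OF S0 sK] by (simp add: K1 K2 lf iota_bracket[OF f])
qed

text \<open>Since \<open>c (h + t) = c t \<otimes> c h\<close>, the derivative at \<open>t\<close>
  is the derivative at 0 for the functional composed with \<open>Adj (c t)\<close>.\<close>

lemma Ad_deriv:
  assumes c: "gen X c" and e: "gen Y e" and l: "linear l"
  shows "((\<lambda>t. l (Adj (c t) Y)) has_real_derivative l (Adj (c t) (lb X Y))) (at t)"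
proof -
  have "linear (l \<circ> Adj (c t))" using Ad_linear l by (rule linear_compose)
  from Ad_deriv_0[OF c e this]
  have "((\<lambda>h. l (Adj (c (h + t)) Y)) has_real_derivative l (Adj (c t) (lb X Y))) (at 0)"
    by (simp add: Ad_mult[symmetric] gen_add[OF c, symmetric] add.commute)
  then show ?thesis using DERIV_shift[of "\<lambda>t. l (Adj (c t) Y)" _ 0 t] by simp
qed

text \<open>Smoothness of the two-sided derivative is pulled back along the map that pairs
  \<open>x\<close> with \<open>inv x\<close>. This later makes the local lifts of sections
  smooth.\<close>

lemma Ad_smooth:
  assumes e: "gen Y e"
  shows "smooth_fun A UNIV (\<lambda>x. Adj x Y)"
proof (rule smooth_fun_iff[THEN iffD2], intro allI impI)
  fix l :: "'g \<Rightarrow> real" assume l: "linear l"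
  obtain f where f: "smooth_near A \<one> f" and lf: "\<And>Z. l Z = \<iota> Z f"
    using functional_representation[OF l] by blast
  obtain N where N: "open N" "\<one> \<in> N" "smooth_fun A N f" using f unfolding smooth_near_def by auto
  note AA = smooth_manifold_prod_atlas[OF man man]
  have p: "smooth_map A (prod_atlas A A) UNIV (\<lambda>x. (x, inv x))"
    by (rule smooth_map_Pair[OF man man man open_UNIV smooth_map_ident[OF man] smooth_map_inv[OF man open_UNIV smooth_map_ident[OF man]]])
  have "smooth_fun A UNIV (\<lambda>x. deriv (\<lambda>s. f (fst (x, inv x) \<otimes> e s \<otimes> snd (x, inv x))) 0)"
    using smooth_fun_compose[OF man AA open_UNIV two_sided_derivative_open[OF e N(1,3)] _ p two_sided_derivative_smooth[OF e N(1,3)]]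
      N(2) by (simp add: image_subset_iff)
  moreover have "l (Adj x Y) = deriv (\<lambda>s. f (x \<otimes> e s \<otimes> inv x)) 0" for x
    unfolding lf iota_Ad_apply[OF f]
    using two_sided_derivative_iota[OF e N(1,3), of x "inv x"] N(2) by simp
  ultimately show "smooth_fun A UNIV (\<lambda>x. l (Adj x Y))" by simp
qed

text \<open>Conjugating the curve by \<open>g\<close> conjugates its adjoint action, so both sides
  arise as the derivative at 0 of one and the same curve.\<close>

lemma Ad_bracket:
  assumes c: "gen X c" and e: "gen Y e"
  shows "Adj g (lb X Y) = lb (Adj g X) (Adj g Y)"
proof (rule functionals_separate)
  fix l :: "'g \<Rightarrow> real" assume l: "linear l"
  have "linear (l \<circ> Adj g)" using Ad_linear l by (rule linear_compose)
  from Ad_deriv_0[OF c e this]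
  have 1: "((\<lambda>t. l (Adj g (Adj (c t) Y))) has_real_derivative l (Adj g (lb X Y))) (at 0)" by simp
  have "Adj (g \<otimes> c t \<otimes> inv g) (Adj g Y) = Adj g (Adj (c t) Y)" for t
    by (simp add: Ad_mult Ad_inv)
  then have "((\<lambda>t. l (Adj g (Adj (c t) Y))) has_real_derivative l (lb (Adj g X) (Adj g Y))) (at 0)"
    using Ad_deriv_0[OF gen_conj[OF c, of g] gen_conj[OF e, of g] l] by simp
  then show "l (Adj g (lb X Y)) = l (lb (Adj g X) (Adj g Y))" using 1 DERIV_unique by blast
qed

text \<open>For a functional \<open>l\<close> vanishing on \<open>S\<close>, the functions
  \<open>l (Adj (c t) b)\<close> with \<open>b\<close> in a basis of \<open>S\<close> satisfy a
  linear system, whose matrix is that of \<open>lb X\<close> on \<open>S\<close>, with initial value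
  zero.\<close>

lemma Ad_preserves_subspace:
  assumes c: "gen X c" and S: "subspace S" "\<And>Y. Y \<in> S \<Longrightarrow> lb X Y \<in> S"
    and gen: "\<And>Y. Y \<in> S \<Longrightarrow> \<exists>e. gen Y e" and Y: "Y \<in> S"
  shows "Adj (c t) Y \<in> S"
proof (rule ccontr)
  assume "Adj (c t) Y \<notin> S"
  then obtain l :: "'g \<Rightarrow> real" where l: "linear l" "\<And>x. x \<in> S \<Longrightarrow> l x = 0" "l (Adj (c t) Y) = 1"
    using subspace_separate[OF S(1)] by blast
  obtain B where B: "B \<subseteq> S" "independent B" "S \<subseteq> span B"
    using maximal_independent_subset by metis
  have fin: "finite B"
    using independent_span_bound[OF fbasis(1) B(2)] by (simp add: fbasis(3))
  have SB: "span B = S" using B S(1) by (metis span_subspace)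
  have rep: "\<exists>m. Z = (\<Sum>d\<in>B. m d *\<^sub>R d)" if "Z \<in> S" for Z
    using that SB span_finite[OF fin] by auto
  then have "\<forall>b\<in>B. \<exists>m. lb X b = (\<Sum>d\<in>B. m d *\<^sub>R d)" using S(2) B(1) by blast
  then obtain M where M: "\<And>b. b \<in> B \<Longrightarrow> lb X b = (\<Sum>d\<in>B. M b d *\<^sub>R d)" by metis
  have lAd: "l (Adj x (\<Sum>d\<in>B. m d *\<^sub>R d)) = (\<Sum>d\<in>B. m d * l (Adj x d))" for x m
    by (simp add: linear_sum[OF Ad_linear] linear_sum[OF l(1)] linear_scale[OF Ad_linear] linear_scale[OF l(1)])
  have "l (Adj (c t) b) = 0" if "b \<in> B" for b
  proof (rule linear_ode_zero[where z = "\<lambda>b t. l (Adj (c t) b)" and M = M, OF fin _ _ that])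
    show "((\<lambda>t. l (Adj (c t) b)) has_real_derivative (\<Sum>d\<in>B. M b d * l (Adj (c t) d))) (at t)" if b: "b \<in> B" for b t
    proof -
      obtain e where "gen b e" using gen B(1) b by blast
      from Ad_deriv[OF c this l(1), of t] show ?thesis by (simp add: M[OF b] lAd)
    qed
    show "l (Adj (c 0) b) = 0" if "b \<in> B" for b
      using that B(1) l(2) by (auto simp: gen_0[OF c] Ad_one)
  qed
  then have "l (Adj (c t) Y) = 0" using rep[OF Y] lAd by auto
  then show False using l(3) by simp
qed

text \<open>A functional vanishing on \<open>S\<close> has zero derivative along
  \<open>Adj (c t) Z\<close>, because \<open>lb X Z\<close> lies in \<open>S\<close> and
  \<open>S\<close> is preserved by \<open>Adj (c t)\<close>.\<close>

lemma Ad_trivial_mod_subspace: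
  assumes c: "gen X c" and S: "subspace S" "\<And>Y. Y \<in> S \<Longrightarrow> lb X Y \<in> S"
    and gen: "\<And>Y. Y \<in> S \<Longrightarrow> \<exists>e. gen Y e" and e: "gen Z e" and Z: "lb X Z \<in> S"
  shows "Adj (c t) Z - Z \<in> S"
proof (rule ccontr)
  assume "Adj (c t) Z - Z \<notin> S"
  then obtain l :: "'g \<Rightarrow> real" where l: "linear l" "\<And>x. x \<in> S \<Longrightarrow> l x = 0" "l (Adj (c t) Z - Z) = 1"
    using subspace_separate[OF S(1)] by blast
  have "((\<lambda>t. l (Adj (c t) Z)) has_real_derivative 0) (at t)" for t
    using Ad_deriv[OF c e l(1), of t] l(2)[OF Ad_preserves_subspace[OF c S gen Z]] by simp
  then have "l (Adj (c t) Z) = l (Adj (c 0) Z)"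
    using DERIV_isconst_all[of "\<lambda>t. l (Adj (c t) Z)"] by blast
  then show False using l(3) by (simp add: gen_0[OF c] Ad_one linear_diff[OF l(1)])
qed

end

section \<open>Nilradicals of parabolic subalgebras\<close>

lemma bracket_span_subset:
  assumes "subspace S" "\<And>X Y. X \<in> A \<Longrightarrow> Y \<in> B \<Longrightarrow> lb X Y \<in> S"
  shows "bracket_span lb A B \<subseteq> S"
  unfolding bracket_span_def using assms by (intro span_minimal) auto

lemma bracket_in_span: "X \<in> A \<Longrightarrow> Y \<in> B \<Longrightarrow> lb X Y \<in> bracket_span lb A B"
  unfolding bracket_span_def by (auto intro: span_base)

lemma bracket_span_mono: "A \<subseteq> A' \<Longrightarrow> B \<subseteq> B' \<Longrightarrow> bracket_span lb A B \<subseteq> bracket_span lb A' B'"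
  unfolding bracket_span_def by (intro span_mono) auto

lemma subspace_bracket_span: "subspace (bracket_span lb A B)"
  unfolding bracket_span_def by (rule subspace_span)

abbreviation derived_step :: "('g::real_vector \<Rightarrow> 'g \<Rightarrow> 'g) \<Rightarrow> 'g set \<Rightarrow> 'g set" where
  "derived_step lb D \<equiv> bracket_span lb D D"

lemma subspace_derived_series: "subspace S \<Longrightarrow> subspace ((derived_step lb ^^ k) S)"
  by (cases k) (auto simp: subspace_bracket_span)

lemma subspace_lower_central_series: "subspace S \<Longrightarrow> subspace ((bracket_span lb T ^^ k) S)"
  by (cases k) (auto simp: subspace_bracket_span)

lemma derived_series_mono: "S \<subseteq> T \<Longrightarrow> (derived_step lb ^^ k) S \<subseteq> (derived_step lb ^^ k) T"
  by (induction k) (simp_all add: bracket_span_mono)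

lemma derived_series_subset:
  assumes S: "subspace S" "\<And>X Y. X \<in> S \<Longrightarrow> Y \<in> S \<Longrightarrow> lb X Y \<in> S"
  shows "(derived_step lb ^^ k) S \<subseteq> S"
proof (induction k)
  case (Suc k)
  have "derived_step lb ((derived_step lb ^^ k) S) \<subseteq> S"
    by (rule bracket_span_subset[OF S(1)]) (use S(2) Suc in blast)
  then show ?case by simp
qed simp

lemma lower_central_series_subset:
  assumes S: "subspace S" "\<And>X Y. X \<in> S \<Longrightarrow> Y \<in> S \<Longrightarrow> lb X Y \<in> S"
  shows "(bracket_span lb S ^^ k) S \<subseteq> S"
proof (induction k)
  case (Suc k)
  have "bracket_span lb S ((bracket_span lb S ^^ k) S) \<subseteq> S"
    by (rule bracket_span_subset[OF S(1)]) (use S(2) Suc in blast)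
  then show ?case by simp
qed simp

lemma is_nilradicalD:
  assumes "is_nilradical lb p N"
  shows "subspace N" "N \<subseteq> p" "X \<in> p \<Longrightarrow> Y \<in> N \<Longrightarrow> lb X Y \<in> N" "lie_nilpotent lb N"
    and "lie_ideal lb p N" "lie_ideal lb p I \<Longrightarrow> lie_nilpotent lb I \<Longrightarrow> I \<subseteq> N"
proof -
  have h: "lie_ideal lb p N" "lie_nilpotent lb N" "\<forall>I. lie_ideal lb p I \<and> lie_nilpotent lb I \<longrightarrow> I \<subseteq> N"
    using assms unfolding is_nilradical_def by simp_all
  show "subspace N" "N \<subseteq> p" "X \<in> p \<Longrightarrow> Y \<in> N \<Longrightarrow> lb X Y \<in> N"
    using h(1) unfolding lie_ideal_def by simp_all
  show "lie_nilpotent lb N" "lie_ideal lb p N" "lie_ideal lb p I \<Longrightarrow> lie_nilpotent lb I \<Longrightarrow> I \<subseteq> N"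
    using h by simp_all
qed

text \<open>The sum of \<open>b\<close> and \<open>N\<close> is again a solvable subalgebra stable
  under \<open>J\<close>, so maximality of the Borel subalgebra absorbs \<open>N\<close>.\<close>

lemma borel_contains_solvable_ideal:
  assumes bil: "bilinear lb" and anti: "\<And>X Y. lb X Y = - lb Y X" and J: "linear J"
    and b: "borel_subalgebra lb J b" "b \<subseteq> p"
    and N: "lie_ideal lb p N" "J ` N \<subseteq> N" "lie_solvable lb N"
  shows "N \<subseteq> b"
proof -
  define b' where "b' = {x + y |x y. x \<in> b \<and> y \<in> N}"
  have sb: "subspace b" "\<And>X Y. X \<in> b \<Longrightarrow> Y \<in> b \<Longrightarrow> lb X Y \<in> b" "J ` b \<subseteq> b" "lie_solvable lb b"
    and maxb: "\<And>b'. lie_subalgebra lb b' \<Longrightarrow> J ` b' \<subseteq> b' \<Longrightarrow> lie_solvable lb b' \<Longrightarrow> b \<subseteq> b' \<Longrightarrow> b' = b"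
    using b(1) unfolding borel_subalgebra_def lie_subalgebra_def by blast+
  have sN: "subspace N" "N \<subseteq> p" "\<And>X Y. X \<in> p \<Longrightarrow> Y \<in> N \<Longrightarrow> lb X Y \<in> N"
    using N(1) unfolding lie_ideal_def by blast+
  have sN': "lb Y X \<in> N" if "X \<in> p" "Y \<in> N" for X Y
    using sN(3)[OF that] subspace_neg[OF sN(1)] anti[of Y X] by simp
  have key: "lb (x + y) (x' + y') \<in> {u + v |u v. u \<in> bracket_span lb D D \<and> v \<in> N}"
    if "x \<in> D" "x' \<in> D" "y \<in> N" "y' \<in> N" "D \<subseteq> b" for x y x' y' D
  proof -
    have "lb (x + y) (x' + y') = lb x x' + (lb x y' + lb y x' + lb y y')"
      by (simp add: bilinear_ladd[OF bil] bilinear_radd[OF bil])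
    moreover have "lb x y' + lb y x' + lb y y' \<in> N"
    proof (intro subspace_add[OF sN(1)])
      show "lb x y' \<in> N" by (rule sN(3)) (use that b(2) in auto)
      show "lb y x' \<in> N" by (rule sN') (use that b(2) in auto)
      show "lb y y' \<in> N" by (rule sN(3)) (use that sN(2) in auto)
    qed
    ultimately show ?thesis using bracket_in_span[OF that(1,2), of lb] by blast
  qed
  have sb': "subspace b'" unfolding b'_def using sb(1) sN(1) by (rule subspace_sums)
  have sub: "lie_subalgebra lb b'"
    unfolding lie_subalgebra_def
  proof (intro conjI ballI sb')
    fix X Y assume "X \<in> b'" "Y \<in> b'"
    then obtain x y x' y' where xy: "X = x + y" "Y = x' + y'" "x \<in> b" "x' \<in> b" "y \<in> N" "y' \<in> N"
      unfolding b'_def by blast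
    have "bracket_span lb b b \<subseteq> b" using sb by (intro bracket_span_subset) auto
    then show "lb X Y \<in> b'" using key[of x b x' y y'] xy unfolding b'_def by blast
  qed
  have Jb': "J ` b' \<subseteq> b'"
    unfolding b'_def using sb(3) N(2) by (fastforce simp: linear_add[OF J])
  \<comment> \<open>Modulo \<open>N\<close> the derived series of the sum is that of
    \<open>b\<close>. Hence it enters \<open>N\<close> once the series of \<open>b\<close> has
    reached zero, and solvability of \<open>N\<close> finishes it.\<close>
  have series: "(derived_step lb ^^ k) b' \<subseteq> {u + v |u v. u \<in> (derived_step lb ^^ k) b \<and> v \<in> N}" for k
  proof (induction k)
    case 0 then show ?case unfolding b'_def by simp
  next
    case (Suc k)
    have sub: "(derived_step lb ^^ k) b \<subseteq> b" using derived_series_subset sb by blast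
    have "bracket_span lb ((derived_step lb ^^ k) b') ((derived_step lb ^^ k) b') \<subseteq>
      {u + v |u v. u \<in> bracket_span lb ((derived_step lb ^^ k) b) ((derived_step lb ^^ k) b) \<and> v \<in> N}"
    proof (rule bracket_span_subset)
      show "subspace {u + v |u v. u \<in> bracket_span lb ((derived_step lb ^^ k) b) ((derived_step lb ^^ k) b) \<and> v \<in> N}"
        using subspace_bracket_span sN(1) by (rule subspace_sums)
      fix X Y assume "X \<in> (derived_step lb ^^ k) b'" "Y \<in> (derived_step lb ^^ k) b'"
      then obtain x y x' y' where xy: "X = x + y" "Y = x' + y'" "x \<in> (derived_step lb ^^ k) b" "x' \<in> (derived_step lb ^^ k) b" "y \<in> N" "y' \<in> N"
        using Suc.IH by blast
      show "lb X Y \<in> {u + v |u v. u \<in> bracket_span lb ((derived_step lb ^^ k) b) ((derived_step lb ^^ k) b) \<and> v \<in> N}"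
        unfolding xy(1,2) by (rule key[OF xy(3,4,5,6) sub])
    qed
    then show ?case by simp
  qed
  obtain k where k: "(derived_step lb ^^ k) b = {0}" using sb(4) unfolding lie_solvable_def by blast
  obtain m where m: "(derived_step lb ^^ m) N = {0}" using N(3) unfolding lie_solvable_def by blast
  have "(derived_step lb ^^ k) b' \<subseteq> N" using series[of k] unfolding k by auto
  then have "(derived_step lb ^^ m) ((derived_step lb ^^ k) b') \<subseteq> {0}"
    using derived_series_mono m by blast
  then have "(derived_step lb ^^ (m + k)) b' \<subseteq> {0}" by (simp add: funpow_add)
  moreover have "0 \<in> (derived_step lb ^^ (m + k)) b'"
    using subspace_0[OF subspace_derived_series[OF sb']] .
  ultimately have "lie_solvable lb b'" unfolding lie_solvable_def by blast
  moreover have "b \<subseteq> b'" unfolding b'_def using subspace_0[OF sN(1)] by force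
  ultimately have "b' = b" using maxb[OF sub Jb'] by blast
  moreover have "N \<subseteq> b'" unfolding b'_def using subspace_0[OF sb(1)] by force
  ultimately show ?thesis by simp
qed

lemma
  assumes "lie_algebra lb"
  shows lie_bilinear: "bilinear lb" and lie_antisym: "lb X Y = - lb Y X"
proof -
  show b: "bilinear lb" using assms unfolding lie_algebra_def bilinear_def by blast
  have z: "lb Z Z = 0" for Z using assms unfolding lie_algebra_def by blast
  have "lb (X + Y) (X + Y) = lb X Y + lb Y X"
    by (simp only: bilinear_ladd[OF b] bilinear_radd[OF b]) (simp add: z)
  then show "lb X Y = - lb Y X" unfolding z eq_neg_iff_add_eq_0 by (rule sym)
qed

lemma nilpotent_imp_solvable:
  assumes S: "subspace S" "\<And>X Y. X \<in> S \<Longrightarrow> Y \<in> S \<Longrightarrow> lb X Y \<in> S" and nil: "lie_nilpotent lb S"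
  shows "lie_solvable lb S"
proof -
  have "(derived_step lb ^^ k) S \<subseteq> (bracket_span lb S ^^ k) S" for k
  proof (induction k)
    case (Suc k)
    have "bracket_span lb ((derived_step lb ^^ k) S) ((derived_step lb ^^ k) S) \<subseteq> bracket_span lb S ((bracket_span lb S ^^ k) S)"
      by (rule bracket_span_mono[OF derived_series_subset[OF S] Suc.IH])
    then show ?case by simp
  qed simp
  moreover obtain k where "(bracket_span lb S ^^ k) S = {0}" using nil unfolding lie_nilpotent_def by blast
  ultimately have "(derived_step lb ^^ k) S = {0}"
    using subspace_0[OF subspace_derived_series[OF S(1), of k lb]] by blast
  then show ?thesis unfolding lie_solvable_def by blast
qed

text \<open>\<open>is_nilradical\<close> ranges over real ideals, while Borel subalgebras are
  maximal among \<open>J\<close>-stable ones, so stability has to be proved. The image of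
  \<open>N\<close> under \<open>J\<close> is again a nilpotent ideal, and maximality puts it inside
  \<open>N\<close>.\<close>

lemma complex_nilradical_invariant:
  assumes lie: "lie_algebra lb" and J: "complex_structure lb J" and p: "J ` p \<subseteq> p" and N: "is_nilradical lb p N"
  shows "J ` N \<subseteq> N"
proof -
  have lin: "linear J" and JJ: "\<And>X. J (J X) = - X" and Jl: "\<And>X Y. lb (J X) Y = J (lb X Y)"
    using J unfolding complex_structure_def by simp_all
  note bil = lie_bilinear[OF lie] and anti = lie_antisym[OF lie]
  have Jr: "lb X (J Y) = J (lb X Y)" for X Y
    using anti[of X "J Y"] anti[of Y X] by (simp add: Jl linear_neg[OF lin])
  note id = is_nilradicalD(1-4)[OF N] and max = is_nilradicalD(6)[OF N]
  have ideal: "lie_ideal lb p (J ` N)"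
    unfolding lie_ideal_def using linear_subspace_image[OF lin id(1)] id(2,3) p by (auto simp: Jr image_subset_iff subset_iff)
  let ?C = "\<lambda>k. (bracket_span lb N ^^ k) N"
  \<comment> \<open>The induction does not stay within the image of \<open>J\<close>:
    \<open>lb (J x) (u + J w)\<close> equals \<open>J (lb x u) - lb x w\<close>, so sums of both
    kinds of terms are carried along.\<close>
  have "(bracket_span lb (J ` N) ^^ k) (J ` N) \<subseteq> {u + v |u v. u \<in> ?C k \<and> v \<in> J ` ?C k}" for k
  proof (induction k)
    case 0
    show ?case
    proof
      fix z assume "z \<in> (bracket_span lb (J ` N) ^^ 0) (J ` N)"
      then show "z \<in> {u + v |u v. u \<in> ?C 0 \<and> v \<in> J ` ?C 0}"
        using subspace_0[OF id(1)] by (rule_tac CollectI, rule_tac exI[of _ 0], rule_tac exI[of _ z], simp)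
    qed
  next
    case (Suc k)
    have "bracket_span lb (J ` N) ((bracket_span lb (J ` N) ^^ k) (J ` N)) \<subseteq> {u + v |u v. u \<in> ?C (Suc k) \<and> v \<in> J ` ?C (Suc k)}"
    proof (rule bracket_span_subset)
      show "subspace {u + v |u v. u \<in> ?C (Suc k) \<and> v \<in> J ` ?C (Suc k)}"
        using subspace_lower_central_series[OF id(1)] linear_subspace_image[OF lin] by (intro subspace_sums) blast+
      fix X Z assume "X \<in> J ` N" "Z \<in> (bracket_span lb (J ` N) ^^ k) (J ` N)"
      then obtain x u w where x: "X = J x" "x \<in> N" "Z = u + J w" "u \<in> ?C k" "w \<in> ?C k"
        using Suc.IH by blast
      have "lb X Z = lb x (- w) + J (lb x u)"
        unfolding x by (simp add: Jl Jr JJ bilinear_radd[OF bil] bilinear_rneg[OF bil] linear_add[OF lin])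
      moreover have "- w \<in> ?C k" using x(5) subspace_neg[OF subspace_lower_central_series[OF id(1)]] by blast
      then have "lb x (- w) \<in> ?C (Suc k)" "lb x u \<in> ?C (Suc k)"
        using x by (simp_all add: bracket_in_span)
      ultimately show "lb X Z \<in> {u + v |u v. u \<in> ?C (Suc k) \<and> v \<in> J ` ?C (Suc k)}" by blast
    qed
    then show ?case by simp
  qed
  moreover obtain k where "?C k = {0}" using id(4) unfolding lie_nilpotent_def by blast
  ultimately have "(bracket_span lb (J ` N) ^^ k) (J ` N) \<subseteq> {0}"
    using linear_0[OF lin] by force
  then have "lie_nilpotent lb (J ` N)"
    unfolding lie_nilpotent_def
    using subspace_0[OF subspace_lower_central_series[OF linear_subspace_image[OF lin id(1)], where T = "J ` N"]] by blast
  then show ?thesis using max ideal by blast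
qed

lemma nilradical_subset_complex_parabolic:
  assumes lie: "lie_algebra lb" and J: "complex_structure lb J"
    and q: "complex_parabolic lb J q" and p: "complex_parabolic lb J p" and qp: "q \<subseteq> p" and N: "is_nilradical lb p N"
  shows "N \<subseteq> q"
proof -
  obtain b where b: "b \<subseteq> q" "borel_subalgebra lb J b" using q unfolding complex_parabolic_def by blast
  have Jp: "J ` p \<subseteq> p" using p unfolding complex_parabolic_def by blast
  note id = is_nilradicalD(5,4)[OF N]
  have sN: "subspace N" "\<And>X Y. X \<in> N \<Longrightarrow> Y \<in> N \<Longrightarrow> lb X Y \<in> N"
    using is_nilradicalD(1-3)[OF N] by blast+
  have "N \<subseteq> b"
  proof (rule borel_contains_solvable_ideal[OF lie_bilinear[OF lie] lie_antisym[OF lie] _ b(2)])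
    show "linear J" using J unfolding complex_structure_def by blast
    show "b \<subseteq> p" using b qp by blast
    show "lie_solvable lb N" using nilpotent_imp_solvable sN id(2) by blast
  qed (use id complex_nilradical_invariant[OF lie J Jp N] in auto)
  then show ?thesis using b by blast
qed

text \<open>The Borel subalgebra of a real parabolic lives in the complexification. The argument is
  therefore run for \<open>N \<times> N\<close>, the complexification of \<open>N\<close>, and the
  inclusion is read off in one component.\<close>

lemma nilradical_subset_real_parabolic:
  assumes lie: "lie_algebra lb"
    and q: "real_parabolic lb q" and p: "real_parabolic lb p" and qp: "q \<subseteq> p" and N: "is_nilradical lb p N"
  shows "N \<subseteq> q"
proof -
  note bil = lie_bilinear[OF lie] and anti = lie_antisym[OF lie]
  let ?lb = "complexified_bracket lb" and ?J = "\<lambda>(X, Y). (- Y, X) :: 'a \<times> 'a"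
  obtain b where b: "b \<subseteq> q \<times> q" "borel_subalgebra ?lb ?J b"
    using q unfolding real_parabolic_def complex_parabolic_def by blast
  note id = is_nilradicalD(1-4)[OF N]
  have bilc: "bilinear ?lb"
    unfolding bilinear_def complexified_bracket_def
    by (auto intro!: linearI simp: bilinear_ladd[OF bil] bilinear_radd[OF bil] bilinear_lmul[OF bil] bilinear_rmul[OF bil] scaleR_diff_right scaleR_add_right)
  have antic: "?lb X Y = - ?lb Y X" for X Y
    unfolding complexified_bracket_def using anti[of "fst X"] anti[of "snd X"] by (simp add: case_prod_beta)
  have linJ: "linear ?J" by (auto intro!: linearI)
  have sNN: "subspace (N \<times> N)" using id(1) by (simp add: subspace_Times)
  have subNN: "?lb X Y \<in> N \<times> N" if "X \<in> p \<times> p" "Y \<in> N \<times> N" for X Y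
    using that subspace_diff[OF id(1)] subspace_add[OF id(1)] id(3)
    unfolding complexified_bracket_def by auto
  have ideal: "lie_ideal ?lb (p \<times> p) (N \<times> N)"
    unfolding lie_ideal_def using sNN subNN id(2) by blast
  let ?C = "\<lambda>k. (bracket_span lb N ^^ k) N"
  have "(bracket_span ?lb (N \<times> N) ^^ k) (N \<times> N) \<subseteq> ?C k \<times> ?C k" for k
  proof (induction k)
    case (Suc k)
    have sC: "subspace (?C (Suc k))" using subspace_lower_central_series[OF id(1)] .
    have "bracket_span ?lb (N \<times> N) ((bracket_span ?lb (N \<times> N) ^^ k) (N \<times> N)) \<subseteq> ?C (Suc k) \<times> ?C (Suc k)"
    proof (rule bracket_span_subset)
      show "subspace (?C (Suc k) \<times> ?C (Suc k))" using sC by (simp only: subspace_Times)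
      fix X Y assume "X \<in> N \<times> N" "Y \<in> (bracket_span ?lb (N \<times> N) ^^ k) (N \<times> N)"
      then have "fst X \<in> N" "snd X \<in> N" "fst Y \<in> ?C k" "snd Y \<in> ?C k" using Suc.IH by auto
      then have "lb (fst X) (fst Y) \<in> ?C (Suc k)" "lb (snd X) (snd Y) \<in> ?C (Suc k)"
        "lb (fst X) (snd Y) \<in> ?C (Suc k)" "lb (snd X) (fst Y) \<in> ?C (Suc k)"
        by (simp_all add: bracket_in_span)
      then show "?lb X Y \<in> ?C (Suc k) \<times> ?C (Suc k)"
        using subspace_diff[OF sC] subspace_add[OF sC] unfolding complexified_bracket_def case_prod_beta by blast
    qed
    then show ?case by simp
  qed simp
  moreover obtain k where "?C k = {0}" using id(4) unfolding lie_nilpotent_def by blast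
  ultimately have "(bracket_span ?lb (N \<times> N) ^^ k) (N \<times> N) \<subseteq> {0}"
    by (metis Times_insert_left Sigma_empty1 image_insert image_empty sup_bot_right zero_prod_def)
  then have nil: "lie_nilpotent ?lb (N \<times> N)"
    unfolding lie_nilpotent_def using subspace_0[OF subspace_lower_central_series[OF sNN, where T = "N \<times> N"]] by blast
  have "N \<times> N \<subseteq> b"
  proof (rule borel_contains_solvable_ideal[OF bilc antic linJ b(2) _ ideal])
    show "b \<subseteq> p \<times> p" using b qp by blast
    show "?J ` (N \<times> N) \<subseteq> N \<times> N" using subspace_neg[OF id(1)] by auto
    show "lie_solvable ?lb (N \<times> N)" using nilpotent_imp_solvable[OF sNN _ nil] subNN id(2) by blast
  qed
  then show ?thesis using b subspace_0[OF id(1)] by blast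
qed

lemma semisimple_with_parabolicsD:
  assumes lie: "lie_algebra lb" and q: "semisimple_with_parabolics G A \<iota> lb q p" and N: "is_nilradical lb p N"
  shows "q \<subseteq> p" and "lie_subalgebra lb q" "lie_subalgebra lb p"
    and "N \<subseteq> q"
proof -
  have qp: "q \<subseteq> p" and h: "(real_parabolic lb q \<and> real_parabolic lb p) \<or>
      (\<exists>J. complex_structure lb J \<and> complex_parabolic lb J q \<and> complex_parabolic lb J p)"
    using q unfolding semisimple_with_parabolics_def by auto
  show "q \<subseteq> p" by (rule qp)
  show "N \<subseteq> q"
    using h nilradical_subset_real_parabolic[OF lie _ _ qp N] nilradical_subset_complex_parabolic[OF lie _ _ _ qp N]
    by metis
  show "lie_subalgebra lb q" "lie_subalgebra lb p"
    using h unfolding real_parabolic_def complex_parabolic_def by auto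
qed

context lie_group_with_algebra
begin

text \<open>The image of the nilradical under \<open>Adj g\<close> is a nilpotent ideal of
  \<open>p\<close>, hence contained in the nilradical by maximality. \<open>Ad_bracket\<close>
  applies because elements of \<open>p\<close> have generating curves; the inverse of
  \<open>g\<close> serves to show that the image is an ideal.\<close>

lemma Ad_preserves_nilradical:
  assumes p: "subspace p" "\<And>X Y. X \<in> p \<Longrightarrow> Y \<in> p \<Longrightarrow> lb X Y \<in> p" "\<And>X. X \<in> p \<Longrightarrow> \<exists>c. gen X c"
    and g: "\<And>X. X \<in> p \<Longrightarrow> Adj g X \<in> p" "\<And>X. X \<in> p \<Longrightarrow> Adj (inv g) X \<in> p"
    and N: "is_nilradical lb p N" and X: "X \<in> N"
  shows "Adj g X \<in> N"
proof -
  note id = is_nilradicalD(1-4)[OF N] and max = is_nilradicalD(6)[OF N]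
  have hom: "Adj g (lb X Y) = lb (Adj g X) (Adj g Y)" if "X \<in> p" "Y \<in> p" for X Y
    using Ad_bracket p(3) that by blast
  have "lb X (Adj g Y) \<in> Adj g ` N" if "X \<in> p" "Y \<in> N" for X Y
  proof -
    have "lb X (Adj g Y) = Adj g (lb (Adj (inv g) X) Y)"
      using hom[OF g(2)[OF that(1)], of Y] that id(2) by (auto simp: Ad_inv)
    then show ?thesis using id(3)[OF g(2)[OF that(1)] that(2)] by blast
  qed
  then have ideal: "lie_ideal lb p (Adj g ` N)"
    unfolding lie_ideal_def using linear_subspace_image[OF Ad_linear id(1)] id(2) g(1) by blast
  let ?C = "\<lambda>k. (bracket_span lb N ^^ k) N"
  have Cp: "?C k \<subseteq> p" for k
    using lower_central_series_subset[OF id(1), of lb k] id(2,3) by blast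
  have "(bracket_span lb (Adj g ` N) ^^ k) (Adj g ` N) \<subseteq> Adj g ` ?C k" for k
  proof (induction k)
    case (Suc k)
    have "bracket_span lb (Adj g ` N) ((bracket_span lb (Adj g ` N) ^^ k) (Adj g ` N)) \<subseteq> Adj g ` ?C (Suc k)"
    proof (rule bracket_span_subset)
      show "subspace (Adj g ` ?C (Suc k))"
        by (rule linear_subspace_image[OF Ad_linear subspace_lower_central_series[OF id(1)]])
      fix X Y assume "X \<in> Adj g ` N" "Y \<in> (bracket_span lb (Adj g ` N) ^^ k) (Adj g ` N)"
      then obtain x y where xy: "X = Adj g x" "x \<in> N" "Y = Adj g y" "y \<in> ?C k" using Suc.IH by blast
      have "lb X Y = Adj g (lb x y)" using hom[OF subsetD[OF id(2) xy(2)] subsetD[OF Cp xy(4)]] xy(1,3) by simp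
      moreover have "lb x y \<in> ?C (Suc k)" using xy by (simp add: bracket_in_span)
      ultimately show "lb X Y \<in> Adj g ` ?C (Suc k)" by blast
    qed
    then show ?case by simp
  qed simp
  moreover obtain k where "?C k = {0}" using id(4) unfolding lie_nilpotent_def by blast
  ultimately have "(bracket_span lb (Adj g ` N) ^^ k) (Adj g ` N) \<subseteq> {0}"
    using linear_0[OF Ad_linear] by force
  then have "lie_nilpotent lb (Adj g ` N)"
    unfolding lie_nilpotent_def
    using subspace_0[OF subspace_lower_central_series[OF linear_subspace_image[OF Ad_linear id(1)], where T = "Adj g ` N"]] by blast
  then show ?thesis using max[OF ideal] X by blast
qed

end

section \<open>Relative operators on a parabolic geometry\<close>

lemma descend_eq:
  assumes "X \<in> S" "\<pi> X = y" "\<And>Y. Y \<in> S \<Longrightarrow> \<pi> Y = y \<Longrightarrow> F Y = F X"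
  shows "descend S \<pi> F y = F X"
  unfolding descend_def
proof (rule the_equality)
  show "\<forall>Y\<in>S. \<pi> Y = y \<longrightarrow> F X = F Y" using assms(3) by simp
  show "z = F X" if "\<forall>Y\<in>S. \<pi> Y = y \<longrightarrow> z = F Y" for z using that assms(1,2) by blast
qed

lemma
  assumes "qmap S \<pi> N"
  shows qmap_linear: "linear \<pi>" and qmap_surj: "\<exists>X\<in>S. \<pi> X = y"
    and qmap_ker: "X \<in> S \<Longrightarrow> \<pi> X = 0 \<longleftrightarrow> X \<in> N"
proof -
  have h: "linear \<pi>" "\<pi> ` S = UNIV" "{X \<in> S. \<pi> X = 0} = N" using assms unfolding qmap_def by auto
  show "linear \<pi>" by (rule h(1))
  show "\<exists>X\<in>S. \<pi> X = y" using h(2) by (metis UNIV_I imageE)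
  show "X \<in> S \<Longrightarrow> \<pi> X = 0 \<longleftrightarrow> X \<in> N" unfolding h(3)[symmetric] by simp
qed

lemma qmap_eq_iff:
  assumes "qmap S \<pi> N" "subspace S" "X \<in> S" "Y \<in> S"
  shows "\<pi> X = \<pi> Y \<longleftrightarrow> X - Y \<in> N"
  using qmap_ker[OF assms(1), of "X - Y"] subspace_diff[OF assms(2,3,4)] qmap_linear[OF assms(1)]
  by (simp add: linear_diff)

locale parabolic_geom =
  fixes \<G> :: "('x::{t2_space,second_countable_topology}, 'e::{real_normed_vector,fin_dim_vector},
                'g::fin_dim_vector,
                'u::{t2_space,second_countable_topology}, 'f::{real_normed_vector,fin_dim_vector},
                'b::{t2_space,second_countable_topology}, 'm::{real_normed_vector,fin_dim_vector},
                'r::fin_dim_vector, 't::fin_dim_vector) par_geom"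
  assumes parabolic_geometry: "parabolic_geometry \<G>"
begin

abbreviation "G \<equiv> grp \<G>"
abbreviation "AG \<equiv> grp_atlas \<G>"
abbreviation "\<pp> \<equiv> alg_p \<G>"
abbreviation "\<qq> \<equiv> alg_q \<G>"
abbreviation "\<nn> \<equiv> nil_p \<G>"
abbreviation "P \<equiv> grp_P \<G>"
abbreviation "Q \<equiv> grp_Q \<G>"
abbreviation "AB \<equiv> tot_atlas \<G>"
abbreviation "act \<equiv> ract \<G>"
abbreviation "lb \<equiv> lbr \<G>"
abbreviation "quo \<equiv> quotA \<G>"
abbreviation "prT \<equiv> projT \<G>"
abbreviation "\<tau> \<equiv> (\<lambda>X. projT \<G> (quotA \<G> X))"

lemma parabolic_geometryD:
  shows "lie_group G AG"
    and "lie_algebra_of_group G AG (alg_id \<G>) lb"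
    and "semisimple_with_parabolics G AG (alg_id \<G>) lb \<qq> \<pp>"
    and nilradical: "is_nilradical lb \<pp> \<nn>"
    and subgroup_P: "subgroup P G"
    and algebra_P: "lie_subgroup_algebra G AG (alg_id \<G>) P = \<pp>"
    and principal: "principal_bundle G AG Q AB (base_atlas \<G>) (proj \<G>) act"
    and cartan: "cartan_connection G AG (alg_id \<G>) Q AB act (cartan \<G>)"
    and quo: "qmap \<pp> quo \<nn>"
    and prT_linear: "linear prT"
    and \<tau>: "qmap \<pp> \<tau> \<qq>"
  using parabolic_geometry unfolding parabolic_geometry_def o_def by blast+

sublocale lie_group_with_algebra G AG "alg_id \<G>" lb
  by standard (rule parabolic_geometryD)+

section \<open>The groups \<open>P\<close> and \<open>Q\<close> and their adjoint actions\<close>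

lemma P_closed: "g \<in> P \<Longrightarrow> h \<in> P \<Longrightarrow> g \<otimes>\<^bsub>G\<^esub> h \<in> P" "g \<in> P \<Longrightarrow> inv\<^bsub>G\<^esub> g \<in> P" "\<one>\<^bsub>G\<^esub> \<in> P"
  using subgroup_P by (auto simp: subgroup.m_closed subgroup.m_inv_closed subgroup.one_closed)

lemma \<pp>_subalgebra: "subspace \<pp>" "X \<in> \<pp> \<Longrightarrow> Y \<in> \<pp> \<Longrightarrow> lb X Y \<in> \<pp>"
  and \<qq>_subalgebra: "subspace \<qq>" "X \<in> \<qq> \<Longrightarrow> Y \<in> \<qq> \<Longrightarrow> lb X Y \<in> \<qq>"
  and \<qq>_\<pp>: "X \<in> \<qq> \<Longrightarrow> X \<in> \<pp>" and \<nn>_\<qq>: "X \<in> \<nn> \<Longrightarrow> X \<in> \<qq>"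
  using semisimple_with_parabolicsD[OF lie_alg parabolic_geometryD(3) nilradical]
  unfolding lie_subalgebra_def by blast+

lemma \<nn>_ideal: "subspace \<nn>" "X \<in> \<pp> \<Longrightarrow> Y \<in> \<nn> \<Longrightarrow> lb X Y \<in> \<nn>" "X \<in> \<nn> \<Longrightarrow> Y \<in> \<pp> \<Longrightarrow> lb X Y \<in> \<nn>"
proof -
  show "subspace \<nn>" by (rule is_nilradicalD(1)[OF nilradical])
  have i: "lb X Y \<in> \<nn>" if "X \<in> \<pp>" "Y \<in> \<nn>" for X Y by (rule is_nilradicalD(3)[OF nilradical that])
  then show "X \<in> \<pp> \<Longrightarrow> Y \<in> \<nn> \<Longrightarrow> lb X Y \<in> \<nn>" by blast
  show "lb X Y \<in> \<nn>" if "X \<in> \<nn>" "Y \<in> \<pp>"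
    using subspace_neg[OF is_nilradicalD(1)[OF nilradical] i[OF that(2,1)]]
    unfolding lie_antisym[OF lie_alg, of X Y] .
qed

lemma \<pp>_gen: "X \<in> \<pp> \<longleftrightarrow> (\<exists>c. gen X c \<and> range c \<subseteq> P)"
  unfolding algebra_P[symmetric] lie_subgroup_algebra_def by simp

lemma \<pp>_gen': "X \<in> \<pp> \<Longrightarrow> \<exists>c. gen X c"
  using \<pp>_gen by blast

lemma Ad_\<pp>: "g \<in> P \<Longrightarrow> X \<in> \<pp> \<Longrightarrow> AdG \<G> g X \<in> \<pp>"
proof -
  assume g: "g \<in> P" and "X \<in> \<pp>"
  then obtain c where c: "gen X c" "range c \<subseteq> P" using \<pp>_gen by blast
  have "range (\<lambda>t. g \<otimes>\<^bsub>G\<^esub> c t \<otimes>\<^bsub>G\<^esub> inv\<^bsub>G\<^esub> g) \<subseteq> P"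
    using c(2) g by (auto intro!: P_closed)
  then show ?thesis using gen_conj[OF c(1)] \<pp>_gen by blast
qed

lemma Ad_\<nn>: "g \<in> P \<Longrightarrow> X \<in> \<nn> \<Longrightarrow> AdG \<G> g X \<in> \<nn>"
  by (rule Ad_preserves_nilradical[OF \<pp>_subalgebra \<pp>_gen' Ad_\<pp> Ad_\<pp> nilradical])
     (auto simp: P_closed)

lemma Q_P: "g \<in> Q \<Longrightarrow> g \<in> P" and Ad_\<qq>: "g \<in> Q \<Longrightarrow> X \<in> \<qq> \<Longrightarrow> AdG \<G> g X \<in> \<qq>"
  unfolding grp_Q_def by auto

lemma Q_closed: "g \<in> Q \<Longrightarrow> h \<in> Q \<Longrightarrow> g \<otimes>\<^bsub>G\<^esub> h \<in> Q" "g \<in> Q \<Longrightarrow> inv\<^bsub>G\<^esub> g \<in> Q" "\<one>\<^bsub>G\<^esub> \<in> Q"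
proof -
  show "\<one>\<^bsub>G\<^esub> \<in> Q" unfolding grp_Q_def using P_closed(3) by (simp add: Ad_one)
  show "g \<otimes>\<^bsub>G\<^esub> h \<in> Q" if "g \<in> Q" "h \<in> Q"
  proof -
    have "AdG \<G> (g \<otimes>\<^bsub>G\<^esub> h) ` \<qq> = AdG \<G> g ` AdG \<G> h ` \<qq>" by (simp add: image_image Ad_mult)
    then show ?thesis using that unfolding grp_Q_def by (simp add: P_closed)
  qed
  show "inv\<^bsub>G\<^esub> g \<in> Q" if "g \<in> Q"
  proof -
    have "AdG \<G> (inv\<^bsub>G\<^esub> g) ` AdG \<G> g ` \<qq> = \<qq>" by (simp add: image_image Ad_inv)
    then show ?thesis using that unfolding grp_Q_def by (simp add: P_closed)
  qed
qed

lemma curve_in_Q: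
  assumes X: "X \<in> \<qq>" and c: "gen X c" "range c \<subseteq> P"
  shows "c t \<in> Q"
proof -
  have i: "AdG \<G> (c t) Y \<in> \<qq>" if "Y \<in> \<qq>" for t Y
    by (rule Ad_preserves_subspace[OF c(1) \<qq>_subalgebra(1) _ _ that])
       (use X \<qq>_subalgebra(2) \<qq>_\<pp> \<pp>_gen' in auto)
  have "AdG \<G> (c t) ` \<qq> = \<qq>"
  proof
    show "AdG \<G> (c t) ` \<qq> \<subseteq> \<qq>" using i by blast
    show "\<qq> \<subseteq> AdG \<G> (c t) ` \<qq>"
    proof
      fix Y assume "Y \<in> \<qq>"
      then have "AdG \<G> (c (- t)) Y \<in> \<qq>" by (rule i)
      moreover have "Y = AdG \<G> (c t) (AdG \<G> (c (- t)) Y)" by (simp add: gen_minus[OF c(1)] Ad_inv)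
      ultimately show "Y \<in> AdG \<G> (c t) ` \<qq>" by blast
    qed
  qed
  then show ?thesis unfolding grp_Q_def using c(2) by auto
qed

lemma \<qq>_gen:
  assumes "X \<in> \<qq>"
  obtains c where "gen X c" "range c \<subseteq> Q"
proof -
  obtain c where c: "gen X c" "range c \<subseteq> P" using \<qq>_\<pp>[OF assms] \<pp>_gen by blast
  then have "range c \<subseteq> Q" using curve_in_Q[OF assms c] by blast
  then show ?thesis using that c by blast
qed

text \<open>\<open>grp_P_plus\<close> is made of values at time 1, so time is absorbed into the
  generator: \<open>c t\<close> is the value at 1 of the curve generated by
  \<open>t *\<^sub>R X\<close>.\<close>

lemma curve_in_P_plus:
  assumes "X \<in> \<nn>" "gen X c"
  shows "c t \<in> grp_P_plus \<G>"
  unfolding grp_P_plus_def exp_image_def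
  using gen_scaleR[OF assms(2), of t] subspace_scale[OF \<nn>_ideal(1) assms(1), of t]
  by (intro CollectI exI[of _ "\<lambda>s. c (t * s)"] exI[of _ "t *\<^sub>R X"]) simp

section \<open>Induced actions and bracket on the quotients\<close>

lemma quo_eq_iff: "X \<in> \<pp> \<Longrightarrow> Y \<in> \<pp> \<Longrightarrow> quo X = quo Y \<longleftrightarrow> X - Y \<in> \<nn>"
  by (rule qmap_eq_iff[OF quo \<pp>_subalgebra(1)])

lemma \<tau>_eq_iff: "X \<in> \<pp> \<Longrightarrow> Y \<in> \<pp> \<Longrightarrow> \<tau> X = \<tau> Y \<longleftrightarrow> X - Y \<in> \<qq>"
  using qmap_eq_iff[OF \<tau> \<pp>_subalgebra(1)] .

lemma quo_linear: "linear quo" and \<tau>_linear: "linear \<tau>"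
  using qmap_linear[OF quo] qmap_linear[OF \<tau>] .

lemma quo_lift: obtains X where "X \<in> \<pp>" "x = quo X"
  using qmap_surj[OF quo, of x] by blast

lemma \<tau>_lift: obtains Y where "Y \<in> \<pp>" "y = \<tau> Y"
  using qmap_surj[OF \<tau>, of y] by blast

lemma actA_quo:
  assumes g: "g \<in> P" and X: "X \<in> \<pp>"
  shows "actA \<G> g (quo X) = quo (AdG \<G> g X)"
  unfolding actA_def
proof (rule descend_eq[OF X refl])
  fix Y assume Y: "Y \<in> \<pp>" "quo Y = quo X"
  then have "AdG \<G> g (Y - X) \<in> \<nn>" using Ad_\<nn>[OF g] quo_eq_iff[OF Y(1) X] by blast
  then show "quo (AdG \<G> g Y) = quo (AdG \<G> g X)"
    using quo_eq_iff[OF Ad_\<pp>[OF g Y(1)] Ad_\<pp>[OF g X]] by (simp add: linear_diff[OF Ad_linear])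
qed

lemma actT_\<tau>:
  assumes g: "g \<in> Q" and X: "X \<in> \<pp>"
  shows "actT \<G> g (\<tau> X) = \<tau> (AdG \<G> g X)"
  unfolding actT_def o_def
proof (rule descend_eq[OF X refl])
  fix Y assume Y: "Y \<in> \<pp>" "\<tau> Y = \<tau> X"
  then have "AdG \<G> g (Y - X) \<in> \<qq>" using Ad_\<qq>[OF g] \<tau>_eq_iff[OF Y(1) X] by blast
  then show "\<tau> (AdG \<G> g Y) = \<tau> (AdG \<G> g X)"
    using \<tau>_eq_iff[OF Ad_\<pp>[OF Q_P[OF g] Y(1)] Ad_\<pp>[OF Q_P[OF g] X]] by (simp add: linear_diff[OF Ad_linear])
qed

lemma actT_inv: "g \<in> Q \<Longrightarrow> actT \<G> g (actT \<G> (inv\<^bsub>G\<^esub> g) y) = y"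
  by (rule \<tau>_lift[of y]) (simp add: actT_\<tau> Q_closed Ad_\<pp> Q_P Ad_inv)

lemma actT_linear: "g \<in> Q \<Longrightarrow> linear (actT \<G> g)"
proof (rule linearI)
  assume g: "g \<in> Q"
  fix x y :: 't and r :: real
  obtain X Y where X: "X \<in> \<pp>" "x = \<tau> X" and Y: "Y \<in> \<pp>" "y = \<tau> Y" using \<tau>_lift by metis
  have "x + y = \<tau> (X + Y)" "r *\<^sub>R x = \<tau> (r *\<^sub>R X)"
    using X Y linear_add[OF \<tau>_linear] linear_scale[OF \<tau>_linear] by simp_all
  then show "actT \<G> g (x + y) = actT \<G> g x + actT \<G> g y" "actT \<G> g (r *\<^sub>R x) = r *\<^sub>R actT \<G> g x"
    using X Y actT_\<tau>[OF g X(1)] actT_\<tau>[OF g Y(1)] actT_\<tau>[OF g subspace_add[OF \<pp>_subalgebra(1) X(1) Y(1)]]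
      actT_\<tau>[OF g subspace_scale[OF \<pp>_subalgebra(1) X(1), of r]]
      linear_add[OF \<tau>_linear] linear_scale[OF \<tau>_linear] linear_add[OF Ad_linear] linear_scale[OF Ad_linear]
    by simp_all
qed

lemma brA_quo:
  assumes X: "X \<in> \<pp>" and Y: "Y \<in> \<pp>"
  shows "brA \<G> (quo X) (quo Y) = quo (lb X Y)"
proof -
  note bil = lie_bilinear[OF lie_alg]
  have 1: "descend \<pp> quo (\<lambda>Y. quo (lb Z Y)) (quo Y) = quo (lb Z Y)" if Z: "Z \<in> \<pp>" for Z
  proof (rule descend_eq[OF Y refl])
    fix Y' assume Y': "Y' \<in> \<pp>" "quo Y' = quo Y"
    then have "lb Z (Y' - Y) \<in> \<nn>" using quo_eq_iff[OF Y'(1) Y] \<nn>_ideal(2)[OF Z] by blast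
    then show "quo (lb Z Y') = quo (lb Z Y)"
      using quo_eq_iff \<pp>_subalgebra(2)[OF Z] Y Y' by (simp add: bilinear_rsub[OF bil])
  qed
  show ?thesis
    unfolding brA_def 1[OF X, symmetric]
  proof (rule descend_eq[OF X refl])
    fix X' assume X': "X' \<in> \<pp>" "quo X' = quo X"
    then have "lb (X' - X) Y \<in> \<nn>" using quo_eq_iff[OF X'(1) X] \<nn>_ideal(3) Y by blast
    then show "descend \<pp> quo (\<lambda>Y. quo (lb X' Y)) (quo Y) = descend \<pp> quo (\<lambda>Y. quo (lb X Y)) (quo Y)"
      unfolding 1[OF X] 1[OF X'(1)]
      using quo_eq_iff \<pp>_subalgebra(2) Y X X' by (simp add: bilinear_lsub[OF bil])
  qed
qed

text \<open>Brackets of \<open>X\<close> with \<open>\<pp>\<close> lie in the ideal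
  \<open>\<nn>\<close>, so one-parameter subgroups of the nilradical act trivially on
  \<open>\<pp>\<close> modulo \<open>\<nn>\<close>, and with that also modulo
  \<open>\<qq>\<close>.\<close>

lemma Ad_\<nn>_curve: "X \<in> \<nn> \<Longrightarrow> gen X c \<Longrightarrow> Y \<in> \<pp> \<Longrightarrow> AdG \<G> (c t) Y - Y \<in> \<nn>"
proof -
  assume X: "X \<in> \<nn>" and c: "gen X c" and Y: "Y \<in> \<pp>"
  obtain e where "gen Y e" using \<pp>_gen'[OF Y] by blast
  show ?thesis
    by (rule Ad_trivial_mod_subspace[OF c \<nn>_ideal(1) _ _ \<open>gen Y e\<close>])
       (use X Y \<nn>_ideal \<nn>_\<qq> \<qq>_\<pp> \<pp>_gen' in auto)
qed

lemma actA_\<nn>_curve: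
  assumes X: "X \<in> \<nn>" "gen X c" "c t \<in> Q"
  shows "actA \<G> (c t) x = x"
proof (rule quo_lift[of x])
  fix Y assume Y: "Y \<in> \<pp>" "x = quo Y"
  show ?thesis
    unfolding Y(2) actA_quo[OF Q_P[OF X(3)] Y(1)] quo_eq_iff[OF Ad_\<pp>[OF Q_P[OF X(3)] Y(1)] Y(1)]
    using Ad_\<nn>_curve[OF X(1,2) Y(1)] .
qed

lemma actT_\<nn>_curve:
  assumes X: "X \<in> \<nn>" "gen X c" "c t \<in> Q"
  shows "actT \<G> (c t) y = y"
proof (rule \<tau>_lift[of y])
  fix Y assume Y: "Y \<in> \<pp>" "y = \<tau> Y"
  show ?thesis
    unfolding Y(2) actT_\<tau>[OF X(3) Y(1)] \<tau>_eq_iff[OF Ad_\<pp>[OF Q_P[OF X(3)] Y(1)] Y(1)]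
    using Ad_\<nn>_curve[OF X(1,2) Y(1)] \<nn>_\<qq> by blast
qed

section \<open>Derivatives along the Cartan connection\<close>

lemma manB: "smooth_manifold AB" and manM: "smooth_manifold (base_atlas \<G>)"
  and proj_smooth: "smooth_map AB (base_atlas \<G>) UNIV (proj \<G>)"
  and act_one: "act u \<one>\<^bsub>G\<^esub> = u"
  and act_smooth: "smooth_map_on_subset (prod_atlas AB AG) AB (UNIV \<times> Q) (\<lambda>(u, g). act u g)"
  using principal unfolding principal_bundle_def by simp_all

definition cartan_inv :: "'u \<Rightarrow> 'g \<Rightarrow> ('u \<Rightarrow> real) \<Rightarrow> real" where
  "cartan_inv u X = inv_into (tangent_space AB u) (cartan \<G> u) X"

lemma
  shows cartan_inv_tangent: "cartan_inv u X \<in> tangent_space AB u"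
    and cartan_inv_eqI: "v \<in> tangent_space AB u \<Longrightarrow> cartan \<G> u v = X \<Longrightarrow> cartan_inv u X = v"
    and cartan_inv_add: "cartan_inv u (X + Y) f = cartan_inv u X f + cartan_inv u Y f"
proof -
  have bij: "bij_betw (cartan \<G> u) (tangent_space AB u) UNIV"
    and add: "v \<in> tangent_space AB u \<Longrightarrow> w \<in> tangent_space AB u \<Longrightarrow> cartan \<G> u (\<lambda>f. v f + w f) = cartan \<G> u v + cartan \<G> u w"
    for v w
    using cartan unfolding cartan_connection_def by simp_all
  show t: "cartan_inv u X \<in> tangent_space AB u" for X
    unfolding cartan_inv_def using bij by (metis UNIV_I bij_betw_imp_surj_on inv_into_into)
  have c: "cartan \<G> u (cartan_inv u X) = X" for X
    unfolding cartan_inv_def using bij by (metis UNIV_I bij_betw_imp_surj_on f_inv_into_f)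
  show e: "cartan_inv u X = v" if "v \<in> tangent_space AB u" "cartan \<G> u v = X" for v X
    unfolding cartan_inv_def using bij that by (metis bij_betw_imp_inj_on inv_into_f_f)
  have "cartan_inv u (X + Y) = (\<lambda>f. cartan_inv u X f + cartan_inv u Y f)"
    by (rule e[OF tangent_add[OF t t]]) (simp add: add[OF t t] c)
  then show "cartan_inv u (X + Y) f = cartan_inv u X f + cartan_inv u Y f" by simp
qed

lemma cartan_inv_derivative:
  fixes f :: "'u \<Rightarrow> real"
  assumes X: "gen X c" "range c \<subseteq> Q" and f: "smooth_near AB u f"
  shows "((\<lambda>t. f (act u (c t))) has_real_derivative cartan_inv u X f) (at 0)"
proof -
  let ?\<gamma> = "\<lambda>t. act u (c t)"
  have c0: "c 0 = \<one>\<^bsub>G\<^esub>" by (rule gen_0[OF X(1)])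
  \<comment> \<open>The action is smooth on \<open>UNIV \<times> Q\<close> only in the sense of
    local extensions. The curve is first written through an extension \<open>F\<close> near the pair
    of \<open>u\<close> and the identity, which agrees with the action because \<open>c\<close>
    stays in \<open>Q\<close>.\<close>
  obtain U F where U: "open U" "(u, \<one>\<^bsub>G\<^esub>) \<in> U" "smooth_map (prod_atlas AB AG) AB U F"
    "\<And>y. y \<in> U \<inter> UNIV \<times> Q \<Longrightarrow> F y = (\<lambda>(u, g). act u g) y"
    using act_smooth[unfolded smooth_map_on_subset_def, rule_format, of "(u, \<one>\<^bsub>G\<^esub>)"] Q_closed(3) by auto
  note R = smooth_manifold_real_atlas and P = smooth_manifold_prod_atlas[OF manB man]
  have p: "smooth_map real_atlas (prod_atlas AB AG) UNIV (\<lambda>t. (u, c t))"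
    by (rule smooth_map_Pair[OF R manB man open_UNIV smooth_map_const[OF R manB] gen_smooth[OF X(1)]])
  define N where "N = (\<lambda>t. (u, c t)) -` U"
  have oN: "open N" unfolding N_def using smooth_map_preimage_open[OF open_UNIV p U(1)] by simp
  have N0: "0 \<in> N" unfolding N_def using U(2) c0 by simp
  have "smooth_map real_atlas AB N (\<lambda>t. F (u, c t))"
    by (rule smooth_map_compose[OF R P manB oN U(1) _ smooth_map_subset[OF p] U(3)]) (auto simp: N_def)
  then have s: "smooth_map real_atlas AB N ?\<gamma>"
  proof (rule smooth_map_cong[OF R manB oN])
    fix t assume "t \<in> N"
    moreover have "c t \<in> Q" using X(2) by blast
    ultimately show "F (u, c t) = ?\<gamma> t" using U(4)[of "(u, c t)"] by (simp add: N_def)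
  qed
  have g0: "?\<gamma> 0 = u" using c0 act_one by simp
  have "velocity AB ?\<gamma> \<in> tangent_space AB u" using velocity_tangent[OF manB oN N0 s] g0 by simp
  moreover have "cartan \<G> u (velocity AB ?\<gamma>) = X"
    using cartan X unfolding cartan_connection_def by blast
  ultimately have "cartan_inv u X = velocity AB ?\<gamma>" by (rule cartan_inv_eqI)
  then show ?thesis using smooth_at_curve_has_derivative[OF manB oN N0 s, of f] f g0 by simp
qed

text \<open>Invariance in the \<open>\<nn>\<close> directions is what the descent of
  \<open>rel_fund_deriv\<close> requires. It is weaker than equivariance, and it also covers forms
  with constant arguments inserted, which in general are not equivariant functions with values in
  the representation.\<close>

definition horizontal_at :: "'u \<Rightarrow> ('u \<Rightarrow> 'w::fin_dim_vector) \<Rightarrow> bool" where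
  "horizontal_at u \<sigma> \<longleftrightarrow> smooth_near AB u \<sigma> \<and>
     (\<forall>X c t. X \<in> \<nn> \<longrightarrow> gen X c \<longrightarrow> range c \<subseteq> Q \<longrightarrow> \<sigma> (act u (c t)) = \<sigma> u)"

lemma dir_deriv_cartan_inv_add:
  assumes "smooth_near AB u \<sigma>"
  shows "dir_deriv (cartan_inv u (X + Y)) \<sigma> = dir_deriv (cartan_inv u X) \<sigma> + dir_deriv (cartan_inv u Y) \<sigma>"
  by (rule dir_deriv_eqI[OF cartan_inv_tangent assms])
     (simp add: linear_add dir_deriv[OF cartan_inv_tangent assms] cartan_inv_add)

lemma dir_deriv_\<nn>:
  assumes \<sigma>: "horizontal_at u \<sigma>" and X: "X \<in> \<nn>"
  shows "dir_deriv (cartan_inv u X) \<sigma> = 0"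
proof (rule dir_deriv_eqI[OF cartan_inv_tangent])
  show s: "smooth_near AB u \<sigma>" using \<sigma> unfolding horizontal_at_def by blast
  fix l :: "'a \<Rightarrow> real" assume l: "linear l"
  obtain c where c: "gen X c" "range c \<subseteq> Q" using \<qq>_gen[OF \<nn>_\<qq>[OF X]] .
  have "\<sigma> (act u (c t)) = \<sigma> u" for t using \<sigma> X c unfolding horizontal_at_def by blast
  then show "cartan_inv u X (\<lambda>y. l (\<sigma> y)) = l 0"
    using DERIV_unique[OF cartan_inv_derivative[OF c smooth_near_linear[OF s l]], of 0] linear_0[OF l] by simp
qed

lemma rel_fund_deriv_quo:
  assumes \<sigma>: "horizontal_at u \<sigma>" and X: "X \<in> \<pp>"
  shows "rel_fund_deriv \<G> (quo X) \<sigma> u = dir_deriv (cartan_inv u X) \<sigma>"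
  unfolding rel_fund_deriv_def cartan_inv_def[symmetric]
proof (rule descend_eq[OF X refl])
  fix Y assume Y: "Y \<in> \<pp>" "quo Y = quo X"
  have s: "smooth_near AB u \<sigma>" using \<sigma> unfolding horizontal_at_def by blast
  have "Y - X \<in> \<nn>" using quo_eq_iff[OF Y(1) X] Y(2) by simp
  from dir_deriv_\<nn>[OF \<sigma> this] dir_deriv_cartan_inv_add[OF s, of X "Y - X"]
  show "dir_deriv (cartan_inv u Y) \<sigma> = dir_deriv (cartan_inv u X) \<sigma>" by simp
qed

lemma sections_equivariant:
  "\<sigma> \<in> sections \<G> \<alpha> U \<Longrightarrow> proj \<G> u \<in> U \<Longrightarrow> g \<in> Q \<Longrightarrow> \<sigma> (act u g) = \<alpha> (inv\<^bsub>G\<^esub> g) (\<sigma> u)"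
  unfolding sections_def by auto

lemma sections_smooth_near:
  assumes "open U" "\<sigma> \<in> sections \<G> \<alpha> U" "proj \<G> u \<in> U"
  shows "smooth_near AB u \<sigma>"
proof (rule smooth_nearI)
  show "open (proj \<G> -` U)" using smooth_map_preimage_open[OF open_UNIV proj_smooth assms(1)] by simp
  show "smooth_fun AB (proj \<G> -` U) \<sigma>" using assms(2) unfolding sections_def by auto
qed (use assms(3) in simp)

lemma horizontal_sections_actA:
  assumes "open U" "\<sigma> \<in> sections \<G> (actA \<G>) U" "proj \<G> u \<in> U"
  shows "horizontal_at u \<sigma>"
  unfolding horizontal_at_def
proof (intro conjI allI impI)
  show "smooth_near AB u \<sigma>" by (rule sections_smooth_near[OF assms])
  fix X c t assume c: "X \<in> \<nn>" "gen X c" "range c \<subseteq> Q"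
  have "\<sigma> (act u (c t)) = actA \<G> (c (- t)) (\<sigma> u)"
    using sections_equivariant[OF assms(2,3)] c(3) by (simp add: gen_minus[OF c(2)] image_subset_iff)
  moreover have "c (- t) \<in> Q" using c(3) by blast
  ultimately show "\<sigma> (act u (c t)) = \<sigma> u" using actA_\<nn>_curve[OF c(1,2)] by simp
qed

lemma dir_deriv_section_\<qq>:
  assumes \<xi>: "\<xi> \<in> sections \<G> (actT \<G>) UNIV" and X: "X \<in> \<qq>" and Y: "Y \<in> \<pp>" "\<xi> u = \<tau> Y"
  shows "dir_deriv (cartan_inv u X) \<xi> = - \<tau> (lb X Y)"
proof (rule dir_deriv_eqI[OF cartan_inv_tangent])
  show s: "smooth_near AB u \<xi>" by (rule sections_smooth_near[OF open_UNIV \<xi>]) simp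
  fix l :: "'t \<Rightarrow> real" assume l: "linear l"
  obtain c where c: "gen X c" "range c \<subseteq> Q" using \<qq>_gen[OF X] .
  obtain e where e: "gen Y e" using \<pp>_gen'[OF Y(1)] by blast
  have l\<tau>: "linear (\<lambda>Z. l (\<tau> Z))" using linear_compose[OF \<tau>_linear l] by (simp add: o_def)
  \<comment> \<open>Writing \<open>- 1 * t\<close> for \<open>- t\<close> matches
    \<open>gen_scaleR\<close>, which turns the reversed curve into the one generated by
    \<open>- X\<close>; this is the source of the minus sign.\<close>
  have "\<xi> (act u (c t)) = \<tau> (AdG \<G> (c (- 1 * t)) Y)" for t
    using sections_equivariant[OF \<xi>] c(2) actT_\<tau>[OF _ Y(1), of "c (- t)"] Y(2)
    by (simp add: gen_minus[OF c(1), symmetric] image_subset_iff)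
  moreover have "((\<lambda>t. l (\<tau> (AdG \<G> (c (- 1 * t)) Y))) has_real_derivative l (\<tau> (lb (- 1 *\<^sub>R X) Y))) (at 0)"
    by (rule Ad_deriv_0[OF gen_scaleR[OF c(1)] e l\<tau>])
  moreover have "lb (- 1 *\<^sub>R X) Y = - lb X Y" using bilinear_lneg[OF lie_bilinear[OF lie_alg]] by simp
  ultimately show "cartan_inv u X (\<lambda>y. l (\<xi> y)) = l (- \<tau> (lb X Y))"
    using DERIV_unique[OF cartan_inv_derivative[OF c smooth_near_linear[OF s l]]] linear_neg[OF \<tau>_linear] by simp
qed

end

section \<open>Relative tractor bundles: infinitesimal action and connection\<close>

locale tractor_bundle = parabolic_geom \<G>
  for \<G> :: "('x::{t2_space,second_countable_topology}, 'e::{real_normed_vector,fin_dim_vector},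
                'g::fin_dim_vector,
                'u::{t2_space,second_countable_topology}, 'f::{real_normed_vector,fin_dim_vector},
                'b::{t2_space,second_countable_topology}, 'm::{real_normed_vector,fin_dim_vector},
                'r::fin_dim_vector, 't::fin_dim_vector) par_geom" +
  fixes \<rho> :: "'x \<Rightarrow> 'v::fin_dim_vector \<Rightarrow> 'v"
  assumes tractor_rep: "tractor_rep \<G> \<rho>"
begin

abbreviation "inf_act \<equiv> infinitesimal_action G AG (alg_id \<G>) P \<rho>"

lemma rep_smooth: "smooth_fun_on_subset AG P (\<lambda>x. \<rho> x v)"
  and rep_P_plus: "g \<in> grp_P_plus \<G> \<Longrightarrow> \<rho> g v = v"
  using tractor_rep unfolding tractor_rep_def group_rep_def by simp_all

text \<open>The derivative depends on \<open>c\<close> only through \<open>X\<close> since \<open>g \<mapsto> \<rho> g v\<close> extends smoothly to a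
  neighbourhood of the identity in \<open>G\<close>.\<close>

lemma rep_derivative:
  "\<exists>F. smooth_near AG \<one>\<^bsub>G\<^esub> F \<and> (\<forall>X c l. gen X c \<longrightarrow> range c \<subseteq> P \<longrightarrow> linear (l :: 'v \<Rightarrow> real) \<longrightarrow>
       ((\<lambda>t. l (\<rho> (c t) v)) has_real_derivative alg_id \<G> X (\<lambda>y. l (F y))) (at 0))"
proof -
  from rep_smooth[of v, unfolded smooth_fun_on_subset_def] P_closed(3)
  have "\<exists>U F. open U \<and> \<one>\<^bsub>G\<^esub> \<in> U \<and> smooth_fun AG U F \<and> (\<forall>y\<in>U \<inter> P. F y = \<rho> y v)" by (rule bspec)
  then obtain U F where U: "open U" "\<one>\<^bsub>G\<^esub> \<in> U" "smooth_fun AG U F" "\<forall>y\<in>U \<inter> P. F y = \<rho> y v" by blast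
  have sF: "smooth_near AG \<one>\<^bsub>G\<^esub> F" by (rule smooth_nearI[OF U(1,2,3)])
  show ?thesis
  proof (intro exI[of _ F] conjI allI impI sF)
    fix X c and l :: "'v \<Rightarrow> real" assume c: "gen X c" "range c \<subseteq> P" and l: "linear l"
    show "((\<lambda>t. l (\<rho> (c t) v)) has_real_derivative alg_id \<G> X (\<lambda>y. l (F y))) (at 0)"
    proof (rule has_field_derivative_transform_within_open)
      show "((\<lambda>t. l (F (c t))) has_real_derivative alg_id \<G> X (\<lambda>y. l (F y))) (at 0)"
        by (rule gen_deriv[OF c(1) smooth_near_linear[OF sF l]])
      show "open (c -` U)" using smooth_map_preimage_open[OF open_UNIV gen_smooth[OF c(1)] U(1)] by simp
      show "0 \<in> c -` U" using U(2) gen_0[OF c(1)] by simp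
      show "l (F (c t)) = l (\<rho> (c t) v)" if "t \<in> c -` U" for t
        using U(4) that subsetD[OF c(2) rangeI[of c t]] by simp
    qed
  qed
qed

text \<open>All curves in \<open>P\<close> generating \<open>X\<close> give the same derivative, and
  the curve \<open>c\<close> at hand excludes further solutions, so the definite description in
  \<open>infinitesimal_action\<close> is determined.\<close>

lemma infinitesimal_action_derivative:
  assumes c: "gen X c" "range c \<subseteq> P" and l: "linear (l :: 'v \<Rightarrow> real)"
  shows "((\<lambda>t. l (\<rho> (c t) v)) has_real_derivative l (inf_act X v)) (at 0)"
proof -
  obtain F where F: "smooth_near AG \<one>\<^bsub>G\<^esub> F \<and> (\<forall>X c l. gen X c \<longrightarrow> range c \<subseteq> P \<longrightarrow> linear (l :: 'v \<Rightarrow> real) \<longrightarrow>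
       ((\<lambda>t. l (\<rho> (c t) v)) has_real_derivative alg_id \<G> X (\<lambda>y. l (F y))) (at 0))"
    using rep_derivative[of v] ..
  note sF = F[THEN conjunct1] and D = F[THEN conjunct2, rule_format]
  have "inf_act X v = dir_deriv (alg_id \<G> X) F"
    unfolding infinitesimal_action_def
  proof (rule the_equality)
    show "\<forall>c. gen X c \<and> range c \<subseteq> P \<longrightarrow> (\<forall>l::'v \<Rightarrow> real. linear l \<longrightarrow>
        ((\<lambda>t. l (\<rho> (c t) v)) has_real_derivative l (dir_deriv (alg_id \<G> X) F)) (at 0))"
      using D dir_deriv[OF iota_tangent sF] by simp
    fix w assume w: "\<forall>c. gen X c \<and> range c \<subseteq> P \<longrightarrow>
        (\<forall>l::'v \<Rightarrow> real. linear l \<longrightarrow> ((\<lambda>t. l (\<rho> (c t) v)) has_real_derivative l w) (at 0))"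
    show "w = dir_deriv (alg_id \<G> X) F"
    proof (rule functionals_separate)
      fix l :: "'v \<Rightarrow> real" assume l: "linear l"
      then show "l w = l (dir_deriv (alg_id \<G> X) F)"
        unfolding dir_deriv[OF iota_tangent sF l] using w[rule_format, OF conjI[OF c] l] D[OF c l] DERIV_unique by blast
    qed
  qed
  then show ?thesis using D[OF c l] dir_deriv[OF iota_tangent sF l] by simp
qed

lemma inf_act_eqI:
  assumes X: "X \<in> \<pp>"
    and D: "\<And>c l. gen X c \<Longrightarrow> range c \<subseteq> P \<Longrightarrow> linear (l :: 'v \<Rightarrow> real) \<Longrightarrow> ((\<lambda>t. l (\<rho> (c t) v)) has_real_derivative l w) (at 0)"
  shows "inf_act X v = w"
proof (rule functionals_separate)
  fix l :: "'v \<Rightarrow> real" assume l: "linear l"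
  obtain c where c: "gen X c" "range c \<subseteq> P" using X \<pp>_gen by blast
  show "l (inf_act X v) = l w"
    using infinitesimal_action_derivative[OF c l] D[OF c l] DERIV_unique by blast
qed

lemma inf_act_\<nn>: "X \<in> \<nn> \<Longrightarrow> inf_act X v = 0"
proof (rule inf_act_eqI)
  assume X: "X \<in> \<nn>"
  then show "X \<in> \<pp>" using \<nn>_\<qq> \<qq>_\<pp> by blast
  fix c and l :: "'v \<Rightarrow> real" assume c: "gen X c" and l: "linear l"
  show "((\<lambda>t. l (\<rho> (c t) v)) has_real_derivative l 0) (at 0)"
    using rep_P_plus[OF curve_in_P_plus[OF X c]] linear_0[OF l] by simp
qed

text \<open>The curves for \<open>X\<close>, \<open>Y\<close> and \<open>X + Y\<close> are not
  compared with each other: all three derivatives are values of \<open>alg_id\<close> on components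
  of one germ \<open>F\<close>, and \<open>alg_id\<close> is additive.\<close>

lemma inf_act_add:
  assumes X: "X \<in> \<pp>" and Y: "Y \<in> \<pp>"
  shows "inf_act (X + Y) v = inf_act X v + inf_act Y v"
proof -
  obtain F where F: "smooth_near AG \<one>\<^bsub>G\<^esub> F \<and> (\<forall>X c l. gen X c \<longrightarrow> range c \<subseteq> P \<longrightarrow> linear (l :: 'v \<Rightarrow> real) \<longrightarrow>
       ((\<lambda>t. l (\<rho> (c t) v)) has_real_derivative alg_id \<G> X (\<lambda>y. l (F y))) (at 0))"
    using rep_derivative[of v] ..
  note sF = F[THEN conjunct1] and D = F[THEN conjunct2, rule_format]
  have eq: "l (inf_act Z v) = alg_id \<G> Z (\<lambda>y. l (F y))" if Z: "Z \<in> \<pp>" and l: "linear l" for Z and l :: "'v \<Rightarrow> real"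
  proof -
    obtain c where c: "gen Z c" "range c \<subseteq> P" using Z \<pp>_gen by blast
    show ?thesis by (rule DERIV_unique[OF infinitesimal_action_derivative[OF c l] D[OF c l]])
  qed
  show ?thesis
    by (rule functionals_separate)
       (simp add: linear_add eq X Y subspace_add[OF \<pp>_subalgebra(1)] iota_add)
qed

lemma bullet_quo:
  assumes X: "X \<in> \<pp>"
  shows "bullet \<G> \<rho> (quo X) v = inf_act X v"
  unfolding bullet_def
proof (rule descend_eq[OF X refl])
  fix Y assume Y: "Y \<in> \<pp>" "quo Y = quo X"
  then have d: "Y - X \<in> \<nn>" using quo_eq_iff X by blast
  have "Y = X + (Y - X)" by simp
  then have "inf_act Y v = inf_act X v + inf_act (Y - X) v"
    using inf_act_add[OF X subspace_diff[OF \<pp>_subalgebra(1) Y(1) X]] by simp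
  then show "inf_act Y v = inf_act X v" using inf_act_\<nn>[OF d] by simp
qed

text \<open>Curves in \<open>Q\<close> generated by elements of \<open>\<nn>\<close> act trivially
  both on the arguments in \<open>\<pp>/\<qq>\<close> and on the values in the
  representation.\<close>

lemma horizontal_form:
  assumes \<phi>: "\<phi> \<in> rel_forms \<G> \<rho> k" and ys: "length ys = k"
  shows "horizontal_at u (\<lambda>u'. \<phi> u' ys)"
  unfolding horizontal_at_def
proof (intro conjI allI impI)
  show "smooth_near AB u (\<lambda>u'. \<phi> u' ys)"
    using \<phi> ys unfolding rel_forms_def by (intro smooth_nearI[of UNIV]) auto
  fix X c t assume c: "X \<in> \<nn>" "gen X c" "range c \<subseteq> Q"
  have Q: "c t \<in> Q" for t using c(3) by blast
  have "\<phi> (act u (c t)) ys = \<rho> (inv\<^bsub>G\<^esub> (c t)) (\<phi> u (map (actT \<G> (c t)) ys))"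
    using \<phi> ys Q unfolding rel_forms_def by blast
  also have "map (actT \<G> (c t)) ys = ys" using actT_\<nn>_curve[OF c(1,2) Q] by (simp add: map_idI)
  also have "\<rho> (inv\<^bsub>G\<^esub> (c t)) (\<phi> u ys) = \<phi> u ys"
    using rep_P_plus[OF curve_in_P_plus[OF c(1,2)], of "- t"] by (simp add: gen_minus[OF c(2)])
  finally show "\<phi> (act u (c t)) ys = \<phi> u ys" .
qed

definition equivariant :: "('u \<Rightarrow> 'v) \<Rightarrow> bool" where
  "equivariant \<sigma> \<longleftrightarrow> (\<forall>u. \<forall>g\<in>Q. \<sigma> (act u g) = \<rho> (inv\<^bsub>G\<^esub> g) (\<sigma> u))"

lemma equivariant_horizontal:
  assumes \<sigma>: "equivariant \<sigma>" and s: "smooth_near AB u \<sigma>"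
  shows "horizontal_at u \<sigma>"
  unfolding horizontal_at_def
proof (intro conjI allI impI s)
  fix X c t assume c: "X \<in> \<nn>" "gen X c" "range c \<subseteq> Q"
  then have "c t \<in> Q" by blast
  then show "\<sigma> (act u (c t)) = \<sigma> u"
    using \<sigma> rep_P_plus[OF curve_in_P_plus[OF c(1,2)], of "- t"] unfolding equivariant_def
    by (simp add: gen_minus[OF c(2)])
qed

lemma dir_deriv_equivariant_\<qq>:
  assumes \<sigma>: "equivariant \<sigma>" and s: "smooth_near AB u \<sigma>" and X: "X \<in> \<qq>"
  shows "dir_deriv (cartan_inv u X) \<sigma> = - inf_act X (\<sigma> u)"
proof (rule dir_deriv_eqI[OF cartan_inv_tangent s])
  fix l :: "'v \<Rightarrow> real" assume l: "linear l"
  obtain c where c: "gen X c" "range c \<subseteq> Q" using \<qq>_gen[OF X] .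
  have cP: "range c \<subseteq> P" using c(2) Q_P by blast
  have "((\<lambda>t. l (\<rho> (c t) (\<sigma> u))) has_real_derivative l (inf_act X (\<sigma> u))) (at (- 1 * 0))"
    using infinitesimal_action_derivative[OF c(1) cP l] by simp
  moreover have "((\<lambda>t. - 1 * t) has_real_derivative - 1) (at (0::real))" by (auto intro!: derivative_eq_intros)
  ultimately have "((\<lambda>t. l (\<rho> (c (- 1 * t)) (\<sigma> u))) has_real_derivative l (inf_act X (\<sigma> u)) * - 1) (at 0)"
    by (rule DERIV_chain2)
  moreover have "\<sigma> (act u (c t)) = \<rho> (c (- 1 * t)) (\<sigma> u)" for t
    using \<sigma> c(2) unfolding equivariant_def by (simp add: gen_minus[OF c(1)] image_subset_iff)
  ultimately show "cartan_inv u X (\<lambda>y. l (\<sigma> y)) = l (- inf_act X (\<sigma> u))"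
    using DERIV_unique[OF cartan_inv_derivative[OF c smooth_near_linear[OF s l]]] linear_neg[OF l] by simp
qed

text \<open>Two lifts differ by some \<open>d\<close> in \<open>\<qq>\<close>, which changes the
  derivative by \<open>- inf_act d (\<sigma> u)\<close> and the action term by
  \<open>inf_act d (\<sigma> u)\<close>. The two changes cancel.\<close>

lemma rel_tractor_connection_eq:
  assumes \<sigma>: "equivariant \<sigma>" "smooth_near AB u \<sigma>" and X: "X \<in> \<pp>" "\<xi> u = \<tau> X"
  shows "rel_tractor_connection \<G> \<rho> \<xi> \<sigma> u = dir_deriv (cartan_inv u X) \<sigma> + inf_act X (\<sigma> u)"
proof -
  note h = equivariant_horizontal[OF \<sigma>]
  have e: "rel_fund_deriv \<G> (quo Z) \<sigma> u + bullet \<G> \<rho> (quo Z) (\<sigma> u) = dir_deriv (cartan_inv u Z) \<sigma> + inf_act Z (\<sigma> u)"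
    if "Z \<in> \<pp>" for Z using that by (simp add: rel_fund_deriv_quo[OF h] bullet_quo)
  show ?thesis
    unfolding rel_tractor_connection_def e[OF X(1), symmetric]
  proof (rule descend_eq)
    show "prT (quo X) = \<xi> u" using X by simp
    fix y assume y: "prT y = \<xi> u"
    obtain Y where Y: "Y \<in> \<pp>" "y = quo Y" using quo_lift .
    then have d: "Y - X \<in> \<qq>" using \<tau>_eq_iff[OF Y(1) X(1)] y X(2) by simp
    have "inf_act (X + (Y - X)) (\<sigma> u) = inf_act X (\<sigma> u) + inf_act (Y - X) (\<sigma> u)"
      by (rule inf_act_add[OF X(1) \<qq>_\<pp>[OF d]])
    then show "rel_fund_deriv \<G> y \<sigma> u + bullet \<G> \<rho> y (\<sigma> u) = rel_fund_deriv \<G> (quo X) \<sigma> u + bullet \<G> \<rho> (quo X) (\<sigma> u)"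
      unfolding Y(2) e[OF Y(1)] e[OF X(1)]
      using dir_deriv_cartan_inv_add[OF \<sigma>(2), of X "Y - X"] dir_deriv_equivariant_\<qq>[OF \<sigma> d] by simp
  qed simp
qed

end

section \<open>Local lifts and the bracket of sections\<close>

context parabolic_geom
begin

lemma actT_mult: "g \<in> Q \<Longrightarrow> h \<in> Q \<Longrightarrow> actT \<G> (g \<otimes>\<^bsub>G\<^esub> h) y = actT \<G> g (actT \<G> h y)"
  by (rule \<tau>_lift[of y]) (simp add: actT_\<tau> Q_closed Ad_\<pp> Q_P Ad_mult)

text \<open>A linear splitting of \<open>\<pp>/\<pp>\<^sub>+ \<rightarrow> \<pp>/\<qq>\<close> is made equivariant by conjugating it with the
  \<open>Q\<close>-component of a local trivialization \<open>\<theta>\<close>. Only \<open>\<theta>\<close> enters: the bundle axioms do not say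
  that the action of \<open>Q\<close> preserves the fibres of the projection.\<close>

lemma local_lifts:
  obtains U where "open U" "proj \<G> u \<in> U"
    "\<And>\<xi>. \<xi> \<in> sections \<G> (actT \<G>) UNIV \<Longrightarrow>
       \<exists>s\<in>sections \<G> (actA \<G>) U. \<forall>u'\<in>proj \<G> -` U. prT (s u') = \<xi> u'"
proof -
  have "\<exists>U \<theta> \<psi>. open U \<and> proj \<G> u \<in> U \<and>
        smooth_map AB (prod_atlas (base_atlas \<G>) AG) (proj \<G> -` U) \<theta> \<and>
        smooth_map_on_subset (prod_atlas (base_atlas \<G>) AG) AB (U \<times> Q) \<psi> \<and>
        (\<forall>u\<in>proj \<G> -` U. \<theta> u \<in> U \<times> Q \<and> \<psi> (\<theta> u) = u \<and> fst (\<theta> u) = proj \<G> u) \<and>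
        (\<forall>z\<in>U \<times> Q. \<psi> z \<in> proj \<G> -` U \<and> \<theta> (\<psi> z) = z) \<and>
        (\<forall>u\<in>proj \<G> -` U. \<forall>g\<in>Q. \<theta> (act u g) = (proj \<G> u, snd (\<theta> u) \<otimes>\<^bsub>G\<^esub> g))"
    using principal unfolding principal_bundle_def by simp
  then obtain U \<theta> where U: "open U" "proj \<G> u \<in> U"
    and \<theta>: "smooth_map AB (prod_atlas (base_atlas \<G>) AG) (proj \<G> -` U) \<theta>"
    and \<theta>Q: "\<And>u. u \<in> proj \<G> -` U \<Longrightarrow> snd (\<theta> u) \<in> Q"
    and \<theta>act: "\<And>u g. u \<in> proj \<G> -` U \<Longrightarrow> g \<in> Q \<Longrightarrow> \<theta> (act u g) = (proj \<G> u, snd (\<theta> u) \<otimes>\<^bsub>G\<^esub> g)"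
    by (auto simp: mem_Times_iff)
  define W where "W = proj \<G> -` U"
  have oW: "open W" unfolding W_def using smooth_map_preimage_open[OF open_UNIV proj_smooth U(1)] by simp
  define q where "q = (\<lambda>u. snd (\<theta> u))"
  have sq: "smooth_map AB AG W q"
    unfolding q_def W_def
    by (rule smooth_map_compose[OF manB smooth_manifold_prod_atlas[OF manM man] man oW[unfolded W_def] open_UNIV _ \<theta> smooth_map_snd[OF manM man]]) simp
  have qQ: "q u' \<in> Q" if "u' \<in> W" for u' using \<theta>Q that unfolding q_def W_def by blast
  have "\<forall>a. \<exists>Y. Y \<in> \<pp> \<and> a = \<tau> Y" using \<tau>_lift by metis
  then obtain Y where Y: "\<And>a. Y a \<in> \<pp>" "\<And>a. a = \<tau> (Y a)" by metis
  \<comment> \<open>A linear right inverse of \<tau> with values in \<open>\<pp>\<close>, obtained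
    from a choice of preimages of basis vectors.\<close>
  define L where "L = (\<lambda>y. \<Sum>a\<in>fbasis. fcoord a y *\<^sub>R Y a)"
  have L: "L y \<in> \<pp>" "\<tau> (L y) = y" for y
  proof -
    show "L y \<in> \<pp>" unfolding L_def using Y(1) \<pp>_subalgebra(1) by (intro subspace_sum subspace_scale)
    have "\<tau> (L y) = (\<Sum>a\<in>fbasis. fcoord a y *\<^sub>R a)"
      unfolding L_def linear_sum[OF \<tau>_linear] linear_scale[OF \<tau>_linear] Y(2)[symmetric] ..
    then show "\<tau> (L y) = y" using fcoord_expansion[of y] by simp
  qed
  have sAd: "smooth_fun AB W (\<lambda>u'. AdG \<G> (q u') (Y a))" "smooth_fun AB W (\<lambda>u'. AdG \<G> (inv\<^bsub>G\<^esub> (q u')) (Y a))" for a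
  proof -
    obtain e where e: "gen (Y a) e" using \<pp>_gen'[OF Y(1)] by blast
    show "smooth_fun AB W (\<lambda>u'. AdG \<G> (q u') (Y a))"
      by (rule smooth_fun_compose[OF manB man oW open_UNIV _ sq Ad_smooth[OF e]]) simp
    show "smooth_fun AB W (\<lambda>u'. AdG \<G> (inv\<^bsub>G\<^esub> (q u')) (Y a))"
      by (rule smooth_fun_compose[OF manB man oW open_UNIV _ smooth_map_inv[OF manB oW sq] Ad_smooth[OF e]]) simp
  qed
  have "\<exists>s\<in>sections \<G> (actA \<G>) U. \<forall>u'\<in>proj \<G> -` U. prT (s u') = \<xi> u'"
    if \<xi>: "\<xi> \<in> sections \<G> (actT \<G>) UNIV" for \<xi>
  proof -
    \<comment> \<open>\<open>T\<close> is \<xi> transported by \<open>q\<close>, hence unchanged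
      under the action of \<open>Q\<close> over \<open>U\<close>; lifting it by \<open>L\<close> and
      transporting back by the inverse of \<open>q\<close> is then equivariant. Writing
      \<open>T\<close> and \<open>s\<close> as sums over a basis reduces smoothness to that of
      \<open>Ad\<close> on fixed vectors.\<close>
    define T where "T = (\<lambda>u'. \<Sum>b\<in>fbasis. fcoord b (\<xi> u') *\<^sub>R \<tau> (AdG \<G> (q u') (Y b)))"
    define s where "s = (\<lambda>u'. \<Sum>a\<in>fbasis. fcoord a (T u') *\<^sub>R quo (AdG \<G> (inv\<^bsub>G\<^esub> (q u')) (Y a)))"
    \<comment> \<open>Stated for \<open>q u' \<in> Q\<close> and not for \<open>u' \<in> W\<close>,
      since it is also applied at \<open>act u' g\<close>, where only the value of \<open>q\<close>
      is at hand.\<close>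
    have T: "T u' = actT \<G> (q u') (\<xi> u')" if "q u' \<in> Q" for u'
    proof -
      have "actT \<G> (q u') (\<xi> u') = (\<Sum>b\<in>fbasis. fcoord b (\<xi> u') *\<^sub>R actT \<G> (q u') b)"
        by (rule linear_expansion[OF actT_linear[OF that]])
      also have "\<dots> = T u'"
        unfolding T_def
      proof (rule sum.cong[OF refl])
        fix b :: 't
        have "actT \<G> (q u') b = \<tau> (AdG \<G> (q u') (Y b))"
          using actT_\<tau>[OF that Y(1), of b] unfolding Y(2)[symmetric] .
        then show "fcoord b (\<xi> u') *\<^sub>R actT \<G> (q u') b = fcoord b (\<xi> u') *\<^sub>R \<tau> (AdG \<G> (q u') (Y b))" by simp
      qed
      finally show ?thesis by simp
    qed
    have s: "s u' = quo (AdG \<G> (inv\<^bsub>G\<^esub> (q u')) (L (T u')))" for u'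
      unfolding s_def L_def linear_sum[OF Ad_linear] linear_scale[OF Ad_linear] linear_sum[OF quo_linear] linear_scale[OF quo_linear] ..
    have sT: "smooth_fun AB W T"
      unfolding T_def
      using \<xi> sAd(1) unfolding sections_def
      by (intro smooth_fun_sum[OF manB oW] smooth_fun_scaleR[OF manB oW] smooth_fun_linear[OF _ \<tau>_linear]
            smooth_fun_linear[OF _ linear_fcoord]) (auto intro: smooth_fun_subset)
    have ss: "smooth_fun AB W s"
      unfolding s_def using sT sAd(2)
      by (intro smooth_fun_sum[OF manB oW] smooth_fun_scaleR[OF manB oW] smooth_fun_linear[OF _ quo_linear]
            smooth_fun_linear[OF _ linear_fcoord]) auto
    have "s (act u' g) = actA \<G> (inv\<^bsub>G\<^esub> g) (s u')" if u': "u' \<in> W" and g: "g \<in> Q" for u' g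
    proof -
      have q': "q (act u' g) = q u' \<otimes>\<^bsub>G\<^esub> g" using \<theta>act u' g unfolding q_def W_def by simp
      have Q': "q u' \<in> Q" "q u' \<otimes>\<^bsub>G\<^esub> g \<in> Q" using qQ[OF u'] g Q_closed by auto
      have "T (act u' g) = actT \<G> (q u' \<otimes>\<^bsub>G\<^esub> g) (\<xi> (act u' g))" using T[of "act u' g"] q' Q' by simp
      also have "\<dots> = actT \<G> (q u') (actT \<G> g (actT \<G> (inv\<^bsub>G\<^esub> g) (\<xi> u')))"
        using sections_equivariant[OF \<xi> _ g] actT_mult[OF Q'(1) g] by simp
      also have "\<dots> = T u'" using actT_inv[OF g] T[OF Q'(1)] by simp
      finally have "s (act u' g) = quo (AdG \<G> (inv\<^bsub>G\<^esub> g) (AdG \<G> (inv\<^bsub>G\<^esub> (q u')) (L (T u'))))"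
        unfolding s q' by (simp add: inv_mult_group Ad_mult)
      also have "\<dots> = actA \<G> (inv\<^bsub>G\<^esub> g) (s u')"
        unfolding s using actA_quo[OF Q_P[OF Q_closed(2)[OF g]] Ad_\<pp>[OF Q_P[OF Q_closed(2)[OF Q'(1)]] L(1)]] by simp
      finally show ?thesis .
    qed
    then have "s \<in> sections \<G> (actA \<G>) U" using ss unfolding sections_def W_def by blast
    moreover have "prT (s u') = \<xi> u'" if u': "u' \<in> W" for u'
    proof -
      note Q' = qQ[OF u'] Q_closed(2)[OF qQ[OF u']]
      have "prT (s u') = actT \<G> (inv\<^bsub>G\<^esub> (q u')) (T u')"
        unfolding s using actT_\<tau>[OF Q'(2) L(1), of "T u'"] L(2) by simp
      also have "\<dots> = \<xi> u'" using T[OF Q'(1)] actT_inv[OF Q'(2), of "\<xi> u'"] by simp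
      finally show ?thesis .
    qed
    ultimately show ?thesis unfolding W_def by blast
  qed
  then show ?thesis using that U by blast
qed

definition bracket_at :: "'u \<Rightarrow> ('u \<Rightarrow> 't) \<Rightarrow> ('u \<Rightarrow> 't) \<Rightarrow> 'g \<Rightarrow> 'g \<Rightarrow> 't" where
  "bracket_at u \<xi> \<eta> X Y = dir_deriv (cartan_inv u X) \<eta> - dir_deriv (cartan_inv u Y) \<xi> + \<tau> (lb X Y)"

text \<open>Adding an element \<open>d\<close> of \<open>\<qq>\<close> to the first lift changes the
  derivative of \<eta> by minus a bracket with \<open>d\<close> and the algebraic term by plus the
  same bracket; the second lift is treated in the same way.\<close>

lemma bracket_at_unique:
  assumes \<xi>: "\<xi> \<in> sections \<G> (actT \<G>) UNIV" and \<eta>: "\<eta> \<in> sections \<G> (actT \<G>) UNIV"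
    and X: "X \<in> \<pp>" "\<xi> u = \<tau> X" "X' \<in> \<pp>" "\<xi> u = \<tau> X'"
    and Y: "Y \<in> \<pp>" "\<eta> u = \<tau> Y" "Y' \<in> \<pp>" "\<eta> u = \<tau> Y'"
  shows "bracket_at u \<xi> \<eta> X' Y' = bracket_at u \<xi> \<eta> X Y"
proof -
  note bil = lie_bilinear[OF lie_alg]
  have s: "smooth_near AB u \<xi>" "smooth_near AB u \<eta>"
    using sections_smooth_near[OF open_UNIV \<xi>] sections_smooth_near[OF open_UNIV \<eta>] by auto
  define d where "d = X' - X"
  define e where "e = Y' - Y"
  have de: "d \<in> \<qq>" "e \<in> \<qq>" "X' = X + d" "Y' = Y + e"
    unfolding d_def e_def using \<tau>_eq_iff X Y by simp_all
  \<comment> \<open>The lifts are changed one after the other, following the expansion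
    \<open>lb X' Y' = lb X Y + lb X e + lb d Y'\<close>: hence \<open>Y'\<close> in one correction
    and \<open>X\<close> in the other.\<close>
  have 1: "dir_deriv (cartan_inv u X') \<eta> = dir_deriv (cartan_inv u X) \<eta> - \<tau> (lb d Y')"
    unfolding de(3) dir_deriv_cartan_inv_add[OF s(2)] dir_deriv_section_\<qq>[OF \<eta> de(1) Y(3,4)] by simp
  have 2: "dir_deriv (cartan_inv u Y') \<xi> = dir_deriv (cartan_inv u Y) \<xi> - \<tau> (lb e X)"
    unfolding de(4) dir_deriv_cartan_inv_add[OF s(1)] dir_deriv_section_\<qq>[OF \<xi> de(2) X(1,2)] by simp
  have "lb X' Y' = lb X Y + lb X e + lb d Y'"
    unfolding de(3) bilinear_ladd[OF bil] unfolding de(4) by (simp add: bilinear_radd[OF bil])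
  then have 3: "\<tau> (lb X' Y') = \<tau> (lb X Y) + \<tau> (lb X e) + \<tau> (lb d Y')"
    by (simp add: linear_add[OF \<tau>_linear])
  have "\<tau> (lb X e) = - \<tau> (lb e X)"
    unfolding lie_antisym[OF lie_alg, of X e] linear_neg[OF \<tau>_linear] ..
  then show ?thesis unfolding bracket_at_def 1 2 3 by simp
qed

text \<open>All pairs of lifts give the same value, and \<open>local_lifts\<close> provides at least
  one pair; without a pair, every \<open>y\<close> would satisfy the condition in the definite
  description.\<close>

lemma rel_bracket_eq:
  assumes \<xi>: "\<xi> \<in> sections \<G> (actT \<G>) UNIV" and \<eta>: "\<eta> \<in> sections \<G> (actT \<G>) UNIV"
    and X: "X \<in> \<pp>" "\<xi> u = \<tau> X" and Y: "Y \<in> \<pp>" "\<eta> u = \<tau> Y"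
  shows "rel_bracket \<G> \<xi> \<eta> u = bracket_at u \<xi> \<eta> X Y"
proof -
  have main: "prT (rel_fund_deriv \<G> (s1 u) s2 u - rel_fund_deriv \<G> (s2 u) s1 u + brA \<G> (s1 u) (s2 u)) = bracket_at u \<xi> \<eta> X Y"
    if U: "open U" "proj \<G> u \<in> U" and s: "s1 \<in> sections \<G> (actA \<G>) U" "s2 \<in> sections \<G> (actA \<G>) U"
      and l: "\<forall>u'\<in>proj \<G> -` U. prT (s1 u') = \<xi> u' \<and> prT (s2 u') = \<eta> u'" for U s1 s2
  proof -
    obtain X' where X': "X' \<in> \<pp>" "s1 u = quo X'" using quo_lift .
    obtain Y' where Y': "Y' \<in> \<pp>" "s2 u = quo Y'" using quo_lift .
    note h = horizontal_sections_actA[OF U(1) s(1) U(2)] horizontal_sections_actA[OF U(1) s(2) U(2)]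
    note n = sections_smooth_near[OF U(1) s(1) U(2)] sections_smooth_near[OF U(1) s(2) U(2)]
    have oW: "open (proj \<G> -` U)" using smooth_map_preimage_open[OF open_UNIV proj_smooth U(1)] by simp
    \<comment> \<open>The projection commutes with the derivative, so derivatives of the lifts
      become derivatives of \<xi> and \<eta>. The lifts cover these only over \<open>U\<close>,
      hence the passage to germs.\<close>
    have pr: "prT (dir_deriv v \<sigma>) = dir_deriv v \<zeta>"
      if v: "v \<in> tangent_space AB u" and \<sigma>: "smooth_near AB u \<sigma>" and \<zeta>: "\<forall>u'\<in>proj \<G> -` U. prT (\<sigma> u') = \<zeta> u'" for v \<sigma> \<zeta>
    proof -
      have ev: "eventually (\<lambda>u'. prT (\<sigma> u') = \<zeta> u') (nhds u)"
        unfolding eventually_nhds using oW U(2) \<zeta> by (intro exI[of _ "proj \<G> -` U"]) simp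
      note s\<sigma> = smooth_near_linear[OF \<sigma> prT_linear]
      have s\<zeta>: "smooth_near AB u \<zeta>" by (rule smooth_near_cong[OF manB s\<sigma> ev])
      have "dir_deriv v \<zeta> = prT (dir_deriv v \<sigma>)"
      proof (rule dir_deriv_eqI[OF v s\<zeta>])
        fix m :: "'t \<Rightarrow> real" assume m: "linear m"
        have "v (\<lambda>y. m (\<zeta> y)) = v (\<lambda>y. m (prT (\<sigma> y)))"
          by (rule tangent_cong[OF manB v smooth_near_linear[OF s\<sigma> m], symmetric])
             (use ev in eventually_elim, simp)
        also have "\<dots> = m (prT (dir_deriv v \<sigma>))"
          using dir_deriv[OF v \<sigma> linear_compose[OF prT_linear m]] by simp
        finally show "v (\<lambda>y. m (\<zeta> y)) = m (prT (dir_deriv v \<sigma>))" .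
      qed
      then show ?thesis by simp
    qed
    have p: "prT (dir_deriv (cartan_inv u X') s2) = dir_deriv (cartan_inv u X') \<eta>" "prT (dir_deriv (cartan_inv u Y') s1) = dir_deriv (cartan_inv u Y') \<xi>"
      using l by (auto intro!: pr[OF cartan_inv_tangent n(2)] pr[OF cartan_inv_tangent n(1)])
    have "prT (rel_fund_deriv \<G> (s1 u) s2 u - rel_fund_deriv \<G> (s2 u) s1 u + brA \<G> (s1 u) (s2 u)) = bracket_at u \<xi> \<eta> X' Y'"
      unfolding X'(2) Y'(2) rel_fund_deriv_quo[OF h(2) X'(1)] rel_fund_deriv_quo[OF h(1) Y'(1)] brA_quo[OF X'(1) Y'(1)]
        linear_add[OF prT_linear] linear_diff[OF prT_linear] bracket_at_def p ..
    also have "\<dots> = bracket_at u \<xi> \<eta> X Y"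
    proof (rule bracket_at_unique[OF \<xi> \<eta> X X'(1) _ Y Y'(1)])
      show "\<xi> u = \<tau> X'" "\<eta> u = \<tau> Y'"
        unfolding X'(2)[symmetric] Y'(2)[symmetric] using l U(2) by simp_all
    qed
    finally show ?thesis .
  qed
  obtain U where U: "open U" "proj \<G> u \<in> U"
    "\<And>\<xi>. \<xi> \<in> sections \<G> (actT \<G>) UNIV \<Longrightarrow> \<exists>s\<in>sections \<G> (actA \<G>) U. \<forall>u'\<in>proj \<G> -` U. prT (s u') = \<xi> u'"
    using local_lifts[of u] by blast
  obtain s1 where s1: "s1 \<in> sections \<G> (actA \<G>) U" "\<forall>u'\<in>proj \<G> -` U. prT (s1 u') = \<xi> u'" using U(3)[OF \<xi>] by blast
  obtain s2 where s2: "s2 \<in> sections \<G> (actA \<G>) U" "\<forall>u'\<in>proj \<G> -` U. prT (s2 u') = \<eta> u'" using U(3)[OF \<eta>] by blast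
  show ?thesis
    unfolding rel_bracket_def
  proof (rule the_equality)
    show "\<forall>U s1 s2. open U \<and> proj \<G> u \<in> U \<and> s1 \<in> sections \<G> (actA \<G>) U \<and> s2 \<in> sections \<G> (actA \<G>) U \<and>
        (\<forall>u'\<in>proj \<G> -` U. prT (s1 u') = \<xi> u' \<and> prT (s2 u') = \<eta> u') \<longrightarrow>
        bracket_at u \<xi> \<eta> X Y = prT (rel_fund_deriv \<G> (s1 u) s2 u - rel_fund_deriv \<G> (s2 u) s1 u + brA \<G> (s1 u) (s2 u))"
      by (intro allI impI, elim conjE, rule main[symmetric])
    fix y assume "\<forall>U s1 s2. open U \<and> proj \<G> u \<in> U \<and> s1 \<in> sections \<G> (actA \<G>) U \<and> s2 \<in> sections \<G> (actA \<G>) U \<and>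
        (\<forall>u'\<in>proj \<G> -` U. prT (s1 u') = \<xi> u' \<and> prT (s2 u') = \<eta> u') \<longrightarrow>
        y = prT (rel_fund_deriv \<G> (s1 u) s2 u - rel_fund_deriv \<G> (s2 u) s1 u + brA \<G> (s1 u) (s2 u))"
    from this[rule_format, of U s1 s2] show "y = bracket_at u \<xi> \<eta> X Y"
      using main[OF U(1,2) s1(1) s2(1)] U(1,2) s1 s2 by simp
  qed
qed

end

section \<open>Alternating forms and the Leibniz rule\<close>

text \<open>Unlike \<open>nths\<close> with a complement set, deletion can be iterated: removing two
  entries is two deletions, and the positions of the remaining entries stay explicit.\<close>

definition del :: "nat \<Rightarrow> 'a list \<Rightarrow> 'a list" where
  "del i xs = take i xs @ drop (Suc i) xs"

lemma del_Cons: "del 0 (x # xs) = xs" "del (Suc i) (x # xs) = x # del i xs"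
  by (simp_all add: del_def)

lemma length_del: "i < length xs \<Longrightarrow> length (del i xs) = length xs - 1"
  by (simp add: del_def)

lemma map_del: "map f (del i xs) = del i (map f xs)"
  by (simp add: del_def take_map drop_map)

lemma set_del: "set (del i xs) \<subseteq> set xs"
  by (auto simp: del_def dest: in_set_takeD in_set_dropD)

lemma nth_del: "m < length xs - 1 \<Longrightarrow> i < length xs \<Longrightarrow> del i xs ! m = xs ! (if m < i then m else Suc m)"
  by (auto simp: del_def nth_append min_def)

lemma nths_remove: "i < length xs \<Longrightarrow> nths xs (- {i}) = del i xs"
proof (induction xs arbitrary: i)
  case (Cons x xs)
  have e0: "{j. Suc j \<in> - {0}} = UNIV" and S: "{j. Suc j \<in> - {Suc i}} = - {i}" for i by auto
  show ?case
  proof (cases i)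
    case 0
    then show ?thesis by (simp only: nths_Cons e0 del_Cons) (simp add: nths_all)
  next
    case (Suc i')
    then show ?thesis
      using Cons.IH[of i'] Cons.prems unfolding Suc nths_Cons S del_Cons by simp
  qed
qed simp

text \<open>Both orders of deletion occur in the Leibniz terms; once the earlier entry is gone, the
  later one sits at \<open>j - 1\<close>.\<close>

lemma nths_remove2:
  "i < j \<Longrightarrow> j < length xs \<Longrightarrow> nths xs (- {i, j}) = del i (del j xs) \<and> nths xs (- {i, j}) = del (j - 1) (del i xs)"
proof (induction xs arbitrary: i j)
  case (Cons x xs)
  obtain j' where j: "j = Suc j'" using Cons.prems by (cases j) auto
  show ?case
  proof (cases i)
    case 0
    have e: "{k. Suc k \<in> - {0, Suc j'}} = - {j'}" by auto
    show ?thesis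
      using Cons.prems nths_remove[of j' xs] unfolding 0 j nths_Cons e del_Cons by (simp add: del_Cons)
  next
    case (Suc i')
    have e: "{k. Suc k \<in> - {Suc i', Suc j'}} = - {i', j'}" by auto
    obtain j'' where j': "j' = Suc j''" using Cons.prems Suc j by (cases j') auto
    have "nths xs (- {i', j'}) = del i' (del j' xs)" "nths xs (- {i', j'}) = del (j' - 1) (del i' xs)"
      using Cons.IH[of i' j'] Cons.prems by (auto simp: Suc j)
    then show ?thesis
      unfolding Suc j nths_Cons e by (simp only: del_Cons j' diff_Suc_1) simp
  qed
qed simp

lemma alternating_formD:
  assumes "alternating_form k \<alpha>"
  shows "length ys = k \<Longrightarrow> i < k \<Longrightarrow> linear (\<lambda>y. \<alpha> (ys[i := y]))"
    and "length ys = k \<Longrightarrow> i < j \<Longrightarrow> j < k \<Longrightarrow> ys ! i = ys ! j \<Longrightarrow> \<alpha> ys = 0"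
  using assms unfolding alternating_form_def by simp_all blast

lemma alternating_slot_linear:
  assumes "alternating_form k \<alpha>" "Suc (length ys + length zs) = k"
  shows "linear (\<lambda>y. \<alpha> (ys @ y # zs))"
proof -
  have "linear (\<lambda>y. \<alpha> ((ys @ undefined # zs)[length ys := y]))"
    by (rule alternating_formD(1)[OF assms(1)]) (use assms(2) in auto)
  then show ?thesis by simp
qed

text \<open>Polarization: the value with \<open>a + b\<close> in both slots vanishes and is
  expanded.\<close>

lemma alternating_swap:
  assumes \<alpha>: "alternating_form k \<alpha>" and len: "Suc (Suc (length ys + length zs)) = k"
  shows "\<alpha> (ys @ a # b # zs) = - \<alpha> (ys @ b # a # zs)"
proof -
  have eq0: "\<alpha> (ys @ c # c # zs) = 0" for c
  proof -
    have "(ys @ c # c # zs) ! length ys = (ys @ c # c # zs) ! Suc (length ys)" by (simp add: nth_append)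
    then show ?thesis by (rule alternating_formD(2)[OF \<alpha>, rotated 3]) (use len in auto)
  qed
  have l1: "linear (\<lambda>y. \<alpha> (ys @ y # c # zs))" for c using alternating_slot_linear[OF \<alpha>, of ys "c # zs"] len by simp
  have l2: "linear (\<lambda>y. \<alpha> (ys @ c # y # zs))" for c using alternating_slot_linear[OF \<alpha>, of "ys @ [c]" zs] len by simp
  have "0 = \<alpha> (ys @ (a + b) # (a + b) # zs)" using eq0 by simp
  also have "\<dots> = \<alpha> (ys @ a # b # zs) + \<alpha> (ys @ b # a # zs)"
    unfolding linear_add[OF l1] linear_add[OF l2] by (simp add: eq0)
  finally show ?thesis by (simp add: eq_neg_iff_add_eq_0)
qed

text \<open>\<open>y\<close> passes the entries of \<open>ys\<close> one at a time, starting with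
  the last, at the cost of one sign each.\<close>

lemma alternating_move_to_front:
  assumes \<alpha>: "alternating_form k \<alpha>" and len: "Suc (length ys + length zs) = k"
  shows "\<alpha> (ys @ y # zs) = (- 1) ^ length ys *\<^sub>R \<alpha> (y # ys @ zs)"
  using len
proof (induction ys arbitrary: zs rule: rev_induct)
  case (snoc a ys)
  have "\<alpha> ((ys @ [a]) @ y # zs) = - \<alpha> (ys @ y # a # zs)"
    using alternating_swap[OF \<alpha>, of ys zs a y] snoc.prems by simp
  also have "\<alpha> (ys @ y # a # zs) = (- 1) ^ length ys *\<^sub>R \<alpha> (y # ys @ a # zs)"
    using snoc.IH[of "a # zs"] snoc.prems by simp
  finally show ?case by simp
qed simp

lemma alternating_update:
  assumes \<alpha>: "alternating_form k \<alpha>" and len: "length ys = k" "m < k"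
  shows "\<alpha> (ys[m := z]) = (- 1) ^ m *\<^sub>R \<alpha> (z # del m ys)"
proof -
  have "ys[m := z] = take m ys @ z # drop (Suc m) ys" using len by (simp add: upd_conv_take_nth_drop)
  then show ?thesis
    using alternating_move_to_front[OF \<alpha>, of "take m ys" "drop (Suc m) ys" z] len by (simp add: del_def)
qed

text \<open>In the application, \<open>F i j\<close> is the term in which argument \<open>j\<close>
  is differentiated in direction \<open>i\<close>. With argument \<open>i\<close> removed, slot
  \<open>m\<close> holds argument \<open>m\<close> if \<open>m < i\<close> and \<open>Suc m\<close>
  otherwise; this shift reverses the sign of the terms with \<open>j > i\<close>, and renaming the
  indices in those with \<open>j < i\<close> produces the difference.\<close>

lemma sum_over_slots_antisymmetrize:
  fixes F :: "nat \<Rightarrow> nat \<Rightarrow> 'v::real_vector"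
  shows "(\<Sum>i\<le>k. (- 1) ^ i *\<^sub>R (\<Sum>m<k. (- 1) ^ m *\<^sub>R F i (if m < i then m else Suc m))) =
    (\<Sum>j\<le>k. \<Sum>i<j. (- 1) ^ (i + j) *\<^sub>R (F j i - F i j))"
proof -
  define H where "H = (\<lambda>i j. (- 1::real) ^ (i + j) *\<^sub>R F i j)"
  have inner: "(- 1) ^ i *\<^sub>R (\<Sum>m<k. (- 1) ^ m *\<^sub>R F i (if m < i then m else Suc m)) =
      (\<Sum>j<i. H i j) - (\<Sum>j\<le>k. if i < j then H i j else 0)" if i: "i \<le> k" for i
  proof -
    have "(\<Sum>m<k. (- 1) ^ (i + m) *\<^sub>R F i (if m < i then m else Suc m)) =
       (\<Sum>m<i. (- 1) ^ (i + m) *\<^sub>R F i (if m < i then m else Suc m)) +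
       (\<Sum>m=i..<k. (- 1) ^ (i + m) *\<^sub>R F i (if m < i then m else Suc m))"
      using sum.atLeastLessThan_concat[OF le0 i, of "\<lambda>m. (- 1) ^ (i + m) *\<^sub>R F i (if m < i then m else Suc m)"]
      by (simp only: lessThan_atLeast0)
    also have "(\<Sum>m<i. (- 1) ^ (i + m) *\<^sub>R F i (if m < i then m else Suc m)) = (\<Sum>j<i. H i j)"
      by (simp add: H_def)
    also have "(\<Sum>m=i..<k. (- 1) ^ (i + m) *\<^sub>R F i (if m < i then m else Suc m)) = (\<Sum>m=i..<k. - H i (Suc m))"
      by (intro sum.cong) (auto simp: H_def)
    also have "\<dots> = (\<Sum>j=Suc i..<Suc k. - H i j)"
      using sum.shift_bounds_Suc_ivl[of "\<lambda>j. - H i j" i k] by simp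
    also have "\<dots> = - (\<Sum>j\<in>{Suc i..<Suc k}. H i j)" by (simp add: sum_negf)
    also have "(\<Sum>j\<in>{Suc i..<Suc k}. H i j) = (\<Sum>j\<le>k. if i < j then H i j else 0)"
      by (rule sum.mono_neutral_cong_left) auto
    finally show ?thesis by (simp add: scaleR_sum_right power_add)
  qed
  have "(\<Sum>i\<le>k. (- 1) ^ i *\<^sub>R (\<Sum>m<k. (- 1) ^ m *\<^sub>R F i (if m < i then m else Suc m))) =
    (\<Sum>i\<le>k. \<Sum>j<i. H i j) - (\<Sum>i\<le>k. \<Sum>j\<le>k. if i < j then H i j else 0)"
    using inner by (simp add: sum_subtractf)
  also have "(\<Sum>i\<le>k. \<Sum>j\<le>k. if i < j then H i j else 0) = (\<Sum>j\<le>k. \<Sum>i\<le>k. if i < j then H i j else 0)"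
    by (rule sum.swap)
  also have "\<dots> = (\<Sum>j\<le>k. \<Sum>i<j. H i j)"
  proof (rule sum.cong[OF refl])
    fix j assume "j \<in> {..k}"
    then show "(\<Sum>i\<le>k. if i < j then H i j else 0) = (\<Sum>i<j. H i j)"
      by (intro sum.mono_neutral_cong_right) auto
  qed
  finally show ?thesis
    by (simp add: H_def sum_subtractf scaleR_diff_right add.commute)
qed

lemma dir_deriv_scaleR:
  fixes g :: "_ \<Rightarrow> 'w::fin_dim_vector"
  assumes A: "smooth_manifold A" and v: "v \<in> tangent_space A x" and f: "smooth_near A x f" and g: "smooth_near A x g"
  shows "dir_deriv v (\<lambda>y. f y *\<^sub>R g y) = f x *\<^sub>R dir_deriv v g + v f *\<^sub>R g x"
proof (rule dir_deriv_eqI[OF v smooth_near_scaleR[OF A f g]])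
  fix l :: "'w \<Rightarrow> real" assume l: "linear l"
  show "v (\<lambda>y. l (f y *\<^sub>R g y)) = l (f x *\<^sub>R dir_deriv v g + v f *\<^sub>R g x)"
    using tangentD(3)[OF v f smooth_near_linear[OF g l]]
    by (simp add: linear_scale[OF l] linear_add[OF l] dir_deriv[OF v g l] mult.commute)
qed

lemma dir_deriv_sum:
  fixes f :: "_ \<Rightarrow> _ \<Rightarrow> 'w::fin_dim_vector"
  assumes A: "smooth_manifold A" and v: "v \<in> tangent_space A x" and f: "\<And>i. i \<in> I \<Longrightarrow> smooth_near A x (f i)"
  shows "dir_deriv v (\<lambda>y. \<Sum>i\<in>I. f i y) = (\<Sum>i\<in>I. dir_deriv v (f i))"
proof (rule dir_deriv_eqI[OF v smooth_near_sum[OF A f]])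
  fix l :: "'w \<Rightarrow> real" assume l: "linear l"
  have "v (\<lambda>y. l (\<Sum>i\<in>I. f i y)) = v (\<lambda>y. \<Sum>i\<in>I. l (f i y))" by (simp add: linear_sum[OF l])
  also have "\<dots> = (\<Sum>i\<in>I. v (\<lambda>y. l (f i y)))" by (rule tangent_sum[OF A v smooth_near_linear[OF f l]])
  finally show "v (\<lambda>y. l (\<Sum>i\<in>I. f i y)) = l (\<Sum>i\<in>I. dir_deriv v (f i))"
    using dir_deriv[OF v f l] by (simp add: linear_sum[OF l])
qed

text \<open>Leibniz rule by induction over the arguments: the first section is expanded in a basis,
  which gives a sum of scalar functions times forms with a fixed basis vector in that slot.
  \<open>pre\<close> collects the arguments already fixed.\<close>

lemma dir_deriv_multilinear:
  fixes \<Phi> :: "_ \<Rightarrow> 't::fin_dim_vector list \<Rightarrow> 'v::fin_dim_vector"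
  assumes A: "smooth_manifold A" and v: "v \<in> tangent_space A x"
    and lin: "\<And>y ys zs. Suc (length ys + length zs) = k \<Longrightarrow> linear (\<lambda>z. \<Phi> y (ys @ z # zs))"
    and smooth: "\<And>ys. length ys = k \<Longrightarrow> smooth_near A x (\<lambda>y. \<Phi> y ys)"
    and \<xi>s: "\<And>\<xi>. \<xi> \<in> set \<xi>s \<Longrightarrow> smooth_near A x \<xi>" and len: "length pre + length \<xi>s = k"
  shows "smooth_near A x (\<lambda>y. \<Phi> y (pre @ map (\<lambda>\<xi>. \<xi> y) \<xi>s)) \<and>
    dir_deriv v (\<lambda>y. \<Phi> y (pre @ map (\<lambda>\<xi>. \<xi> y) \<xi>s)) =
      dir_deriv v (\<lambda>y. \<Phi> y (pre @ map (\<lambda>\<xi>. \<xi> x) \<xi>s)) +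
      (\<Sum>j<length \<xi>s. \<Phi> x (pre @ (map (\<lambda>\<xi>. \<xi> x) \<xi>s)[j := dir_deriv v (\<xi>s ! j)]))"
  using \<xi>s len
proof (induction \<xi>s arbitrary: pre)
  case Nil
  then show ?case using smooth[of pre] by simp
next
  case (Cons \<xi> \<xi>s)
  let ?R = "\<lambda>y. map (\<lambda>\<xi>. \<xi> y) \<xi>s"
  have s\<xi>: "smooth_near A x \<xi>" using Cons.prems(1) by simp
  have len': "length (pre @ [a]) + length \<xi>s = k" for a using Cons.prems(2) by simp
  have lin': "linear (\<lambda>z. \<Phi> y (pre @ z # R))" if "length R = length \<xi>s" for y R
    using lin[of pre R y] Cons.prems(2) that by simp
  note IH = Cons.IH[OF Cons.prems(1) len']
  have exp: "\<Phi> y (pre @ z # R) = (\<Sum>a\<in>fbasis. fcoord a z *\<^sub>R \<Phi> y ((pre @ [a]) @ R))"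
    if "length R = length \<xi>s" for y z R
    using linear_expansion[OF lin'[OF that], of y z] by simp
  have sR: "smooth_near A x (\<lambda>y. \<Phi> y ((pre @ [a]) @ ?R y))" for a using IH by simp
  have sc: "smooth_near A x (\<lambda>y. fcoord a (\<xi> y))" for a :: 't by (rule smooth_near_linear[OF s\<xi> linear_fcoord])
  have sP: "smooth_near A x (\<lambda>y. fcoord a (\<xi> y) *\<^sub>R \<Phi> y ((pre @ [a]) @ ?R y))" for a
    by (rule smooth_near_scaleR[OF A sc sR])
  have vc: "v (\<lambda>y. fcoord a (\<xi> y)) = fcoord a (dir_deriv v \<xi>)" for a :: 't
    by (rule dir_deriv[OF v s\<xi> linear_fcoord, symmetric])
  have smooth_goal: "smooth_near A x (\<lambda>y. \<Phi> y (pre @ \<xi> y # ?R y))"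
    unfolding exp[of "?R _", OF length_map] by (rule smooth_near_sum[OF A sP])
  have sK: "smooth_near A x (\<lambda>y. \<Phi> y ((pre @ [a]) @ ?R x))" for a by (rule smooth) (use Cons.prems(2) in simp)
  have const: "(\<Sum>a\<in>fbasis. fcoord a (\<xi> x) *\<^sub>R dir_deriv v (\<lambda>y. \<Phi> y ((pre @ [a]) @ ?R x))) =
      dir_deriv v (\<lambda>y. \<Phi> y (pre @ \<xi> x # ?R x))"
  proof -
    have "dir_deriv v (\<lambda>y. fcoord a (\<xi> x) *\<^sub>R \<Phi> y ((pre @ [a]) @ ?R x)) =
        fcoord a (\<xi> x) *\<^sub>R dir_deriv v (\<lambda>y. \<Phi> y ((pre @ [a]) @ ?R x))" for a
    proof -
      have "v (\<lambda>y. fcoord a (\<xi> x)) = 0"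
        using tangentD(3)[OF v smooth_near_const smooth_near_const, of 1 "fcoord a (\<xi> x)"]
          tangentD(5)[OF v smooth_near_const[of _ _ 1], of "fcoord a (\<xi> x)"] by simp
      then show ?thesis using dir_deriv_scaleR[OF A v smooth_near_const sK, of "fcoord a (\<xi> x)" a] by simp
    qed
    then show ?thesis
      unfolding exp[of "?R x", OF length_map] dir_deriv_sum[OF A v smooth_near_scaleR[OF A smooth_near_const sK]] by simp
  qed
  have "dir_deriv v (\<lambda>y. \<Phi> y (pre @ \<xi> y # ?R y)) =
      (\<Sum>a\<in>fbasis. fcoord a (\<xi> x) *\<^sub>R dir_deriv v (\<lambda>y. \<Phi> y ((pre @ [a]) @ ?R y)) +
        fcoord a (dir_deriv v \<xi>) *\<^sub>R \<Phi> x ((pre @ [a]) @ ?R x))"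
    unfolding exp[of "?R _", OF length_map] dir_deriv_sum[OF A v sP] dir_deriv_scaleR[OF A v sc sR] vc ..
  also have "\<dots> = (\<Sum>a\<in>fbasis. fcoord a (\<xi> x) *\<^sub>R dir_deriv v (\<lambda>y. \<Phi> y ((pre @ [a]) @ ?R y))) +
      \<Phi> x (pre @ dir_deriv v \<xi> # ?R x)"
    unfolding exp[of "?R x", OF length_map] by (rule sum.distrib)
  also have "(\<Sum>a\<in>fbasis. fcoord a (\<xi> x) *\<^sub>R dir_deriv v (\<lambda>y. \<Phi> y ((pre @ [a]) @ ?R y))) =
      (\<Sum>a\<in>fbasis. fcoord a (\<xi> x) *\<^sub>R dir_deriv v (\<lambda>y. \<Phi> y ((pre @ [a]) @ ?R x)) +
        (\<Sum>j<length \<xi>s. fcoord a (\<xi> x) *\<^sub>R \<Phi> x ((pre @ [a]) @ (?R x)[j := dir_deriv v (\<xi>s ! j)])))"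
    using IH by (simp add: scaleR_add_right scaleR_sum_right)
  also have "\<dots> = dir_deriv v (\<lambda>y. \<Phi> y (pre @ \<xi> x # ?R x)) +
      (\<Sum>j<length \<xi>s. \<Phi> x (pre @ \<xi> x # (?R x)[j := dir_deriv v (\<xi>s ! j)]))"
  proof -
    have "(\<Sum>a\<in>fbasis. \<Sum>j<length \<xi>s. fcoord a (\<xi> x) *\<^sub>R \<Phi> x ((pre @ [a]) @ (?R x)[j := dir_deriv v (\<xi>s ! j)])) =
      (\<Sum>j<length \<xi>s. \<Sum>a\<in>fbasis. fcoord a (\<xi> x) *\<^sub>R \<Phi> x ((pre @ [a]) @ (?R x)[j := dir_deriv v (\<xi>s ! j)]))"
      by (rule sum.swap)
    also have "\<dots> = (\<Sum>j<length \<xi>s. \<Phi> x (pre @ \<xi> x # (?R x)[j := dir_deriv v (\<xi>s ! j)]))"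
      by (rule sum.cong[OF refl], rule exp[symmetric]) simp
    finally show ?thesis unfolding sum.distrib const by simp
  qed
  finally have "dir_deriv v (\<lambda>y. \<Phi> y (pre @ \<xi> y # ?R y)) =
      dir_deriv v (\<lambda>y. \<Phi> y (pre @ \<xi> x # ?R x)) +
      ((\<Sum>j<length \<xi>s. \<Phi> x (pre @ \<xi> x # (?R x)[j := dir_deriv v (\<xi>s ! j)])) + \<Phi> x (pre @ dir_deriv v \<xi> # ?R x))"
    by simp
  then show ?case
    using smooth_goal by (simp add: sum.lessThan_Suc_shift add.commute del: sum.lessThan_Suc)
qed

section \<open>Both sides of the formula in terms of lifts to \<open>\<pp>\<close>\<close>

context tractor_bundle
begin

lemma rel_formsD:
  assumes "\<phi> \<in> rel_forms \<G> \<rho> k"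
  shows "alternating_form k (\<phi> u)"
    and "length ys = k \<Longrightarrow> smooth_near AB u (\<lambda>u. \<phi> u ys)"
    and "length ys = k \<Longrightarrow> g \<in> Q \<Longrightarrow> \<phi> (act u g) ys = \<rho> (inv\<^bsub>G\<^esub> g) (\<phi> u (map (actT \<G> g) ys))"
  using assms unfolding rel_forms_def by (auto intro: smooth_nearI[of UNIV])

text \<open>Sections transform by the inverse of the action that a form applies to its arguments, so
  only the action on the values remains.\<close>

lemma equivariant_form_on_sections:
  assumes \<phi>: "\<phi> \<in> rel_forms \<G> \<rho> k" and \<xi>s: "set \<xi>s \<subseteq> sections \<G> (actT \<G>) UNIV" "length \<xi>s = k"
  shows "equivariant (\<lambda>u. \<phi> u (map (\<lambda>\<xi>. \<xi> u) \<xi>s))"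
  unfolding equivariant_def
proof (intro allI ballI)
  fix u g assume g: "g \<in> Q"
  have "actT \<G> g (\<xi> (act u g)) = \<xi> u" if "\<xi> \<in> set \<xi>s" for \<xi>
    using sections_equivariant[of \<xi> "actT \<G>" UNIV u g] \<xi>s(1) that g actT_inv[OF g] by auto
  then have m: "map (actT \<G> g) (map (\<lambda>\<xi>. \<xi> (act u g)) \<xi>s) = map (\<lambda>\<xi>. \<xi> u) \<xi>s" by simp
  have "length (map (\<lambda>\<xi>. \<xi> (act u g)) \<xi>s) = k" using \<xi>s(2) by simp
  from rel_formsD(3)[OF \<phi> this g, of u, unfolded m]
  show "\<phi> (act u g) (map (\<lambda>\<xi>. \<xi> (act u g)) \<xi>s) = \<rho> (inv\<^bsub>G\<^esub> g) (\<phi> u (map (\<lambda>\<xi>. \<xi> u) \<xi>s))" .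
qed

lemma form_leibniz:
  assumes \<phi>: "\<phi> \<in> rel_forms \<G> \<rho> k" and \<xi>s: "set \<xi>s \<subseteq> sections \<G> (actT \<G>) UNIV" "length \<xi>s = k"
  shows "smooth_near AB u (\<lambda>u'. \<phi> u' (map (\<lambda>\<xi>. \<xi> u') \<xi>s))"
    and "dir_deriv (cartan_inv u X) (\<lambda>u'. \<phi> u' (map (\<lambda>\<xi>. \<xi> u') \<xi>s)) =
      dir_deriv (cartan_inv u X) (\<lambda>u'. \<phi> u' (map (\<lambda>\<xi>. \<xi> u) \<xi>s)) +
      (\<Sum>m<k. (- 1) ^ m *\<^sub>R \<phi> u (dir_deriv (cartan_inv u X) (\<xi>s ! m) # del m (map (\<lambda>\<xi>. \<xi> u) \<xi>s)))"
proof -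
  have L: "smooth_near AB u (\<lambda>u'. \<phi> u' ([] @ map (\<lambda>\<xi>. \<xi> u') \<xi>s)) \<and>
    dir_deriv (cartan_inv u X) (\<lambda>u'. \<phi> u' ([] @ map (\<lambda>\<xi>. \<xi> u') \<xi>s)) =
      dir_deriv (cartan_inv u X) (\<lambda>u'. \<phi> u' ([] @ map (\<lambda>\<xi>. \<xi> u) \<xi>s)) +
      (\<Sum>j<length \<xi>s. \<phi> u ([] @ (map (\<lambda>\<xi>. \<xi> u) \<xi>s)[j := dir_deriv (cartan_inv u X) (\<xi>s ! j)]))"
    by (rule dir_deriv_multilinear[where k = k, OF manB cartan_inv_tangent])
       (use \<xi>s sections_smooth_near[OF open_UNIV] rel_formsD(2)[OF \<phi>] alternating_slot_linear[OF rel_formsD(1)[OF \<phi>]] in auto)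
  then show "smooth_near AB u (\<lambda>u'. \<phi> u' (map (\<lambda>\<xi>. \<xi> u') \<xi>s))" by simp
  have "(\<Sum>j<length \<xi>s. \<phi> u ((map (\<lambda>\<xi>. \<xi> u) \<xi>s)[j := dir_deriv (cartan_inv u X) (\<xi>s ! j)])) =
    (\<Sum>m<k. (- 1) ^ m *\<^sub>R \<phi> u (dir_deriv (cartan_inv u X) (\<xi>s ! m) # del m (map (\<lambda>\<xi>. \<xi> u) \<xi>s)))"
    using \<xi>s(2) by (intro sum.cong) (auto intro!: alternating_update[OF rel_formsD(1)[OF \<phi>]])
  then show "dir_deriv (cartan_inv u X) (\<lambda>u'. \<phi> u' (map (\<lambda>\<xi>. \<xi> u') \<xi>s)) =
      dir_deriv (cartan_inv u X) (\<lambda>u'. \<phi> u' (map (\<lambda>\<xi>. \<xi> u) \<xi>s)) +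
      (\<Sum>m<k. (- 1) ^ m *\<^sub>R \<phi> u (dir_deriv (cartan_inv u X) (\<xi>s ! m) # del m (map (\<lambda>\<xi>. \<xi> u) \<xi>s)))"
    using L by simp
qed

text \<open>Since \<open>xs\<close> is an arbitrary lift and does not occur on the right, the
  equation also contains the fact that \<open>twisted_d\<close> descends to arguments in
  \<open>\<pp>/\<qq>\<close>.\<close>

lemma twisted_d_eq:
  assumes \<phi>: "\<phi> \<in> rel_forms \<G> \<rho> k" and len: "length \<xi>s = Suc k"
    and \<xi>s: "set \<xi>s \<subseteq> sections \<G> (actT \<G>) UNIV"
    and xs: "map prT xs = map (\<lambda>\<xi>. \<xi> u) \<xi>s"
  shows "twisted_d \<G> \<rho> (\<lambda>u' xs. \<phi> u' (map prT xs)) u xs =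
    (\<Sum>i\<le>k. (- 1) ^ i *\<^sub>R
       rel_tractor_connection \<G> \<rho> (\<xi>s ! i)
         (\<lambda>u'. \<phi> u' (map (\<lambda>\<xi>. \<xi> u') (nths \<xi>s (- {i})))) u) +
    (\<Sum>j\<le>k. \<Sum>i<j. (- 1) ^ (i + j) *\<^sub>R
       \<phi> u (rel_bracket \<G> (\<xi>s ! i) (\<xi>s ! j) u # map (\<lambda>\<xi>. \<xi> u) (nths \<xi>s (- {i, j}))))"
proof -
  define ys where "ys = map (\<lambda>\<xi>. \<xi> u) \<xi>s"
  have lens: "length ys = Suc k" "length xs = Suc k"
    using len xs unfolding ys_def by (auto dest: map_eq_imp_length_eq)
  have "\<forall>i. \<exists>X. X \<in> \<pp> \<and> xs ! i = quo X" using quo_lift by metis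
  then obtain X where X: "\<And>i. X i \<in> \<pp>" "\<And>i. xs ! i = quo (X i)" by metis
  have ysX: "ys ! i = \<tau> (X i)" if "i \<le> k" for i
    using arg_cong[OF xs, of "\<lambda>l. l ! i"] that lens len by (simp add: ys_def X(2))
  have \<xi>X: "(\<xi>s ! i) u = \<tau> (X i)" if "i \<le> k" for i using ysX[OF that] that len by (simp add: ys_def)
  have \<xi>i: "\<xi>s ! i \<in> sections \<G> (actT \<G>) UNIV" if "i \<le> k" for i using \<xi>s that len by auto
  \<comment> \<open>\<open>C\<close> and \<open>B\<close> below are the terms common to both sides:
    derivative with frozen arguments plus action, and algebraic bracket. \<open>F\<close> collects
    the terms with a differentiated argument, which occur on the right only and have to cancel
    there.\<close>
  define d where "d = (\<lambda>i j. dir_deriv (cartan_inv u (X i)) (\<xi>s ! j))"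
  define F where "F = (\<lambda>i j. \<phi> u (d i j # nths ys (- {i, j})))"
  define C where "C = (\<lambda>i. dir_deriv (cartan_inv u (X i)) (\<lambda>u'. \<phi> u' (del i ys)) + inf_act (X i) (\<phi> u (del i ys)))"
  define B where "B = (\<lambda>i j. \<phi> u (\<tau> (lb (X i) (X j)) # nths ys (- {i, j})))"
  have mapx: "map prT (nths xs I) = nths ys I" for I using xs by (simp add: nths_map[symmetric] ys_def)
  have map\<xi>: "map (\<lambda>\<xi>. \<xi> u) (nths \<xi>s I) = nths ys I" for I by (simp add: nths_map ys_def)
  have len_del: "length (del i ys) = k" "length (del i \<xi>s) = k" if "i \<le> k" for i
    using that lens len by (simp_all add: length_del)
  have set_del': "set (del i \<xi>s) \<subseteq> sections \<G> (actT \<G>) UNIV" for i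
    using set_del[of i \<xi>s] \<xi>s by (rule subset_trans)
  have del_map: "map (\<lambda>\<xi>. \<xi> u) (del i \<xi>s) = del i ys" for i by (simp add: map_del ys_def)
  have len2: "length (nths ys (- {i, j})) = k - 1" if "i < j" "j \<le> k" for i j
    using nths_remove2[OF that(1), of ys] that lens by (simp add: length_del)
  have lin1: "linear (\<lambda>y. \<phi> u (y # nths ys (- {i, j})))" if "i < j" "j \<le> k" for i j
    using alternating_slot_linear[OF rel_formsD(1)[OF \<phi>], of "[]" "nths ys (- {i, j})" u] len2[OF that] that by simp
  have "twisted_d \<G> \<rho> (\<lambda>u' xs. \<phi> u' (map prT xs)) u xs =
      (\<Sum>i\<le>k. (- 1) ^ i *\<^sub>R C i) + (\<Sum>j\<le>k. \<Sum>i<j. (- 1) ^ (i + j) *\<^sub>R B i j)"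
  proof -
    have 1: "rel_fund_deriv \<G> (xs ! i) (\<lambda>u'. \<phi> u' (map prT (nths xs (- {i})))) u =
        dir_deriv (cartan_inv u (X i)) (\<lambda>u'. \<phi> u' (del i ys))" if "i \<le> k" for i
      using rel_fund_deriv_quo[OF horizontal_form[OF \<phi> len_del(1)[OF that]] X(1)] that lens
      unfolding mapx X(2) by (simp add: nths_remove)
    have 2: "bullet \<G> \<rho> (xs ! i) (\<phi> u (map prT (nths xs (- {i})))) = inf_act (X i) (\<phi> u (del i ys))" if "i \<le> k" for i
      using that lens unfolding mapx X(2) bullet_quo[OF X(1)] by (simp add: nths_remove)
    have 3: "\<phi> u (map prT (brA \<G> (xs ! i) (xs ! j) # nths xs (- {i, j}))) = B i j" for i j
      unfolding list.map mapx X(2) brA_quo[OF X(1) X(1)] B_def ..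
    show ?thesis
      unfolding twisted_d_def lens lessThan_Suc_atMost C_def 3
      by (simp add: 1 2 scaleR_add_right sum.distrib)
  qed
  moreover have "(\<Sum>i\<le>k. (- 1) ^ i *\<^sub>R rel_tractor_connection \<G> \<rho> (\<xi>s ! i)
         (\<lambda>u'. \<phi> u' (map (\<lambda>\<xi>. \<xi> u') (nths \<xi>s (- {i})))) u) =
      (\<Sum>i\<le>k. (- 1) ^ i *\<^sub>R C i) + (\<Sum>j\<le>k. \<Sum>i<j. (- 1) ^ (i + j) *\<^sub>R (F j i - F i j))"
  proof -
    have 1: "rel_tractor_connection \<G> \<rho> (\<xi>s ! i) (\<lambda>u'. \<phi> u' (map (\<lambda>\<xi>. \<xi> u') (nths \<xi>s (- {i})))) u =
        C i + (\<Sum>m<k. (- 1) ^ m *\<^sub>R F i (if m < i then m else Suc m))" if i: "i \<le> k" for i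
    proof -
      have n: "nths \<xi>s (- {i}) = del i \<xi>s" using i len by (simp add: nths_remove)
      note lz = form_leibniz(1)[OF \<phi> set_del' len_del(2)[OF i], where u = u]
        form_leibniz(2)[OF \<phi> set_del' len_del(2)[OF i], where u = u and X = "X i", unfolded del_map]
      \<comment> \<open>Slot \<open>m\<close> of the shortened list is the original argument
        \<open>m\<close> or \<open>Suc m\<close>, according to the side of \<open>i\<close> on which
        it lies; the two orders of deletion in \<open>nths_remove2\<close> correspond to these
        cases.\<close>
      have F: "\<phi> u (dir_deriv (cartan_inv u (X i)) (del i \<xi>s ! m) # del m (del i ys)) = F i (if m < i then m else Suc m)"
        if m: "m < k" for m
      proof (cases "m < i")
        case True
        then show ?thesis
          using nths_remove2[OF True, of ys] i lens m len by (simp add: F_def d_def nth_del insert_commute)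
      next
        case False
        then have "i < Suc m" "Suc m < length ys" using lens m by auto
        from conjunct2[OF nths_remove2[OF this]]
        have "nths ys (- {i, Suc m}) = del m (del i ys)" by simp
        then show ?thesis
          using False i m len by (simp add: F_def d_def nth_del)
      qed
      show ?thesis
        unfolding n rel_tractor_connection_eq[where u = u and \<xi> = "\<xi>s ! i" and X = "X i", OF equivariant_form_on_sections[OF \<phi> set_del' len_del(2)[OF i]] lz(1) X(1) \<xi>X[OF i]]
          lz(2) del_map C_def
        using F by simp
    qed
    show ?thesis
      unfolding sum_over_slots_antisymmetrize[symmetric]
      by (simp add: 1 scaleR_add_right sum.distrib)
  qed
  moreover have "(\<Sum>j\<le>k. \<Sum>i<j. (- 1) ^ (i + j) *\<^sub>R
       \<phi> u (rel_bracket \<G> (\<xi>s ! i) (\<xi>s ! j) u # map (\<lambda>\<xi>. \<xi> u) (nths \<xi>s (- {i, j})))) =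
      (\<Sum>j\<le>k. \<Sum>i<j. (- 1) ^ (i + j) *\<^sub>R (B i j - (F j i - F i j)))"
  proof (intro sum.cong refl)
    fix i j assume "j \<in> {..k}" "i \<in> {..<j}"
    then have ij: "i < j" "j \<le> k" "i \<le> k" by auto
    have br: "rel_bracket \<G> (\<xi>s ! i) (\<xi>s ! j) u = d i j - d j i + \<tau> (lb (X i) (X j))"
      unfolding rel_bracket_eq[OF \<xi>i[OF ij(3)] \<xi>i[OF ij(2)] X(1) \<xi>X[OF ij(3)] X(1) \<xi>X[OF ij(2)]] bracket_at_def d_def ..
    have "{j, i} = {i, j}" by (rule insert_commute)
    then show "(- 1) ^ (i + j) *\<^sub>R \<phi> u (rel_bracket \<G> (\<xi>s ! i) (\<xi>s ! j) u # map (\<lambda>\<xi>. \<xi> u) (nths \<xi>s (- {i, j}))) =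
        (- 1) ^ (i + j) *\<^sub>R (B i j - (F j i - F i j))"
      unfolding map\<xi> br linear_add[OF lin1[OF ij(1,2)]] linear_diff[OF lin1[OF ij(1,2)]] F_def B_def
      by simp
  qed
  ultimately show ?thesis
    by (simp add: scaleR_diff_right sum_subtractf)
qed

end

theorem theorem4p5:
  fixes \<G> :: "('x::{t2_space,second_countable_topology}, 'e::{real_normed_vector,fin_dim_vector},
                'g::fin_dim_vector,
                'u::{t2_space,second_countable_topology}, 'f::{real_normed_vector,fin_dim_vector},
                'b::{t2_space,second_countable_topology}, 'm::{real_normed_vector,fin_dim_vector},
                'r::fin_dim_vector, 't::fin_dim_vector) par_geom"
    and \<rho> :: "'x \<Rightarrow> 'v::fin_dim_vector \<Rightarrow> 'v"
    and k :: nat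
    and \<phi> :: "'u \<Rightarrow> 't list \<Rightarrow> 'v"
    and \<xi>s :: "('u \<Rightarrow> 't) list"
    and u :: 'u
  assumes "parabolic_geometry \<G>"
    and "tractor_rep \<G> \<rho>"
    and "\<phi> \<in> rel_forms \<G> \<rho> k"
    and "length \<xi>s = Suc k"
    and "set \<xi>s \<subseteq> sections \<G> (actT \<G>) UNIV"
  shows "rel_twisted_d \<G> \<rho> \<phi> u (map (\<lambda>\<xi>. \<xi> u) \<xi>s) =
    (\<Sum>i\<le>k. (- 1) ^ i *\<^sub>R
       rel_tractor_connection \<G> \<rho> (\<xi>s ! i)
         (\<lambda>u'. \<phi> u' (map (\<lambda>\<xi>. \<xi> u') (nths \<xi>s (- {i})))) u) +
    (\<Sum>j\<le>k. \<Sum>i<j. (- 1) ^ (i + j) *\<^sub>R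
       \<phi> u (rel_bracket \<G> (\<xi>s ! i) (\<xi>s ! j) u # map (\<lambda>\<xi>. \<xi> u) (nths \<xi>s (- {i, j}))))"
proof -
  interpret tractor_bundle \<G> \<rho> using assms(1,2) by unfold_locales
  note eq = twisted_d_eq[OF assms(3-5)]
  have "\<forall>y. \<exists>x. prT x = y" using \<tau>_lift by metis
  \<comment> \<open>A pointwise choice of preimages is enough, since \<open>twisted_d\<close> takes
    elements of the fibre and not sections.\<close>
  then obtain L where L: "\<And>y. prT (L y) = y" by metis
  have lift: "map prT (map (\<lambda>\<xi>. L (\<xi> u)) \<xi>s) = map (\<lambda>\<xi>. \<xi> u) \<xi>s" by (simp add: L)
  \<comment> \<open>\<open>eq\<close> holds for every lift with the same right-hand side, so
    constancy on the fibre of \<open>map prT\<close> is immediate.\<close>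
  show ?thesis
    unfolding rel_twisted_d_def eq[OF lift, symmetric]
    by (rule descend_eq[where \<pi> = "map prT", OF UNIV_I lift]) (simp only: eq[OF lift] eq)
qed

end
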